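(* Let $(M,\alpha_1,\alpha_2,\phi,g)$ be a metric contact pair manifold with decomposable $\phi$, let $Z_1,Z_2$ be the Reeb vector fields and $Z=Z_1+Z_2$. Let $\mathrm{R}$ be the curvature operator of $g$. Then the metric contact pair $(\alpha_1,\alpha_2,\phi,g)$ is normal if and only if, for all $X,Y\in\Gamma(TM)$, $$\mathrm{R}_{XY}Z=\sum_{i=1}^2\left[\alpha_i(Y_i)X_i-\alpha_i(X_i)Y_i\right],$$ where $X_i$ and $Y_i$, $i=1,2$, are the orthogonal projections of $X$ and $Y$ respectively on (the tangent bundle $T\mathcal{F}_j$ of) the characteristic foliation $\mathcal{F}_j$ of $\alpha_j$, with $j\ne i$, $j\in\{1,2\}$.
   Context: All objects are smooth; $\Gamma(TM)$ is the space of vector fields. Conventions: $d\alpha(X,Y)=\frac12[X\alpha(Y)-Y\alpha(X)-\alpha([X,Y])]$ and $\mathrm{R}_{XY}=\nabla_X\nabla_Y-\nabla_Y\nabla_X-\nabla_{[X,Y]}$, with $\nabla$ the Levi-Civita connection of $g$. Contact pair: a contact pair of type $(h,k)$ ($h,k\ge 0$ integers) on a manifold $M$ is a pair $(\alpha_1,\alpha_2)$ of 1-forms such that $\alpha_1\wedge(d\alpha_1)^h\wedge\alpha_2\wedge(d\alpha_2)^k$ is a volume form, $(d\alpha_1)^{h+1}=0$ and $(d\alpha_2)^{k+1}=0$ (so $\dim M=2h+2k+2$). Its Reeb vector fields $Z_1,Z_2$ are the unique vector fields with $\alpha_i(Z_j)=\delta_{ij}$ and $i_{Z_i}d\alpha_j=0$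 for $i,j=1,2$. The distribution $\ker\alpha_i\cap\ker d\alpha_i$ is integrable and defines the characteristic foliation $\mathcal{F}_i$ of $\alpha_i$; one has $TM=T\mathcal{F}_1\oplus T\mathcal{F}_2$, with $Z_2$ tangent to $\mathcal{F}_1$ and $Z_1$ tangent to $\mathcal{F}_2$. Metric contact pair (MCP): a 4-tuple $(\alpha_1,\alpha_2,\phi,g)$ where $(\alpha_1,\alpha_2)$ is a contact pair on $M$ with Reeb vector fields $Z_1,Z_2$, $\phi$ is an endomorphism field of $TM$ with $\phi^2=-\mathrm{Id}+\alpha_1\otimes Z_1+\alpha_2\otimes Z_2$ and $\phi Z_1=\phi Z_2=0$, and $g$ is a Riemannian metric with $g(X,\phi Y)=(d\alpha_1+d\alpha_2)(X,Y)$ and $g(X,Z_i)=\alpha_i(X)$, $i=1,2$. $\phi$ is decomposable if $\phi(T\mathcal{F}_i)\subset T\mathcal{F}_i$ for $i=1,2$ (for an MCP this is equivalent to orthogonality of $\mathcal{F}_1$ and $\mathcal{F}_2$). The MCP is normal if the two almost complex structures $J=\phi-\alpha_2\otimes Z_1+\alpha_1\otimes Z_2$ and $T=\phi+\alpha_2\otimes Z_1-\alpha_1\otimes Z_2$ are both integrable (equivalently, $[\phi,\phi](X,Y)+2d\alpha_1(X,Y)Z_1+2d\alpha_2(X,Y)Z_2=0$ for all $X,Y$, where $[\phi,\phi](X,Y)=\phi^2[X,Y]-\phi[\phi X,Y]-\phi[X,\phi Y]+[\phi X,\phi Y]$). *)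

theory Defs
  imports "HOL-Analysis.Analysis"
begin

section \<open>Smooth manifolds, tangent vectors and vector fields\<close>

fun Ck_on :: "nat \<Rightarrow> 'e::real_normed_vector set \<Rightarrow> ('e \<Rightarrow> 'f::real_normed_vector) \<Rightarrow> bool" where
  "Ck_on 0 S f \<longleftrightarrow> continuous_on S f"
| "Ck_on (Suc k) S f \<longleftrightarrow>
     (\<forall>x\<in>S. f differentiable (at x)) \<and> (\<forall>v. Ck_on k S (\<lambda>x. frechet_derivative f (at x) v))"

definition Cinf_on :: "'e::real_normed_vector set \<Rightarrow> ('e \<Rightarrow> 'f::real_normed_vector) \<Rightarrow> bool" where
  "Cinf_on S f \<longleftrightarrow> (\<forall>k. Ck_on k S f)"

text \<open>A chart is a pair of a domain and a coordinate map; the values of the map outside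
  the domain are irrelevant.\<close>

type_synonym ('a, 'e) chart = "'a set \<times> ('a \<Rightarrow> 'e)"

definition is_chart :: "('a::topological_space, 'e::euclidean_space) chart \<Rightarrow> bool" where
  "is_chart c \<longleftrightarrow> (case c of (U, \<psi>) \<Rightarrow>
     open U \<and> open (\<psi> ` U) \<and> homeomorphism U (\<psi> ` U) \<psi> (inv_into U \<psi>))"

definition smooth_atlas ::
  "('a::{t2_space,second_countable_topology}, 'e::euclidean_space) chart set \<Rightarrow> bool" where
  "smooth_atlas \<A> \<longleftrightarrow>
     (\<forall>c\<in>\<A>. is_chart c) \<and> (\<Union>(U, \<psi>)\<in>\<A>. U) = UNIV \<and>
     (\<forall>(U, \<psi>)\<in>\<A>. \<forall>(V, \<theta>)\<in>\<A>. Cinf_on (\<psi> ` (U \<inter> V)) (\<theta> \<circ> inv_into U \<psi>))"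

definition Cinf :: "('a::topological_space, 'e::euclidean_space) chart set \<Rightarrow> ('a \<Rightarrow> real) set" where
  "Cinf \<A> = {f. \<forall>(U, \<psi>)\<in>\<A>. Cinf_on (\<psi> ` U) (f \<circ> inv_into U \<psi>)}"

type_synonym 'a tvec = "('a \<Rightarrow> real) \<Rightarrow> real"
type_synonym 'a vfield = "'a \<Rightarrow> 'a tvec"

text \<open>Tangent vectors at p are the derivations at p of the algebra of smooth functions.
  They are set to zero on non-smooth functions, so that equality of tangent vectors is
  equality in HOL.\<close>

definition tangent_space ::
  "('a::topological_space, 'e::euclidean_space) chart set \<Rightarrow> 'a \<Rightarrow> 'a tvec set" where
  "tangent_space \<A> p = {v.
     (\<forall>f\<in>Cinf \<A>. \<forall>h\<in>Cinf \<A>. \<forall>a b. v (\<lambda>q. a * f q + b * h q) = a * v f + b * v h) \<and>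
     (\<forall>f\<in>Cinf \<A>. \<forall>h\<in>Cinf \<A>. v (\<lambda>q. f q * h q) = f p * v h + h p * v f) \<and>
     (\<forall>f. f \<notin> Cinf \<A> \<longrightarrow> v f = 0)}"

definition vfields ::
  "('a::topological_space, 'e::euclidean_space) chart set \<Rightarrow> 'a vfield set" where
  "vfields \<A> = {X. (\<forall>p. X p \<in> tangent_space \<A> p) \<and> (\<forall>f\<in>Cinf \<A>. (\<lambda>p. X p f) \<in> Cinf \<A>)}"

definition vadd :: "'a vfield \<Rightarrow> 'a vfield \<Rightarrow> 'a vfield" where
  "vadd X Y = (\<lambda>p f. X p f + Y p f)"

definition vsub :: "'a vfield \<Rightarrow> 'a vfield \<Rightarrow> 'a vfield" where
  "vsub X Y = (\<lambda>p f. X p f - Y p f)"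

definition vscale :: "('a \<Rightarrow> real) \<Rightarrow> 'a vfield \<Rightarrow> 'a vfield" where
  "vscale h X = (\<lambda>p f. h p * X p f)"

definition lie_bracket :: "'a vfield \<Rightarrow> 'a vfield \<Rightarrow> 'a vfield" where
  "lie_bracket X Y = (\<lambda>p f. X p (\<lambda>q. Y q f) - Y p (\<lambda>q. X q f))"


section \<open>Tensor fields\<close>

text \<open>Tensor fields are given pointwise on tangent vectors; such a field is smooth iff it
  takes smooth vector fields to smooth functions (or smooth vector fields).\<close>

type_synonym 'a oneform = "'a \<Rightarrow> 'a tvec \<Rightarrow> real"
type_synonym 'a endofield = "'a \<Rightarrow> 'a tvec \<Rightarrow> 'a tvec"
type_synonym 'a bilin = "'a \<Rightarrow> 'a tvec \<Rightarrow> 'a tvec \<Rightarrow> real"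

definition one_form ::
  "('a::topological_space, 'e::euclidean_space) chart set \<Rightarrow> 'a oneform \<Rightarrow> bool" where
  "one_form \<A> \<alpha> \<longleftrightarrow>
     (\<forall>p. \<forall>v\<in>tangent_space \<A> p. \<forall>w\<in>tangent_space \<A> p. \<forall>a b.
        \<alpha> p (\<lambda>f. a * v f + b * w f) = a * \<alpha> p v + b * \<alpha> p w) \<and>
     (\<forall>X\<in>vfields \<A>. (\<lambda>p. \<alpha> p (X p)) \<in> Cinf \<A>)"

definition endo_field ::
  "('a::topological_space, 'e::euclidean_space) chart set \<Rightarrow> 'a endofield \<Rightarrow> bool" where
  "endo_field \<A> \<phi> \<longleftrightarrow>
     (\<forall>p. \<forall>v\<in>tangent_space \<A> p. \<phi> p v \<in> tangent_space \<A> p) \<and>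
     (\<forall>p. \<forall>v\<in>tangent_space \<A> p. \<forall>w\<in>tangent_space \<A> p. \<forall>a b.
        \<phi> p (\<lambda>f. a * v f + b * w f) = (\<lambda>f. a * \<phi> p v f + b * \<phi> p w f)) \<and>
     (\<forall>X\<in>vfields \<A>. (\<lambda>p. \<phi> p (X p)) \<in> vfields \<A>)"

definition riemannian_metric ::
  "('a::topological_space, 'e::euclidean_space) chart set \<Rightarrow> 'a bilin \<Rightarrow> bool" where
  "riemannian_metric \<A> g \<longleftrightarrow>
     (\<forall>p. \<forall>u\<in>tangent_space \<A> p. \<forall>v\<in>tangent_space \<A> p. \<forall>w\<in>tangent_space \<A> p. \<forall>a b.
        g p (\<lambda>f. a * u f + b * v f) w = a * g p u w + b * g p v w) \<and>
     (\<forall>p. \<forall>v\<in>tangent_space \<A> p. \<forall>w\<in>tangent_space \<A> p. g p v w = g p w v) \<and>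
     (\<forall>p. \<forall>v\<in>tangent_space \<A> p. v \<noteq> (\<lambda>f. 0) \<longrightarrow> g p v v > 0) \<and>
     (\<forall>X\<in>vfields \<A>. \<forall>Y\<in>vfields \<A>. (\<lambda>p. g p (X p) (Y p)) \<in> Cinf \<A>)"

text \<open>The exterior derivative of a 1-form, with the normalising factor 1/2.\<close>

definition ext_d :: "'a oneform \<Rightarrow> 'a vfield \<Rightarrow> 'a vfield \<Rightarrow> 'a \<Rightarrow> real" where
  "ext_d \<alpha> X Y p =
     (1/2) * (X p (\<lambda>q. \<alpha> q (Y q)) - Y p (\<lambda>q. \<alpha> q (X q)) - \<alpha> p (lie_bracket X Y p))"

text \<open>A differential form of degree r is evaluated on a sequence of vector fields, of which
  only the first r entries matter. The normalisation 1/(r+s)! of the wedge product is the one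
  that goes with the factor 1/2 in the exterior derivative.\<close>

type_synonym 'a dform = "(nat \<Rightarrow> 'a vfield) \<Rightarrow> 'a \<Rightarrow> real"

definition form1 :: "'a oneform \<Rightarrow> 'a dform" where
  "form1 \<alpha> X p = \<alpha> p (X 0 p)"

definition d_form :: "'a oneform \<Rightarrow> 'a dform" where
  "d_form \<alpha> X p = ext_d \<alpha> (X 0) (X 1) p"

definition wedge :: "nat \<Rightarrow> nat \<Rightarrow> 'a dform \<Rightarrow> 'a dform \<Rightarrow> 'a dform" where
  "wedge r s \<omega> \<eta> X p =
     (1 / fact (r + s)) *
     (\<Sum>\<sigma> | \<sigma> permutes {..<r + s}.
        of_int (sign \<sigma>) * \<omega> (\<lambda>i. X (\<sigma> i)) p * \<eta> (\<lambda>i. X (\<sigma> (r + i))) p)"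

primrec two_form_power :: "'a dform \<Rightarrow> nat \<Rightarrow> 'a dform" where
  "two_form_power \<omega> 0 = (\<lambda>X p. 1)"
| "two_form_power \<omega> (Suc m) = wedge 2 (2 * m) \<omega> (two_form_power \<omega> m)"

definition form_vanishes ::
  "('a::topological_space, 'e::euclidean_space) chart set \<Rightarrow> 'a dform \<Rightarrow> bool" where
  "form_vanishes \<A> \<omega> \<longleftrightarrow> (\<forall>X. (\<forall>i. X i \<in> vfields \<A>) \<longrightarrow> (\<forall>p. \<omega> X p = 0))"

definition volume_form ::
  "('a::topological_space, 'e::euclidean_space) chart set \<Rightarrow> nat \<Rightarrow> 'a dform \<Rightarrow> bool" where
  "volume_form \<A> n \<omega> \<longleftrightarrow>
     n = DIM('e) \<and> (\<forall>p. \<exists>X. (\<forall>i. X i \<in> vfields \<A>) \<and> \<omega> X p \<noteq> 0)"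


section \<open>Metric contact pairs\<close>

definition contact_pair ::
  "('a::topological_space, 'e::euclidean_space) chart set \<Rightarrow> nat \<Rightarrow> nat \<Rightarrow>
   'a oneform \<Rightarrow> 'a oneform \<Rightarrow> bool" where
  "contact_pair \<A> h k \<alpha>1 \<alpha>2 \<longleftrightarrow>
     one_form \<A> \<alpha>1 \<and> one_form \<A> \<alpha>2 \<and>
     volume_form \<A> (2*h + 2*k + 2)
       (wedge (2*h + 2) (2*k)
          (wedge (2*h + 1) 1
             (wedge 1 (2*h) (form1 \<alpha>1) (two_form_power (d_form \<alpha>1) h))
             (form1 \<alpha>2))
          (two_form_power (d_form \<alpha>2) k)) \<and>
     form_vanishes \<A> (two_form_power (d_form \<alpha>1) (h + 1)) \<and>
     form_vanishes \<A> (two_form_power (d_form \<alpha>2) (k + 1))"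

definition reeb_fields ::
  "('a::topological_space, 'e::euclidean_space) chart set \<Rightarrow>
   'a oneform \<Rightarrow> 'a oneform \<Rightarrow> 'a vfield \<Rightarrow> 'a vfield \<Rightarrow> bool" where
  "reeb_fields \<A> \<alpha>1 \<alpha>2 Z1 Z2 \<longleftrightarrow>
     Z1 \<in> vfields \<A> \<and> Z2 \<in> vfields \<A> \<and>
     (\<forall>p. \<alpha>1 p (Z1 p) = 1 \<and> \<alpha>1 p (Z2 p) = 0 \<and> \<alpha>2 p (Z1 p) = 0 \<and> \<alpha>2 p (Z2 p) = 1) \<and>
     (\<forall>X\<in>vfields \<A>. \<forall>p.
        ext_d \<alpha>1 Z1 X p = 0 \<and> ext_d \<alpha>2 Z1 X p = 0 \<and>
        ext_d \<alpha>1 Z2 X p = 0 \<and> ext_d \<alpha>2 Z2 X p = 0)"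

text \<open>The tangent space at p of the characteristic foliation of a 1-form, i.e. the intersection
  of the kernels of the form and of its exterior derivative at p. As the exterior derivative
  is defined on vector fields, a tangent vector is represented by a field extending it; every
  tangent vector has such an extension, and the choice of the extension does not matter.\<close>

definition char_space ::
  "('a::topological_space, 'e::euclidean_space) chart set \<Rightarrow> 'a oneform \<Rightarrow> 'a \<Rightarrow> 'a tvec set" where
  "char_space \<A> \<alpha> p =
     {X p | X. X \<in> vfields \<A> \<and> \<alpha> p (X p) = 0 \<and> (\<forall>Y\<in>vfields \<A>. ext_d \<alpha> X Y p = 0)}"

definition metric_contact_pair ::
  "('a::topological_space, 'e::euclidean_space) chart set \<Rightarrow> nat \<Rightarrow> nat \<Rightarrow>
   'a oneform \<Rightarrow> 'a oneform \<Rightarrow> 'a vfield \<Rightarrow> 'a vfield \<Rightarrow> 'a endofield \<Rightarrow> 'a bilin \<Rightarrow> bool" where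
  "metric_contact_pair \<A> h k \<alpha>1 \<alpha>2 Z1 Z2 \<phi> g \<longleftrightarrow>
     contact_pair \<A> h k \<alpha>1 \<alpha>2 \<and> reeb_fields \<A> \<alpha>1 \<alpha>2 Z1 Z2 \<and>
     endo_field \<A> \<phi> \<and>
     (\<forall>p. \<forall>v\<in>tangent_space \<A> p.
        \<phi> p (\<phi> p v) = (\<lambda>f. - v f + \<alpha>1 p v * Z1 p f + \<alpha>2 p v * Z2 p f)) \<and>
     (\<forall>p. \<phi> p (Z1 p) = (\<lambda>f. 0) \<and> \<phi> p (Z2 p) = (\<lambda>f. 0)) \<and>
     riemannian_metric \<A> g \<and>
     (\<forall>X\<in>vfields \<A>. \<forall>Y\<in>vfields \<A>. \<forall>p.
        g p (X p) (\<phi> p (Y p)) = ext_d \<alpha>1 X Y p + ext_d \<alpha>2 X Y p) \<and>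
     (\<forall>p. \<forall>v\<in>tangent_space \<A> p. g p v (Z1 p) = \<alpha>1 p v \<and> g p v (Z2 p) = \<alpha>2 p v)"

definition decomposable ::
  "('a::topological_space, 'e::euclidean_space) chart set \<Rightarrow>
   'a oneform \<Rightarrow> 'a oneform \<Rightarrow> 'a endofield \<Rightarrow> bool" where
  "decomposable \<A> \<alpha>1 \<alpha>2 \<phi> \<longleftrightarrow>
     (\<forall>p. \<phi> p ` char_space \<A> \<alpha>1 p \<subseteq> char_space \<A> \<alpha>1 p \<and>
          \<phi> p ` char_space \<A> \<alpha>2 p \<subseteq> char_space \<A> \<alpha>2 p)"

definition endo_app :: "'a endofield \<Rightarrow> 'a vfield \<Rightarrow> 'a vfield" where
  "endo_app \<phi> X = (\<lambda>p. \<phi> p (X p))"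

definition nijenhuis :: "'a endofield \<Rightarrow> 'a vfield \<Rightarrow> 'a vfield \<Rightarrow> 'a vfield" where
  "nijenhuis \<phi> X Y =
     vadd (vsub (vsub (endo_app \<phi> (endo_app \<phi> (lie_bracket X Y)))
                      (endo_app \<phi> (lie_bracket (endo_app \<phi> X) Y)))
                (endo_app \<phi> (lie_bracket X (endo_app \<phi> Y))))
          (lie_bracket (endo_app \<phi> X) (endo_app \<phi> Y))"

text \<open>Integrability of an almost complex structure, in the sense of vanishing torsion.\<close>

definition integrable_acs ::
  "('a::topological_space, 'e::euclidean_space) chart set \<Rightarrow> 'a endofield \<Rightarrow> bool" where
  "integrable_acs \<A> J \<longleftrightarrow>
     (\<forall>X\<in>vfields \<A>. \<forall>Y\<in>vfields \<A>. nijenhuis J X Y = (\<lambda>p f. 0))"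

definition J_structure ::
  "'a oneform \<Rightarrow> 'a oneform \<Rightarrow> 'a vfield \<Rightarrow> 'a vfield \<Rightarrow> 'a endofield \<Rightarrow> 'a endofield" where
  "J_structure \<alpha>1 \<alpha>2 Z1 Z2 \<phi> = (\<lambda>p v f. \<phi> p v f - \<alpha>2 p v * Z1 p f + \<alpha>1 p v * Z2 p f)"

definition T_structure ::
  "'a oneform \<Rightarrow> 'a oneform \<Rightarrow> 'a vfield \<Rightarrow> 'a vfield \<Rightarrow> 'a endofield \<Rightarrow> 'a endofield" where
  "T_structure \<alpha>1 \<alpha>2 Z1 Z2 \<phi> = (\<lambda>p v f. \<phi> p v f + \<alpha>2 p v * Z1 p f - \<alpha>1 p v * Z2 p f)"

definition normal_pair ::
  "('a::topological_space, 'e::euclidean_space) chart set \<Rightarrow>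
   'a oneform \<Rightarrow> 'a oneform \<Rightarrow> 'a vfield \<Rightarrow> 'a vfield \<Rightarrow> 'a endofield \<Rightarrow> bool" where
  "normal_pair \<A> \<alpha>1 \<alpha>2 Z1 Z2 \<phi> \<longleftrightarrow>
     integrable_acs \<A> (J_structure \<alpha>1 \<alpha>2 Z1 Z2 \<phi>) \<and>
     integrable_acs \<A> (T_structure \<alpha>1 \<alpha>2 Z1 Z2 \<phi>)"


section \<open>Levi-Civita connection, curvature and orthogonal projection\<close>

type_synonym 'a connection = "'a vfield \<Rightarrow> 'a vfield \<Rightarrow> 'a vfield"

definition affine_connection ::
  "('a::topological_space, 'e::euclidean_space) chart set \<Rightarrow> 'a connection \<Rightarrow> bool" where
  "affine_connection \<A> nabla \<longleftrightarrow>
     (\<forall>X\<in>vfields \<A>. \<forall>Y\<in>vfields \<A>. nabla X Y \<in> vfields \<A>) \<and>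
     (\<forall>X\<in>vfields \<A>. \<forall>Y\<in>vfields \<A>. \<forall>W\<in>vfields \<A>.
        nabla (vadd X Y) W = vadd (nabla X W) (nabla Y W) \<and>
        nabla W (vadd X Y) = vadd (nabla W X) (nabla W Y)) \<and>
     (\<forall>h\<in>Cinf \<A>. \<forall>X\<in>vfields \<A>. \<forall>Y\<in>vfields \<A>.
        nabla (vscale h X) Y = vscale h (nabla X Y) \<and>
        nabla X (vscale h Y) = vadd (vscale (\<lambda>p. X p h) Y) (vscale h (nabla X Y)))"

definition levi_civita ::
  "('a::topological_space, 'e::euclidean_space) chart set \<Rightarrow> 'a bilin \<Rightarrow> 'a connection \<Rightarrow> bool" where
  "levi_civita \<A> g nabla \<longleftrightarrow>
     affine_connection \<A> nabla \<and>
     (\<forall>X\<in>vfields \<A>. \<forall>Y\<in>vfields \<A>. vsub (nabla X Y) (nabla Y X) = lie_bracket X Y) \<and>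
     (\<forall>X\<in>vfields \<A>. \<forall>Y\<in>vfields \<A>. \<forall>W\<in>vfields \<A>. \<forall>p.
        X p (\<lambda>q. g q (Y q) (W q)) = g p (nabla X Y p) (W p) + g p (Y p) (nabla X W p))"

definition curvature :: "'a connection \<Rightarrow> 'a vfield \<Rightarrow> 'a vfield \<Rightarrow> 'a vfield \<Rightarrow> 'a vfield" where
  "curvature nabla X Y W =
     vsub (vsub (nabla X (nabla Y W)) (nabla Y (nabla X W))) (nabla (lie_bracket X Y) W)"

definition orth_proj :: "'a bilin \<Rightarrow> 'a \<Rightarrow> 'a tvec set \<Rightarrow> 'a tvec \<Rightarrow> 'a tvec" where
  "orth_proj g p S v = (THE u. u \<in> S \<and> (\<forall>w\<in>S. g p (\<lambda>f. v f - u f) w = 0))"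

end

theory Submission
  imports Defs "HOL-Library.Function_Algebras"
begin

text \<open>Pointwise, the components of the two exterior derivatives along finitely many fields, together
  with the two forms, define a linear map from the vector fields onto the model space, because the
  volume form is annihilated by its kernel. Hence every field splits, at each point, into parts
  tangent to the two foliations, and the inner product of the i-th parts of X and Y is
  \<open>\<alpha>\<^sub>i(X) \<alpha>\<^sub>i(Y) - d\<alpha>\<^sub>i(X, \<phi> Y)\<close>. So no cut-off functions are needed, and both sides of the
  equivalence become identities between smooth functions of global fields.

  Both conditions are equivalent to
  \<open>g((\<nabla>\<^sub>X \<phi>) Y, W) = \<Sum>\<^sub>i \<alpha>\<^sub>i(W) g(X\<^sub>i, Y\<^sub>i) - \<alpha>\<^sub>i(Y) g(X\<^sub>i, W\<^sub>i)\<close>.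
  Normality makes both Reeb fields Killing, and the formula follows as for Kaehler manifolds.
  Conversely, the curvature condition applied to X and Z is a Riccati equation which forces
  \<open>\<nabla>\<^sub>X Z = - \<phi> X\<close>. Once this holds, the closedness of the fundamental form gives
  \<open>g(R(X, Y) Z, W) = g((\<nabla>\<^sub>W \<phi>) X, Y)\<close>.\<close>

section \<open>Smooth functions and vector fields\<close>

text \<open>That the two characteristic distributions span is not a hypothesis; it comes from a
  dimension count. The vanishing powers let at most 2*h and 2*k linear equations cut out the
  radicals of the exterior derivatives, and with the two forms this makes exactly as many
  functionals as the dimension. The resulting splitting exists at one point at a time, with no claim
  that the parts of a field are smooth; hence inner products with the parts are computed from the
  unsplit fields.

  The curvature condition sees only the sum of the Reeb fields, whereas the torsion computation
  needs each of them to be Killing. The Riccati argument works with the sum alone; the formula for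
  the derivative of \<open>\<phi>\<close>, evaluated at each Reeb field, then returns the separate
  statements.

  The factor 1/2 in the exterior derivative makes \<open>d\<alpha>\<close> the skew part of the
  covariant derivative of its Reeb field. So Killing means that \<open>d\<alpha>\<close> is all of
  that derivative, and adding the two equations gives \<open>- \<phi>\<close> without numerical
  factors.\<close>

text \<open>The derivative at x depends on f near x, so agreement on an open set passes to
  derivatives. This lets the derivative of a sum or product be replaced by its formula inside the
  recursion.\<close>

lemma Ck_on_cong:
  assumes "open S" "\<And>x. x \<in> S \<Longrightarrow> f x = g x" "Ck_on k S f"
  shows "Ck_on k S g"
  using assms(2,3)
proof (induction k arbitrary: f g)
  case 0
  then show ?case by (metis Ck_on.simps(1) continuous_on_cong)
next
  case (Suc k)
  have D: "(g has_derivative F) (at x)" if "x \<in> S" "(f has_derivative F) (at x)" for x F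
    by (rule has_derivative_transform_within_open[OF that(2) assms(1) that(1) Suc.prems(1)])
  have d: "g differentiable (at x)" if "x \<in> S" for x
    using D[OF that] Suc.prems(2) that unfolding Ck_on.simps differentiable_def by blast
  have fd: "frechet_derivative f (at x) = frechet_derivative g (at x)" if "x \<in> S" for x
    by (rule frechet_derivative_at[OF D[OF that]])
      (use Suc.prems(2) that in \<open>simp flip: frechet_derivative_works\<close>)
  have "Ck_on k S (\<lambda>x. frechet_derivative g (at x) v)" for v
    by (rule Suc.IH[of "\<lambda>x. frechet_derivative f (at x) v"]) (use fd Suc.prems(2) in auto)
  then show ?case using d by simp
qed

lemma Ck_on_const: "Ck_on k S (\<lambda>x. c)"
proof (induction k arbitrary: c)
  case (Suc k)
  then show ?case by (simp add: frechet_derivative_const)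
qed simp

lemma Ck_on_Suc_imp: "Ck_on (Suc k) S f \<Longrightarrow> Ck_on k S f"
proof (induction k arbitrary: f)
  case 0
  then show ?case
    by (auto intro!: continuous_at_imp_continuous_on differentiable_imp_continuous_within)
next
  case (Suc k)
  have "f differentiable (at x)" if "x \<in> S" for x
    using Suc.prems that by simp
  moreover have "Ck_on k S (\<lambda>x. frechet_derivative f (at x) v)" for v
    by (rule Suc.IH) (use Suc.prems in simp)
  ultimately show ?case by simp
qed

lemma Ck_on_add:
  assumes "open S" "Ck_on k S f" "Ck_on k S g"
  shows "Ck_on k S (\<lambda>x. f x + g x)"
  using assms(2,3)
proof (induction k arbitrary: f g)
  case (Suc k)
  have "Ck_on k S (\<lambda>x. frechet_derivative (\<lambda>x. f x + g x) (at x) v)" for v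
  proof (rule Ck_on_cong[OF assms(1)])
    show "frechet_derivative f (at x) v + frechet_derivative g (at x) v
        = frechet_derivative (\<lambda>x. f x + g x) (at x) v" if "x \<in> S" for x
    proof -
      have "(f has_derivative frechet_derivative f (at x)) (at x)"
        "(g has_derivative frechet_derivative g (at x)) (at x)"
        using Suc.prems that by (simp_all flip: frechet_derivative_works)
      from frechet_derivative_at[OF has_derivative_add[OF this]] show ?thesis by metis
    qed
    show "Ck_on k S (\<lambda>x. frechet_derivative f (at x) v + frechet_derivative g (at x) v)"
      using Suc by simp
  qed
  then show ?case using Suc.prems by auto
qed (auto intro: continuous_intros)

lemma Ck_on_mult:
  fixes f g :: "'e::real_normed_vector \<Rightarrow> real"
  assumes "open S" "Ck_on k S f" "Ck_on k S g"
  shows "Ck_on k S (\<lambda>x. f x * g x)"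
  using assms(2,3)
proof (induction k arbitrary: f g)
  case (Suc k)
  \<comment> \<open>The Leibniz rule multiplies a derivative, of class k, by an undifferentiated
    factor, of class k + 1; the latter has to be lowered to class k.\<close>
  note lower = Suc.prems[THEN Ck_on_Suc_imp]
  have "Ck_on k S (\<lambda>x. frechet_derivative (\<lambda>x. f x * g x) (at x) v)" for v
  proof (rule Ck_on_cong[OF assms(1)])
    show "f x * frechet_derivative g (at x) v + frechet_derivative f (at x) v * g x
        = frechet_derivative (\<lambda>x. f x * g x) (at x) v" if "x \<in> S" for x
    proof -
      have "(f has_derivative frechet_derivative f (at x)) (at x)"
        "(g has_derivative frechet_derivative g (at x)) (at x)"
        using Suc.prems that by (simp_all flip: frechet_derivative_works)
      from frechet_derivative_at[OF has_derivative_mult[OF this]] show ?thesis by metis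
    qed
    show "Ck_on k S (\<lambda>x. f x * frechet_derivative g (at x) v
        + frechet_derivative f (at x) v * g x)"
      using Suc.prems lower by (intro Ck_on_add[OF assms(1)] Suc.IH) auto
  qed
  then show ?case using Suc.prems by auto
qed (auto intro: continuous_intros)


locale smooth_manifold =
  fixes \<A> :: "('a::{t2_space,second_countable_topology}, 'e::euclidean_space) chart set"
  assumes atlas: "smooth_atlas \<A>"
begin

abbreviation "C \<equiv> Cinf \<A>"
abbreviation "V \<equiv> vfields \<A>"

lemma chart_open: "(U, \<psi>) \<in> \<A> \<Longrightarrow> open (\<psi> ` U)"
  using atlas by (auto simp: smooth_atlas_def is_chart_def)

lemma Cinf_const [simp, intro]: "(\<lambda>q. c) \<in> C"
  by (auto simp: Cinf_def Cinf_on_def o_def Ck_on_const)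

lemma Cinf_add [simp, intro]:
  assumes "f \<in> C" "h \<in> C" shows "(\<lambda>q. f q + h q) \<in> C"
  unfolding Cinf_def Cinf_on_def o_def
proof (intro CollectI ballI, clarify)
  fix U \<psi> k assume c: "(U, \<psi>) \<in> \<A>"
  have "Ck_on k (\<psi> ` U) (\<lambda>x. f (inv_into U \<psi> x))" "Ck_on k (\<psi> ` U) (\<lambda>x. h (inv_into U \<psi> x))"
    using assms c by (auto simp: Cinf_def Cinf_on_def o_def)
  then show "Ck_on k (\<psi> ` U) (\<lambda>x. f (inv_into U \<psi> x) + h (inv_into U \<psi> x))"
    by (rule Ck_on_add[OF chart_open[OF c]])
qed

lemma Cinf_mult [simp, intro]:
  assumes "f \<in> C" "h \<in> C" shows "(\<lambda>q. f q * h q) \<in> C"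
  unfolding Cinf_def Cinf_on_def o_def
proof (intro CollectI ballI, clarify)
  fix U \<psi> k assume c: "(U, \<psi>) \<in> \<A>"
  have "Ck_on k (\<psi> ` U) (\<lambda>x. f (inv_into U \<psi> x))" "Ck_on k (\<psi> ` U) (\<lambda>x. h (inv_into U \<psi> x))"
    using assms c by (auto simp: Cinf_def Cinf_on_def o_def)
  then show "Ck_on k (\<psi> ` U) (\<lambda>x. f (inv_into U \<psi> x) * h (inv_into U \<psi> x))"
    by (rule Ck_on_mult[OF chart_open[OF c]])
qed

lemma Cinf_minus [simp, intro]: "f \<in> C \<Longrightarrow> (\<lambda>q. - f q) \<in> C"
  using Cinf_mult[of "\<lambda>q. -1" f] by simp

lemma Cinf_diff [simp, intro]: "f \<in> C \<Longrightarrow> h \<in> C \<Longrightarrow> (\<lambda>q. f q - h q) \<in> C"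
  using Cinf_add[of f "\<lambda>q. - h q"] by simp

lemma tangent_lincomb:
  "v \<in> tangent_space \<A> p \<Longrightarrow> f \<in> C \<Longrightarrow> h \<in> C \<Longrightarrow>
    v (\<lambda>q. a * f q + b * h q) = a * v f + b * v h"
  by (simp add: tangent_space_def)

lemma tangent_mult:
  "v \<in> tangent_space \<A> p \<Longrightarrow> f \<in> C \<Longrightarrow> h \<in> C \<Longrightarrow> v (\<lambda>q. f q * h q) = f p * v h + h p * v f"
  by (simp add: tangent_space_def)

lemma tangent_nonsmooth: "v \<in> tangent_space \<A> p \<Longrightarrow> f \<notin> C \<Longrightarrow> v f = 0"
  by (simp add: tangent_space_def)

lemma tangent_add:
  "v \<in> tangent_space \<A> p \<Longrightarrow> f \<in> C \<Longrightarrow> h \<in> C \<Longrightarrow> v (\<lambda>q. f q + h q) = v f + v h"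
  using tangent_lincomb[of v p f h 1 1] by simp

lemma tangent_diff:
  "v \<in> tangent_space \<A> p \<Longrightarrow> f \<in> C \<Longrightarrow> h \<in> C \<Longrightarrow> v (\<lambda>q. f q - h q) = v f - v h"
  using tangent_lincomb[of v p f h 1 "-1"] by simp

lemma tangent_minus: "v \<in> tangent_space \<A> p \<Longrightarrow> f \<in> C \<Longrightarrow> v (\<lambda>q. - f q) = - v f"
  using tangent_lincomb[of v p f f "-1" 0] by simp

lemma tangent_const: "v \<in> tangent_space \<A> p \<Longrightarrow> v (\<lambda>q. c) = 0"
proof -
  assume v: "v \<in> tangent_space \<A> p"
  have "v (\<lambda>q. 1) = 0"
    using tangent_mult[OF v, of "\<lambda>q. 1" "\<lambda>q. 1"] by simp
  then show ?thesis
    using tangent_lincomb[OF v, of "\<lambda>q. 1" "\<lambda>q. 1" c 0] by simp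
qed

lemma tangent_space_lincomb:
  assumes "v \<in> tangent_space \<A> p" "w \<in> tangent_space \<A> p"
  shows "(\<lambda>f. a * v f + b * w f) \<in> tangent_space \<A> p"
  unfolding tangent_space_def
proof (intro CollectI conjI ballI allI impI)
  fix f h c d assume fh: "f \<in> C" "h \<in> C"
  show "a * v (\<lambda>q. c * f q + d * h q) + b * w (\<lambda>q. c * f q + d * h q)
      = c * (a * v f + b * w f) + d * (a * v h + b * w h)"
    by (simp only: tangent_lincomb[OF assms(1) fh] tangent_lincomb[OF assms(2) fh])
      (simp add: algebra_simps)
  show "a * v (\<lambda>q. f q * h q) + b * w (\<lambda>q. f q * h q)
      = f p * (a * v h + b * w h) + h p * (a * v f + b * w f)"
    by (simp only: tangent_mult[OF assms(1) fh] tangent_mult[OF assms(2) fh])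
      (simp add: algebra_simps)
next
  show "a * v f + b * w f = 0" if "f \<notin> C" for f
    using tangent_nonsmooth[OF assms(1) that] tangent_nonsmooth[OF assms(2) that] by simp
qed

lemma vf_tangent: "X \<in> V \<Longrightarrow> X p \<in> tangent_space \<A> p"
  unfolding vfields_def by blast

lemma vf_smooth: "X \<in> V \<Longrightarrow> f \<in> C \<Longrightarrow> (\<lambda>q. X q f) \<in> C"
  unfolding vfields_def by blast

lemmas vf_add = tangent_add[OF vf_tangent]
  and vf_diff = tangent_diff[OF vf_tangent]
  and vf_minus = tangent_minus[OF vf_tangent]
  and vf_mult = tangent_mult[OF vf_tangent]
  and vf_const = tangent_const[OF vf_tangent]

lemma vf_lincomb [simp, intro]:
  assumes "a \<in> C" "b \<in> C" "X \<in> V" "Y \<in> V"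
  shows "(\<lambda>p f. a p * X p f + b p * Y p f) \<in> V"
  unfolding vfields_def
proof (intro CollectI conjI ballI allI)
  show "(\<lambda>f. a p * X p f + b p * Y p f) \<in> tangent_space \<A> p" for p
    using assms by (intro tangent_space_lincomb vf_tangent)
  show "(\<lambda>p. a p * X p f + b p * Y p f) \<in> C" if "f \<in> C" for f
    by (intro Cinf_add Cinf_mult vf_smooth[OF assms(3)] vf_smooth[OF assms(4)] assms that)
qed

lemma vfields_plus [simp, intro]: "X \<in> V \<Longrightarrow> Y \<in> V \<Longrightarrow> X + Y \<in> V"
  by (rule subst[of _ _ "\<lambda>W. W \<in> V", OF _ vf_lincomb[of "\<lambda>p. 1" "\<lambda>p. 1" X Y]])
    (auto simp: fun_eq_iff vscale_def)

lemma vfields_minus [simp, intro]: "X \<in> V \<Longrightarrow> Y \<in> V \<Longrightarrow> X - Y \<in> V"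
  by (rule subst[of _ _ "\<lambda>W. W \<in> V", OF _ vf_lincomb[of "\<lambda>p. 1" "\<lambda>p. -1" X Y]])
    (auto simp: fun_eq_iff vscale_def)

lemma vfields_uminus [simp, intro]: "X \<in> V \<Longrightarrow> - X \<in> V"
  by (rule subst[of _ _ "\<lambda>W. W \<in> V", OF _ vf_lincomb[of "\<lambda>p. -1" "\<lambda>p. 0" X X]])
    (auto simp: fun_eq_iff vscale_def)

lemma vfields_vscale [simp, intro]: "a \<in> C \<Longrightarrow> X \<in> V \<Longrightarrow> vscale a X \<in> V"
  by (rule subst[of _ _ "\<lambda>W. W \<in> V", OF _ vf_lincomb[of a "\<lambda>p. 0" X X]])
    (auto simp: fun_eq_iff vscale_def)

lemma lie_bracket_apply: "lie_bracket X Y p f = X p (\<lambda>q. Y q f) - Y p (\<lambda>q. X q f)"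
  by (simp add: lie_bracket_def)

lemma lie_bracket_closed [simp, intro]:
  assumes X: "X \<in> V" and Y: "Y \<in> V"
  shows "lie_bracket X Y \<in> V"
proof -
  have lin: "W q (\<lambda>q. a * f q + b * h q) = a * W q f + b * W q h"
    if "W \<in> V" "f \<in> C" "h \<in> C" for W q f h a b
    using tangent_lincomb[OF vf_tangent] that by simp
  have prod: "W p (\<lambda>q. f q * U q h + h q * U q f)
      = f p * W p (\<lambda>q. U q h) + U p h * W p f + (h p * W p (\<lambda>q. U q f) + U p f * W p h)"
    if "W \<in> V" "U \<in> V" "f \<in> C" "h \<in> C" for W U p f h
    by (simp add: vf_add[OF that(1)] vf_mult[OF that(1)] vf_smooth[OF that(2)] that(3,4))
  have "lie_bracket X Y p \<in> tangent_space \<A> p" for p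
    unfolding tangent_space_def
  proof (intro CollectI conjI ballI allI impI)
    show "lie_bracket X Y p (\<lambda>q. a * f q + b * h q)
        = a * lie_bracket X Y p f + b * lie_bracket X Y p h"
      if "f \<in> C" "h \<in> C" for f h a b
      using that
      by (simp add: lie_bracket_apply lin[OF X] lin[OF Y] vf_smooth[OF X] vf_smooth[OF Y])
        (simp add: algebra_simps)
    show "lie_bracket X Y p (\<lambda>q. f q * h q)
        = f p * lie_bracket X Y p h + h p * lie_bracket X Y p f"
      if "f \<in> C" "h \<in> C" for f h
      using that
      by (simp add: lie_bracket_apply vf_mult[OF X] vf_mult[OF Y] prod[OF X Y] prod[OF Y X])
        (simp add: algebra_simps)
    \<comment> \<open>For a non-smooth f the inner derivative is the zero function, which is smooth
      and is killed by the outer derivation.\<close>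
    show "lie_bracket X Y p f = 0" if "f \<notin> C" for f
      using that
      by (simp add: lie_bracket_apply tangent_nonsmooth[OF vf_tangent[OF X]]
          tangent_nonsmooth[OF vf_tangent[OF Y]] vf_const[OF X] vf_const[OF Y])
  qed
  then show ?thesis
    by (auto simp: vfields_def[of \<A>] lie_bracket_apply vf_smooth[OF X] vf_smooth[OF Y])
qed

end

section \<open>Powers of an alternating form\<close>

text \<open>Up to a factorial this is the Pfaffian of the matrix A.\<close>

definition matching_sum :: "nat \<Rightarrow> (nat \<Rightarrow> nat \<Rightarrow> real) \<Rightarrow> real" where
  "matching_sum m A = (\<Sum>\<sigma> | \<sigma> permutes {..<2*m}.
     of_int (sign \<sigma>) * (\<Prod>i<m. A (\<sigma> (2*i)) (\<sigma> (2*i+1))))"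

text \<open>A permutation of the arguments of the second factor of \<open>wedge 2 n\<close>, seen as
  a permutation of all arguments that fixes the first two positions.\<close>

definition shift2 :: "nat \<Rightarrow> (nat \<Rightarrow> nat) \<Rightarrow> nat \<Rightarrow> nat" where
  "shift2 n \<tau> = map_permutation {..<n} (\<lambda>i. i + 2) \<tau>"

lemma bij_betw_add2: "bij_betw (\<lambda>i::nat. i + 2) {..<n} {2..<n+2}"
  by (rule bij_betw_byWitness[where f' = "\<lambda>i. i - 2"]) auto

lemma shift2_permutes: "\<tau> permutes {..<n} \<Longrightarrow> shift2 n \<tau> permutes {2..<n+2}"
  unfolding shift2_def by (rule map_permutation_permutes[OF bij_betw_add2])

lemma shift2_permutes': "\<tau> permutes {..<n} \<Longrightarrow> shift2 n \<tau> permutes {..<n+2}"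
  by (rule permutes_subset[OF shift2_permutes]) auto

lemma shift2_apply: "i < n \<Longrightarrow> shift2 n \<tau> (i + 2) = \<tau> i + 2"
  unfolding shift2_def using map_permutation_apply[of "\<lambda>i::nat. i + 2" "{..<n}" i \<tau>]
  by (auto simp: inj_on_def)

lemma shift2_low: "\<tau> permutes {..<n} \<Longrightarrow> i < 2 \<Longrightarrow> shift2 n \<tau> i = i"
  by (rule permutes_not_in[OF shift2_permutes]) auto

lemma sign_shift2: "\<tau> permutes {..<n} \<Longrightarrow> sign (shift2 n \<tau>) = sign \<tau>"
  unfolding shift2_def by (rule sign_map_permutation) (auto simp: inj_on_def)

lemma bij_betw_shift2:
  "bij_betw (shift2 n) {\<tau>. \<tau> permutes {..<n}} {\<sigma>. \<sigma> permutes {2..<n+2}}"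
proof (rule bij_betw_byWitness[where f' = "map_permutation {2..<n+2} (\<lambda>i. i - 2)"])
  have b: "bij_betw (\<lambda>i. i - 2) {2..<n+2} {..<n}"
    by (rule bij_betw_byWitness[where f' = "\<lambda>i. i + 2"]) auto
  show "\<forall>\<tau>\<in>{\<tau>. \<tau> permutes {..<n}}.
      map_permutation {2..<n+2} (\<lambda>i. i - 2) (shift2 n \<tau>) = \<tau>"
    unfolding shift2_def using map_permutation_compose_inv[OF bij_betw_add2[of n]] by auto
  show "\<forall>\<sigma>\<in>{\<sigma>. \<sigma> permutes {2..<n+2}}.
      shift2 n (map_permutation {2..<n+2} (\<lambda>i. i - 2) \<sigma>) = \<sigma>"
    unfolding shift2_def
  proof (intro ballI, rule map_permutation_compose_inv[OF b])
    show "\<And>\<sigma>. \<sigma> \<in> {\<sigma>. \<sigma> permutes {2..<n + 2}} \<Longrightarrow> \<sigma> permutes {2..<n + 2}" by simp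
  qed auto
  show "shift2 n ` {\<tau>. \<tau> permutes {..<n}} \<subseteq> {\<sigma>. \<sigma> permutes {2..<n+2}}"
    using shift2_permutes by auto
  show "map_permutation {2..<n+2} (\<lambda>i. i - 2) ` {\<sigma>. \<sigma> permutes {2..<n+2}}
      \<subseteq> {\<tau>. \<tau> permutes {..<n}}"
    using map_permutation_permutes[OF b] by auto
qed

text \<open>In the nested sum, composing with the shifted inner permutation \<tau> permutes the
  outer ones. Each \<tau> thus contributes the same full sum, and their number
  \<open>fact (2*m)\<close> cancels the normalisation of the inner power.\<close>

lemma two_form_power_eq_matching_sum:
  "two_form_power \<omega> m X p = matching_sum m (\<lambda>i j. \<omega> (\<lambda>l. if l = 0 then X i else X j) p) / fact (2*m)"
  if \<omega>: "\<And>Y. \<omega> Y p = \<omega> (\<lambda>l. if l = 0 then Y 0 else Y 1) p"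
proof (induction m arbitrary: X)
  case 0
  then show ?case by (simp add: matching_sum_def)
next
  case (Suc m)
  define A where "A = (\<lambda>i j. \<omega> (\<lambda>l. if l = 0 then X i else X j) p)"
  define S where "S = {\<sigma>. \<sigma> permutes {..<2+2*m}}"
  define S' where "S' = {\<tau>. \<tau> permutes {..<2*m}}"
  define T where "T = (\<lambda>\<sigma>. of_int (sign \<sigma>) * (\<Prod>i<Suc m. A (\<sigma> (2*i)) (\<sigma> (2*i+1))))"
  have fin: "finite S" "finite S'" by (simp_all add: S_def S'_def finite_permutations)
  have term1: "\<omega> (\<lambda>i. X (\<sigma> i)) p = A (\<sigma> 0) (\<sigma> 1)" for \<sigma>
    unfolding A_def by (subst \<omega>) simp
  have term2: "of_int (sign \<sigma>) * A (\<sigma> 0) (\<sigma> 1) *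
      (of_int (sign \<tau>) * (\<Prod>i<m. A (\<sigma> (2 + \<tau> (2*i))) (\<sigma> (2 + \<tau> (2*i+1)))))
      = T (\<sigma> \<circ> shift2 (2*m) \<tau>)" if \<sigma>: "\<sigma> \<in> S" and \<tau>: "\<tau> \<in> S'" for \<sigma> \<tau>
  proof -
    have \<tau>': "\<tau> permutes {..<2*m}" using \<tau> by (simp add: S'_def)
    have "sign (\<sigma> \<circ> shift2 (2*m) \<tau>) = sign \<sigma> * sign \<tau>"
      using sign_compose[of \<sigma> "shift2 (2*m) \<tau>"] sign_shift2[OF \<tau>'] \<sigma>
        shift2_permutes'[OF \<tau>'] by (auto simp: S_def permutation_permutes)
    moreover have "shift2 (2*m) \<tau> (2 * Suc i) = 2 + \<tau> (2*i)"
      "shift2 (2*m) \<tau> (2 * Suc i + 1) = 2 + \<tau> (2*i+1)" if "i < m" for i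
      using shift2_apply[of "2*i" "2*m" \<tau>] shift2_apply[of "2*i+1" "2*m" \<tau>] that by simp_all
    then have "(\<Prod>i<Suc m. A ((\<sigma> \<circ> shift2 (2*m) \<tau>) (2*i)) ((\<sigma> \<circ> shift2 (2*m) \<tau>) (2*i+1)))
      = A (\<sigma> 0) (\<sigma> 1) * (\<Prod>i<m. A (\<sigma> (2 + \<tau> (2*i))) (\<sigma> (2 + \<tau> (2*i+1))))"
      unfolding prod.lessThan_Suc_shift using shift2_low[OF \<tau>'] by simp
    ultimately show ?thesis by (simp add: T_def)
  qed
  have "two_form_power \<omega> (Suc m) X p = 1 / fact (2+2*m) * (\<Sum>\<sigma>\<in>S. of_int (sign \<sigma>) * A (\<sigma> 0) (\<sigma> 1) *
      (matching_sum m (\<lambda>i j. A (\<sigma> (2+i)) (\<sigma> (2+j))) / fact (2*m)))"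
    unfolding two_form_power.simps wedge_def Suc.IH term1 by (simp only: S_def A_def)
  also have "\<dots> = (\<Sum>\<sigma>\<in>S. \<Sum>\<tau>\<in>S'. T (\<sigma> \<circ> shift2 (2*m) \<tau>)) / (fact (2+2*m) * fact (2*m))"
    unfolding matching_sum_def S'_def[symmetric] sum_divide_distrib sum_distrib_left
    by (intro sum.cong refl) (simp add: term2[symmetric] sum_divide_distrib sum_distrib_left)
  also have "(\<Sum>\<sigma>\<in>S. \<Sum>\<tau>\<in>S'. T (\<sigma> \<circ> shift2 (2*m) \<tau>)) = (\<Sum>\<tau>\<in>S'. \<Sum>\<sigma>\<in>S. T (\<sigma> \<circ> shift2 (2*m) \<tau>))"
    by (rule sum.swap)
  also have "\<dots> = (\<Sum>\<tau>\<in>S'. \<Sum>\<sigma>\<in>S. T \<sigma>)"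
  proof (rule sum.cong[OF refl])
    fix \<tau> assume "\<tau> \<in> S'"
    then have "shift2 (2*m) \<tau> permutes {..<2+2*m}"
      using shift2_permutes'[of \<tau> "2*m"] by (simp add: S'_def add.commute)
    from sum_permutations_compose_right[OF this, of T]
    show "(\<Sum>\<sigma>\<in>S. T (\<sigma> \<circ> shift2 (2*m) \<tau>)) = (\<Sum>\<sigma>\<in>S. T \<sigma>)" by (simp add: S_def)
  qed
  also have "\<dots> = fact (2*m) * matching_sum (Suc m) A"
    unfolding matching_sum_def T_def S_def S'_def by (simp add: card_permutations)
  finally show ?case by (simp add: A_def)
qed

text \<open>Expansion of a Pfaffian along a row with a single entry that may be nonzero. The index 0
  can stand at any of the 2*m+2 positions with equal contributions, which is the origin of the
  factor.\<close>

lemma matching_sum_first_row: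
  assumes anti: "\<And>i j. A i j = - A j i" and row: "\<And>j. 2 \<le> j \<Longrightarrow> j < 2*m+2 \<Longrightarrow> A 0 j = 0"
  shows "matching_sum (Suc m) A = (2*m+2) * A 0 1 * matching_sum m (\<lambda>i j. A (i+2) (j+2))"
proof -
  define N where "N = {..<2*m+2}"
  define S where "S = {\<sigma>. \<sigma> permutes N}"
  define T where "T = (\<lambda>\<sigma>. of_int (sign \<sigma>) * (\<Prod>i<Suc m. A (\<sigma> (2*i)) (\<sigma> (2*i+1))))"
  have finS: "finite S" by (simp add: S_def N_def finite_permutations)
  have perm: "permutation \<sigma>" if "\<sigma> \<in> S" for \<sigma>
    using that by (auto simp: S_def N_def permutation_permutes)
  \<comment> \<open>T is invariant under exchanging the pair at position 0 with the pair at position i, and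
    under exchanging the two members of a pair; hence the place where the index 0 occurs in
    the matching does not matter.\<close>
  define \<beta> where "\<beta> = (\<lambda>i. Transposition.transpose 0 (2*i) \<circ> Transposition.transpose 1 (2*i+1) :: nat \<Rightarrow> nat)"
  have \<beta>S: "\<beta> i permutes N" if "i \<le> m" for i
    unfolding \<beta>_def N_def using that by (intro permutes_compose permutes_swap_id) auto
  have sgn\<beta>: "sign (\<beta> i) = 1" for i
    unfolding \<beta>_def by (subst sign_compose) (auto simp: sign_swap_id permutation_swap_id)
  have \<beta>even: "\<beta> i (2*l) = 2 * Transposition.transpose 0 i l" for i l
    unfolding \<beta>_def by (auto simp: Transposition.transpose_def; presburger)
  have \<beta>odd: "\<beta> i (2*l+1) = 2 * Transposition.transpose 0 i l + 1" for i l
    unfolding \<beta>_def by (auto simp: Transposition.transpose_def; presburger)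
  have T\<beta>: "T (\<sigma> \<circ> \<beta> i) = T \<sigma>" if "\<sigma> \<in> S" "i \<le> m" for \<sigma> i
  proof -
    have "sign (\<sigma> \<circ> \<beta> i) = sign \<sigma>"
      using that \<beta>S[of i] perm sgn\<beta> by (subst sign_compose) (auto simp: permutation_permutes N_def)
    moreover have "(\<Prod>l<Suc m. A (\<sigma> (\<beta> i (2*l))) (\<sigma> (\<beta> i (2*l+1))))
        = (\<Prod>l<Suc m. A (\<sigma> (2*l)) (\<sigma> (2*l+1)))"
      unfolding \<beta>even \<beta>odd
      by (rule prod.reindex_bij_betw[of "Transposition.transpose 0 i" "{..<Suc m}" "{..<Suc m}"
            "\<lambda>l. A (\<sigma> (2*l)) (\<sigma> (2*l+1))"])
        (use that in \<open>intro permutes_imp_bij permutes_swap_id; auto\<close>)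
    ultimately show ?thesis by (simp add: T_def)
  qed
  define \<gamma> where "\<gamma> = (\<lambda>i. Transposition.transpose (2*i) (2*i+1) :: nat \<Rightarrow> nat)"
  have \<gamma>S: "\<gamma> i permutes N" if "i \<le> m" for i
    unfolding \<gamma>_def N_def using that by (intro permutes_swap_id) auto
  have T\<gamma>: "T (\<sigma> \<circ> \<gamma> i) = T \<sigma>" if "\<sigma> \<in> S" "i \<le> m" for \<sigma> i
  proof -
    have s: "sign (\<sigma> \<circ> \<gamma> i) = - sign \<sigma>"
      using that perm by (subst sign_compose) (auto simp: \<gamma>_def sign_swap_id permutation_swap_id)
    have i: "i \<in> {..<Suc m}" using that by simp
    have other: "\<gamma> i (2*l) = 2*l \<and> \<gamma> i (2*l+1) = 2*l+1" if "l \<noteq> i" for l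
      unfolding \<gamma>_def using that by (auto simp: Transposition.transpose_def; presburger)
    have "(\<Prod>l<Suc m. A (\<sigma> (\<gamma> i (2*l))) (\<sigma> (\<gamma> i (2*l+1))))
        = A (\<sigma> (2*i+1)) (\<sigma> (2*i)) * (\<Prod>l\<in>{..<Suc m}-{i}. A (\<sigma> (2*l)) (\<sigma> (2*l+1)))"
      by (subst prod.remove[OF _ i]) (use other in \<open>auto simp: \<gamma>_def intro!: prod.cong\<close>)
    also have "\<dots> = - (\<Prod>l<Suc m. A (\<sigma> (2*l)) (\<sigma> (2*l+1)))"
      unfolding prod.remove[OF finite_lessThan i, of "\<lambda>l. A (\<sigma> (2*l)) (\<sigma> (2*l+1))"]
      using anti[of "\<sigma> (2*i+1)" "\<sigma> (2*i)"] by simp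
    finally show ?thesis using s by (simp add: T_def)
  qed
  define G where "G = (\<Sum>\<sigma> | \<sigma> \<in> S \<and> \<sigma> 0 = 0. T \<sigma>)"
  have place: "(\<Sum>\<sigma> | \<sigma> \<in> S \<and> \<sigma> q = 0. T \<sigma>) = G" if "q \<in> N" for q
  proof -
    \<comment> \<open>An odd position is first exchanged with its partner; then its pair is moved to
      the front.\<close>
    obtain \<delta> where \<delta>: "\<delta> permutes N" "\<delta> q = 0" "\<And>\<sigma>. \<sigma> \<in> S \<Longrightarrow> T (\<sigma> \<circ> \<delta>) = T \<sigma>"
    proof (cases "even q")
      case True
      then obtain i where "q = 2*i" by blast
      then show ?thesis using that[of "\<beta> i"] \<beta>S T\<beta> \<beta>even[of i i] \<open>q \<in> N\<close> by (auto simp: N_def)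
    next
      case False
      then obtain i where q: "q = 2*i+1" by (blast elim: oddE)
      have comp: "\<sigma> \<circ> \<beta> i \<in> S" if "\<sigma> \<in> S" for \<sigma>
        using that \<beta>S[of i] q \<open>q \<in> N\<close> by (auto simp: S_def N_def intro: permutes_compose)
      have "(\<beta> i \<circ> \<gamma> i) q = 0" using q \<beta>even[of i i] by (simp add: \<gamma>_def)
      moreover have "T (\<sigma> \<circ> (\<beta> i \<circ> \<gamma> i)) = T \<sigma>" if "\<sigma> \<in> S" for \<sigma>
        using T\<gamma>[OF comp[OF that], of i] T\<beta>[OF that, of i] q \<open>q \<in> N\<close> by (simp add: N_def o_assoc)
      ultimately show ?thesis
        using that[of "\<beta> i \<circ> \<gamma> i"] \<beta>S[of i] \<gamma>S[of i] q \<open>q \<in> N\<close>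
        by (auto simp: N_def intro: permutes_compose)
    qed
    have "inv \<delta> 0 = q" using \<delta> permutes_inverses(2)[OF \<delta>(1), of q] by simp
    have "bij_betw (\<lambda>\<sigma>. \<sigma> \<circ> \<delta>) {\<sigma>. \<sigma> \<in> S \<and> \<sigma> 0 = 0} {\<sigma>. \<sigma> \<in> S \<and> \<sigma> q = 0}"
      by (rule bij_betw_byWitness[where f' = "\<lambda>\<sigma>. \<sigma> \<circ> inv \<delta>"])
        (use \<delta>(1,2) \<open>inv \<delta> 0 = q\<close> in \<open>auto simp: S_def comp_assoc permutes_inv_o
          intro: permutes_compose permutes_inv\<close>)
    from sum.reindex_bij_betw[OF this, of T]
    have "(\<Sum>\<sigma> | \<sigma> \<in> S \<and> \<sigma> q = 0. T \<sigma>) = (\<Sum>\<sigma> | \<sigma> \<in> S \<and> \<sigma> 0 = 0. T (\<sigma> \<circ> \<delta>))" by simp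
    also have "\<dots> = G" unfolding G_def by (rule sum.cong) (use \<delta>(3) in auto)
    finally show ?thesis .
  qed
  have "matching_sum (Suc m) A = (\<Sum>\<sigma>\<in>S. T \<sigma>)"
    by (simp add: matching_sum_def T_def S_def N_def)
  also have "\<dots> = (\<Sum>q\<in>N. \<Sum>\<sigma> | \<sigma> \<in> S \<and> inv \<sigma> 0 = q. T \<sigma>)"
    by (rule sum.group[symmetric])
      (use finS permutes_in_image[OF permutes_inv, of _ N 0] in \<open>auto simp: S_def N_def\<close>)
  also have "\<dots> = (\<Sum>q\<in>N. G)"
  proof (rule sum.cong[OF refl])
    fix q assume "q \<in> N"
    have "{\<sigma>. \<sigma> \<in> S \<and> inv \<sigma> 0 = q} = {\<sigma>. \<sigma> \<in> S \<and> \<sigma> q = 0}"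
      by (auto simp: S_def permutes_inverses permutes_inv_eq)
    with place[OF \<open>q \<in> N\<close>] show "(\<Sum>\<sigma> | \<sigma> \<in> S \<and> inv \<sigma> 0 = q. T \<sigma>) = G" by simp
  qed
  also have "\<dots> = (2*m+2) * G" by (simp add: N_def)
  \<comment> \<open>Once 0 stands first, the leading factor \<open>A 0 (\<sigma> 1)\<close> vanishes
    by \<open>row\<close> unless 1 stands second.\<close>
  also have "G = (\<Sum>\<sigma> | \<sigma> \<in> S \<and> \<sigma> 0 = 0 \<and> \<sigma> 1 = 1. T \<sigma>)"
    unfolding G_def
  proof (rule sum.mono_neutral_right)
    show "\<forall>\<sigma>\<in>{\<sigma> \<in> S. \<sigma> 0 = 0} - {\<sigma> \<in> S. \<sigma> 0 = 0 \<and> \<sigma> 1 = 1}. T \<sigma> = 0"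
    proof
      fix \<sigma> assume "\<sigma> \<in> {\<sigma> \<in> S. \<sigma> 0 = 0} - {\<sigma> \<in> S. \<sigma> 0 = 0 \<and> \<sigma> 1 = 1}"
      then have \<sigma>: "\<sigma> permutes N" "\<sigma> 0 = 0" "\<sigma> 1 \<noteq> 1" by (auto simp: S_def)
      have "\<sigma> 1 \<noteq> \<sigma> 0" using permutes_inj[OF \<sigma>(1)] by (auto dest: injD)
      moreover have "\<sigma> 1 < 2*m+2" using permutes_in_image[OF \<sigma>(1), of 1] by (simp add: N_def)
      ultimately have "A 0 (\<sigma> 1) = 0" using \<sigma> by (intro row) auto
      then show "T \<sigma> = 0" unfolding T_def prod.lessThan_Suc_shift using \<sigma> by simp
    qed
  qed (use finS in auto)
  also have "{\<sigma>. \<sigma> \<in> S \<and> \<sigma> 0 = 0 \<and> \<sigma> 1 = 1} = {\<sigma>. \<sigma> permutes {2..<2*m+2}}"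
  proof (intro set_eqI iffI CollectI)
    fix \<sigma> assume "\<sigma> \<in> {\<sigma>. \<sigma> \<in> S \<and> \<sigma> 0 = 0 \<and> \<sigma> 1 = 1}"
    then have "\<sigma> permutes N" "\<sigma> 0 = 0" "\<sigma> (Suc 0) = Suc 0" by (auto simp: S_def)
    then show "\<sigma> permutes {2..<2*m+2}"
      by (elim permutes_superset) (auto simp: N_def less_2_cases_iff not_le)
  next
    fix \<sigma> assume "\<sigma> \<in> {\<sigma>. \<sigma> permutes {2..<2*m+2}}"
    then have \<sigma>: "\<sigma> permutes {2..<2*m+2}" by simp
    have "\<sigma> permutes N" by (rule permutes_subset[OF \<sigma>]) (auto simp: N_def)
    then show "\<sigma> \<in> S \<and> \<sigma> 0 = 0 \<and> \<sigma> 1 = 1" using permutes_not_in[OF \<sigma>] by (simp add: S_def)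
  qed
  also have "(\<Sum>\<sigma>\<in>\<dots>. T \<sigma>) = (\<Sum>\<tau> | \<tau> permutes {..<2*m}. T (shift2 (2*m) \<tau>))"
    using sum.reindex_bij_betw[OF bij_betw_shift2[of "2*m"], of T] by simp
  also have "\<dots> = (\<Sum>\<tau> | \<tau> permutes {..<2*m}. A 0 1 * (of_int (sign \<tau>) *
      (\<Prod>i<m. A (\<tau> (2*i) + 2) (\<tau> (2*i+1) + 2))))"
  proof (rule sum.cong[OF refl])
    fix \<tau> :: "nat \<Rightarrow> nat" assume "\<tau> \<in> {\<tau>. \<tau> permutes {..<2*m}}"
    then have \<tau>: "\<tau> permutes {..<2*m}" by simp
    have "shift2 (2*m) \<tau> (2 * Suc i) = \<tau> (2*i) + 2"
      "shift2 (2*m) \<tau> (2 * Suc i + 1) = \<tau> (2*i+1) + 2" if "i < m" for i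
      using shift2_apply[of "2*i" "2*m" \<tau>] shift2_apply[of "2*i+1" "2*m" \<tau>] that by simp_all
    then show "T (shift2 (2*m) \<tau>) = A 0 1 * (of_int (sign \<tau>) *
      (\<Prod>i<m. A (\<tau> (2*i) + 2) (\<tau> (2*i+1) + 2)))"
      unfolding T_def prod.lessThan_Suc_shift using shift2_low[OF \<tau>] sign_shift2[OF \<tau>] by simp
  qed
  finally show ?thesis
    unfolding matching_sum_def[of m] by (simp add: sum_distrib_left[symmetric] mult.assoc)
qed

section \<open>Pointwise splitting of vector fields\<close>

text \<open>The point comes last, so that \<open>der X f\<close> is itself a function: derivatives
  can be iterated and rewritten without bound variables. \<open>form_app\<close> and
  \<open>inner_app\<close> follow the same pattern.\<close>

definition der :: "'a vfield \<Rightarrow> ('a \<Rightarrow> real) \<Rightarrow> 'a \<Rightarrow> real" where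
  "der X f p = X p f"

definition form_app :: "'a oneform \<Rightarrow> 'a vfield \<Rightarrow> 'a \<Rightarrow> real" where
  "form_app \<alpha> X p = \<alpha> p (X p)"

definition comb :: "real \<Rightarrow> 'a vfield \<Rightarrow> real \<Rightarrow> 'a vfield \<Rightarrow> 'a vfield" where
  "comb a U b W = vscale (\<lambda>_. a) U + vscale (\<lambda>_. b) W"

definition lincomb :: "nat \<Rightarrow> (nat \<Rightarrow> real) \<Rightarrow> (nat \<Rightarrow> 'a vfield) \<Rightarrow> 'a vfield" where
  "lincomb n c X = (\<lambda>p f. \<Sum>i<n. c i * X i p f)"

lemma vscale_apply: "vscale h X p f = h p * X p f"
  by (simp add: vscale_def)

context smooth_manifold
begin

section \<open>Calculus of derivations and Lie brackets\<close>

lemma der_smooth [simp, intro]: "X \<in> V \<Longrightarrow> f \<in> C \<Longrightarrow> der X f \<in> C"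
  using vf_smooth[of X f] by (simp add: der_def[abs_def])

lemma der_fun_add [simp]:
  "X \<in> V \<Longrightarrow> f \<in> C \<Longrightarrow> h \<in> C \<Longrightarrow> der X (\<lambda>q. f q + h q) p = der X f p + der X h p"
  unfolding der_def by (rule vf_add)

lemma der_fun_diff [simp]:
  "X \<in> V \<Longrightarrow> f \<in> C \<Longrightarrow> h \<in> C \<Longrightarrow> der X (\<lambda>q. f q - h q) p = der X f p - der X h p"
  unfolding der_def by (rule vf_diff)

lemma der_fun_minus [simp]: "X \<in> V \<Longrightarrow> f \<in> C \<Longrightarrow> der X (\<lambda>q. - f q) p = - der X f p"
  unfolding der_def by (rule vf_minus)

lemma der_fun_mult [simp]:
  "X \<in> V \<Longrightarrow> f \<in> C \<Longrightarrow> h \<in> C \<Longrightarrow>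
    der X (\<lambda>q. f q * h q) p = f p * der X h p + h p * der X f p"
  unfolding der_def by (rule vf_mult)

lemma der_const [simp]: "X \<in> V \<Longrightarrow> der X (\<lambda>q. c) p = 0"
  unfolding der_def by (rule vf_const)

lemma der_plus [simp]: "der (X + Y) f = (\<lambda>p. der X f p + der Y f p)"
  by (simp add: der_def fun_eq_iff)

lemma der_minus [simp]: "der (X - Y) f = (\<lambda>p. der X f p - der Y f p)"
  by (simp add: der_def fun_eq_iff)

lemma der_uminus [simp]: "der (- X) f = (\<lambda>p. - der X f p)"
  by (simp add: der_def fun_eq_iff)

lemma der_vscale [simp]: "der (vscale h X) f = (\<lambda>p. h p * der X f p)"
  by (simp add: der_def vscale_def fun_eq_iff)

lemma der_lie_bracket [simp]:
  "der (lie_bracket X Y) f = (\<lambda>p. der X (der Y f) p - der Y (der X f) p)"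
  by (simp add: der_def[abs_def] lie_bracket_apply fun_eq_iff)

lemma der_zero: "der 0 f p = 0"
  by (simp add: der_def)

lemma vfields_zero [simp, intro]: "0 \<in> V"
  unfolding vfields_def tangent_space_def by simp

text \<open>Smooth functions suffice as tests because tangent vectors are zero on all others by
  convention.\<close>

lemma vf_eqI:
  assumes "X \<in> V" "Y \<in> V" "\<And>p f. f \<in> C \<Longrightarrow> der X f p = der Y f p"
  shows "X = Y"
proof (intro ext)
  fix p f
  show "X p f = Y p f"
  proof (cases "f \<in> C")
    case True
    then show ?thesis using assms(3) by (simp add: der_def)
  next
    case False
    then show ?thesis
      using tangent_nonsmooth[OF vf_tangent[OF assms(1)]]
        tangent_nonsmooth[OF vf_tangent[OF assms(2)]] by simp
  qed
qed

lemma lie_bracket_skew: "lie_bracket Y X = - lie_bracket X Y"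
  by (simp add: lie_bracket_def fun_eq_iff)

lemma lie_bracket_plus_left [simp]:
  assumes "X \<in> V" "Y \<in> V" "W \<in> V"
  shows "lie_bracket (X + Y) W = lie_bracket X W + lie_bracket Y W"
  by (rule vf_eqI) (use assms in auto)

lemma lie_bracket_vscale_left [simp]:
  assumes "h \<in> C" "X \<in> V" "W \<in> V"
  shows "lie_bracket (vscale h X) W = vscale h (lie_bracket X W) - vscale (der W h) X"
  by (rule vf_eqI) (use assms in \<open>auto simp: algebra_simps\<close>)

lemma jacobi:
  assumes "X \<in> V" "Y \<in> V" "W \<in> V"
  shows "lie_bracket (lie_bracket X Y) W + lie_bracket (lie_bracket Y W) X
    + lie_bracket (lie_bracket W X) Y = 0"
  by (rule vf_eqI) (use assms in \<open>auto simp: der_zero\<close>)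

section \<open>Multilinear algebra on the real vector space of global fields\<close>

lemma comb_closed [simp, intro]: "U \<in> V \<Longrightarrow> W \<in> V \<Longrightarrow> comb a U b W \<in> V"
  by (auto simp: comb_def)

lemma lincomb_Suc: "lincomb (Suc n) c X = comb 1 (lincomb n c X) (c n) (X n)"
  by (simp add: lincomb_def comb_def vscale_def fun_eq_iff)

lemma lincomb_0: "lincomb 0 c X = comb 0 (X 0) 0 (X 0)"
  by (simp add: lincomb_def comb_def vscale_def fun_eq_iff)

lemma lincomb_closed [simp, intro]: "(\<And>i. X i \<in> V) \<Longrightarrow> lincomb n c X \<in> V"
  by (induction n) (auto simp: lincomb_Suc lincomb_0)

definition linear_on_fields :: "('a vfield \<Rightarrow> real) \<Rightarrow> bool" where
  "linear_on_fields T \<longleftrightarrow> (\<forall>U\<in>V. \<forall>W\<in>V. \<forall>a b. T (comb a U b W) = a * T U + b * T W)"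

lemma linear_on_fieldsI:
  assumes "\<And>U W a b. U \<in> V \<Longrightarrow> W \<in> V \<Longrightarrow> T (comb a U b W) = a * T U + b * T W"
  shows "linear_on_fields T"
  using assms by (simp add: linear_on_fields_def)

lemma linear_on_fieldsD:
  "linear_on_fields T \<Longrightarrow> U \<in> V \<Longrightarrow> W \<in> V \<Longrightarrow> T (comb a U b W) = a * T U + b * T W"
  by (simp add: linear_on_fields_def)

lemma linear_on_fields_lincomb:
  assumes "linear_on_fields T" "\<And>i. X i \<in> V"
  shows "T (lincomb n c X) = (\<Sum>i<n. c i * T (X i))"
  by (induction n) (use assms in \<open>auto simp: lincomb_Suc lincomb_0 linear_on_fieldsD\<close>)

text \<open>Values at a point of n-forms, multilinear over the reals and annihilated by K.\<close>

definition multilinear :: "'a vfield set \<Rightarrow> nat \<Rightarrow> ((nat \<Rightarrow> 'a vfield) \<Rightarrow> real) \<Rightarrow> bool" where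
  "multilinear K n G \<longleftrightarrow>
     (\<forall>Y Y'. (\<forall>i<n. Y i = Y' i) \<longrightarrow> G Y = G Y') \<and>
     (\<forall>Y. (\<forall>i. Y i \<in> V) \<longrightarrow> (\<forall>j<n. linear_on_fields (\<lambda>U. G (Y(j := U))) \<and>
        (\<forall>U\<in>K. G (Y(j := U)) = 0)))"

lemma multilinear_local: "multilinear K n G \<Longrightarrow> (\<And>i. i < n \<Longrightarrow> Y i = Y' i) \<Longrightarrow> G Y = G Y'"
  by (simp add: multilinear_def)

lemma multilinear_slot:
  assumes "multilinear K n G" "\<And>i. Y i \<in> V" "j < n"
  shows "linear_on_fields (\<lambda>U. G (Y(j := U)))" "U \<in> K \<Longrightarrow> G (Y(j := U)) = 0"
  using assms by (auto simp: multilinear_def)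

lemma linear_on_fields_sum:
  assumes "\<And>s. s \<in> S \<Longrightarrow> linear_on_fields (T s)"
  shows "linear_on_fields (\<lambda>U. \<Sum>s\<in>S. T s U)"
  by (rule linear_on_fieldsI)
    (simp add: linear_on_fieldsD[OF assms] sum.distrib sum_distrib_left)

lemma linear_on_fields_mult:
  assumes "linear_on_fields T" shows "linear_on_fields (\<lambda>U. c * T U * d)"
  by (rule linear_on_fieldsI) (simp add: linear_on_fieldsD[OF assms] algebra_simps)

lemma fun_upd_perm:
  assumes "\<sigma> permutes S"
  shows "(\<lambda>t. (Y(j := U)) (\<sigma> t)) = (\<lambda>t. Y (\<sigma> t))(inv \<sigma> j := U)"
  using assms by (auto simp: fun_eq_iff permutes_inverses permutes_inv_eq)

text \<open>Under a permutation \<sigma> the changed entry j moves to position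
  \<open>inv \<sigma> j\<close>, hence into the arguments of exactly one factor. That factor
  supplies linearity and vanishing on K; the other one does not change.\<close>

lemma multilinear_wedge:
  assumes \<omega>: "multilinear K r (\<lambda>X. \<omega> X p)" and \<eta>: "multilinear K s (\<lambda>X. \<eta> X p)"
  shows "multilinear K (r + s) (\<lambda>X. wedge r s \<omega> \<eta> X p)"
proof -
  define T where "T = (\<lambda>\<sigma> X. of_int (sign \<sigma>) * \<omega> (\<lambda>i. X (\<sigma> i)) p * \<eta> (\<lambda>i. X (\<sigma> (r + i))) p)"
  have w: "wedge r s \<omega> \<eta> X p = 1 / fact (r + s) * (\<Sum>\<sigma> | \<sigma> permutes {..<r+s}. T \<sigma> X) * 1" for X
    by (simp add: wedge_def T_def)
  have loc: "T \<sigma> Y = T \<sigma> Y'" if "\<sigma> permutes {..<r+s}" "\<forall>i<r+s. Y i = Y' i" for \<sigma> Y Y'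
  proof -
    have "\<sigma> i < r+s" if "i < r+s" for i
      using permutes_in_image[OF \<open>\<sigma> permutes _\<close>] that by simp
    then show ?thesis
      unfolding T_def using that(2)
      by (intro arg_cong2[of _ _ _ _ "(*)"] refl multilinear_local[OF \<omega>] multilinear_local[OF \<eta>]) auto
  qed
  have slot: "linear_on_fields (\<lambda>U. T \<sigma> (Y(j := U))) \<and> (\<forall>U\<in>K. T \<sigma> (Y(j := U)) = 0)"
    if \<sigma>: "\<sigma> permutes {..<r+s}" and Y: "\<forall>i. Y i \<in> V" and j: "j < r+s" for \<sigma> Y j
  proof -
    define i where "i = inv \<sigma> j"
    have i: "i < r + s"
      using permutes_in_image[OF permutes_inv[OF \<sigma>], of j] j by (simp add: i_def)
    have upd: "(\<lambda>t. (Y(j := U)) (\<sigma> t)) = (\<lambda>t. Y (\<sigma> t))(i := U)" for U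
      unfolding i_def by (rule fun_upd_perm[OF \<sigma>])
    show ?thesis
    proof (cases "i < r")
      case True
      have e: "(\<lambda>t. (Y(j := U)) (\<sigma> (r + t))) = (\<lambda>t. Y (\<sigma> (r + t)))" for U
        using fun_cong[OF upd[of U]] True by (auto simp: fun_eq_iff)
      show ?thesis
        unfolding T_def upd e using multilinear_slot[OF \<omega> _ True, of "\<lambda>t. Y (\<sigma> t)"] Y
        by (auto intro!: linear_on_fields_mult)
    next
      case False
      have e: "(\<lambda>t. (Y(j := U)) (\<sigma> (r + t))) = (\<lambda>t. Y (\<sigma> (r + t)))(i - r := U)" for U
        using fun_cong[OF upd[of U]] False by (auto simp: fun_eq_iff)
      have f: "\<omega> (\<lambda>t. (Y(j := U)) (\<sigma> t)) p = \<omega> (\<lambda>t. Y (\<sigma> t)) p" for U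
        unfolding upd by (rule multilinear_local[OF \<omega>]) (use False in auto)
      have "i - r < s" using i False by simp
      from multilinear_slot[OF \<eta> _ this, of "\<lambda>t. Y (\<sigma> (r + t))"] show ?thesis
        unfolding T_def f e using Y linear_on_fields_mult[of _ _ 1] by auto
    qed
  qed
  have "linear_on_fields (\<lambda>U. wedge r s \<omega> \<eta> (Y(j := U)) p) \<and>
      (\<forall>U\<in>K. wedge r s \<omega> \<eta> (Y(j := U)) p = 0)" if "\<forall>i. Y i \<in> V" "j < r + s" for Y j
    unfolding w using slot[OF _ that]
    by (intro conjI linear_on_fields_mult linear_on_fields_sum ballI) simp_all
  moreover have "wedge r s \<omega> \<eta> Y p = wedge r s \<omega> \<eta> Y' p" if "\<forall>i<r+s. Y i = Y' i" for Y Y'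
  proof -
    have "(\<Sum>\<sigma> | \<sigma> permutes {..<r+s}. T \<sigma> Y) = (\<Sum>\<sigma> | \<sigma> permutes {..<r+s}. T \<sigma> Y')"
      by (rule sum.cong) (use loc that in auto)
    then show ?thesis by (simp add: w)
  qed
  ultimately show ?thesis unfolding multilinear_def by blast
qed

text \<open>The antisymmetrisation alone forces this, whatever the two factors are: exchanging a and
  b reverses the sign of every summand but permutes the sum.\<close>

lemma wedge_repeated:
  assumes "a < r + s" "b < r + s" "a \<noteq> b" "X a = X b"
  shows "wedge r s \<omega> \<eta> X p = 0"
proof -
  define N where "N = {..<r+s}"
  define T where "T = (\<lambda>\<sigma>. of_int (sign \<sigma>) * \<omega> (\<lambda>i. X (\<sigma> i)) p * \<eta> (\<lambda>i. X (\<sigma> (r + i))) p)"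
  define t where "t = Transposition.transpose a b"
  have t: "t permutes N" unfolding t_def N_def using assms by (intro permutes_swap_id) auto
  have X: "X (t i) = X i" for i using assms(4) by (auto simp: t_def Transposition.transpose_def)
  have "T (t \<circ> \<sigma>) = - T \<sigma>" if "\<sigma> permutes N" for \<sigma>
  proof -
    have "sign (t \<circ> \<sigma>) = - sign \<sigma>"
      using that t assms(3) by (subst sign_compose)
        (auto simp: t_def sign_swap_id permutation_swap_id permutation_permutes N_def)
    then show ?thesis by (simp add: T_def X)
  qed
  then have "(\<Sum>\<sigma> | \<sigma> permutes N. T (t \<circ> \<sigma>)) = (\<Sum>\<sigma> | \<sigma> permutes N. - T \<sigma>)"
    by (intro sum.cong) auto
  then have "(\<Sum>\<sigma> | \<sigma> permutes N. T \<sigma>) = - (\<Sum>\<sigma> | \<sigma> permutes N. T \<sigma>)"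
    using setum_permutations_compose_left[OF t, of T] by (simp add: sum_negf)
  then have "(\<Sum>\<sigma> | \<sigma> permutes N. T \<sigma>) = 0" by linarith
  then show ?thesis by (simp add: wedge_def T_def N_def)
qed

text \<open>An alternating form vanishes on arguments that are dependent modulo its annihilator K:
  with the relation inserted in slot j, every term except the j-th repeats an argument.\<close>

lemma wedge_dependent:
  assumes \<omega>: "multilinear K r (\<lambda>X. \<omega> X p)" and \<eta>: "multilinear K s (\<lambda>X. \<eta> X p)"
    and X: "\<And>i. X i \<in> V" and dep: "lincomb (r + s) c X \<in> K" and j: "j < r + s" "c j \<noteq> 0"
  shows "wedge r s \<omega> \<eta> X p = 0"
proof -
  define T where "T = (\<lambda>U. wedge r s \<omega> \<eta> (X(j := U)) p)"
  note slot = multilinear_slot[OF multilinear_wedge[where \<omega> = \<omega> and \<eta> = \<eta> and p = p, OF assms(1,2)] X j(1)]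
  have "0 = T (lincomb (r + s) c X)" using slot(2)[OF dep] by (simp add: T_def)
  also have "\<dots> = (\<Sum>i<r+s. c i * T (X i))"
    by (rule linear_on_fields_lincomb[OF _ X]) (use slot(1) in \<open>simp add: T_def\<close>)
  also have "\<dots> = (\<Sum>i<r+s. if i = j then c j * T (X j) else 0)"
  proof (rule sum.cong[OF refl])
    fix i assume "i \<in> {..<r+s}"
    then show "c i * T (X i) = (if i = j then c j * T (X j) else 0)"
      using wedge_repeated[of i r s j "X(j := X i)" \<omega> \<eta> p] j by (auto simp: T_def)
  qed
  also have "\<dots> = c j * T (X j)" using j by simp
  finally show ?thesis using j by (simp add: T_def)
qed

section \<open>One-forms and their exterior derivatives as tensors\<close>

lemma form_app_lincomb:
  assumes "one_form \<A> \<alpha>" "X \<in> V" "Y \<in> V"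
  shows "\<alpha> p (\<lambda>f. a * X p f + b * Y p f) = a * form_app \<alpha> X p + b * form_app \<alpha> Y p"
  using assms vf_tangent[OF assms(2)] vf_tangent[OF assms(3)]
  unfolding one_form_def form_app_def by blast

lemma form_app_smooth [simp, intro]: "one_form \<A> \<alpha> \<Longrightarrow> X \<in> V \<Longrightarrow> form_app \<alpha> X \<in> C"
  unfolding one_form_def form_app_def[abs_def] by blast

lemma form_app_plus [simp]:
  assumes "one_form \<A> \<alpha>" "X \<in> V" "Y \<in> V"
  shows "form_app \<alpha> (X + Y) = (\<lambda>p. form_app \<alpha> X p + form_app \<alpha> Y p)"
  using form_app_lincomb[OF assms, of _ 1 1]
  by (simp add: form_app_def fun_eq_iff plus_fun_def)

lemma form_app_minus [simp]:
  assumes "one_form \<A> \<alpha>" "X \<in> V" "Y \<in> V"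
  shows "form_app \<alpha> (X - Y) = (\<lambda>p. form_app \<alpha> X p - form_app \<alpha> Y p)"
  using form_app_lincomb[OF assms, of _ 1 "-1"]
  by (simp add: form_app_def fun_eq_iff fun_diff_def)

lemma form_app_vscale [simp]:
  assumes "one_form \<A> \<alpha>" "X \<in> V"
  shows "form_app \<alpha> (vscale h X) = (\<lambda>p. h p * form_app \<alpha> X p)"
  using form_app_lincomb[OF assms(1,2,2), of _ "h _" 0]
  by (simp add: form_app_def fun_eq_iff vscale_def)

lemma form_app_uminus [simp]:
  assumes "one_form \<A> \<alpha>" "X \<in> V"
  shows "form_app \<alpha> (- X) = (\<lambda>p. - form_app \<alpha> X p)"
  using form_app_lincomb[OF assms(1,2,2), of _ "-1" 0]
  by (simp add: form_app_def fun_eq_iff fun_Compl_def)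

lemma ext_d_eq:
  "ext_d \<alpha> X Y p =
     (der X (form_app \<alpha> Y) p - der Y (form_app \<alpha> X) p - form_app \<alpha> (lie_bracket X Y) p) / 2"
  by (simp add: ext_d_def der_def form_app_def[abs_def])

lemma ext_d_skew:
  assumes "one_form \<A> \<alpha>" "X \<in> V" "Y \<in> V"
  shows "ext_d \<alpha> X Y p = - ext_d \<alpha> Y X p"
  using assms by (simp add: ext_d_eq lie_bracket_skew[of Y X] field_simps)

lemma ext_d_plus_left [simp]:
  assumes "one_form \<A> \<alpha>" "X \<in> V" "Y \<in> V" "W \<in> V"
  shows "ext_d \<alpha> (X + Y) W p = ext_d \<alpha> X W p + ext_d \<alpha> Y W p"
  using assms by (simp add: ext_d_eq add_divide_distrib diff_divide_distrib)

text \<open>Tensoriality: the derivative of h from the second term cancels the one produced by the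
  bracket.\<close>

lemma ext_d_vscale_left [simp]:
  assumes "one_form \<A> \<alpha>" "h \<in> C" "X \<in> V" "W \<in> V"
  shows "ext_d \<alpha> (vscale h X) W p = h p * ext_d \<alpha> X W p"
  using assms by (simp add: ext_d_eq algebra_simps)

lemma vscale_minus_one: "vscale (\<lambda>_. -1) X = - X"
  by (simp add: vscale_def fun_eq_iff)

lemma ext_d_uminus_left [simp]:
  assumes "one_form \<A> \<alpha>" "X \<in> V" "W \<in> V"
  shows "ext_d \<alpha> (- X) W p = - ext_d \<alpha> X W p"
  using ext_d_vscale_left[OF assms(1) _ assms(2,3), of "\<lambda>_. -1"] by (simp add: vscale_minus_one)

lemma ext_d_minus_left [simp]:
  assumes "one_form \<A> \<alpha>" "X \<in> V" "Y \<in> V" "W \<in> V"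
  shows "ext_d \<alpha> (X - Y) W p = ext_d \<alpha> X W p - ext_d \<alpha> Y W p"
  using ext_d_plus_left[OF assms(1,2) vfields_uminus[OF assms(3)] assms(4)] assms by simp

lemma ext_d_right [simp]:
  assumes "one_form \<A> \<alpha>" "W \<in> V" "X \<in> V"
  shows "Y \<in> V \<Longrightarrow> ext_d \<alpha> W (X + Y) p = ext_d \<alpha> W X p + ext_d \<alpha> W Y p"
    and "Y \<in> V \<Longrightarrow> ext_d \<alpha> W (X - Y) p = ext_d \<alpha> W X p - ext_d \<alpha> W Y p"
    and "ext_d \<alpha> W (- X) p = - ext_d \<alpha> W X p"
    and "h \<in> C \<Longrightarrow> ext_d \<alpha> W (vscale h X) p = h p * ext_d \<alpha> W X p"
  using assms by (simp_all add: ext_d_skew[of \<alpha> W])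

lemma linear_form_app: "one_form \<A> \<alpha> \<Longrightarrow> linear_on_fields (\<lambda>U. form_app \<alpha> U p)"
  by (rule linear_on_fieldsI) (simp add: comb_def)

lemma linear_ext_d_left: "one_form \<A> \<alpha> \<Longrightarrow> W \<in> V \<Longrightarrow> linear_on_fields (\<lambda>U. ext_d \<alpha> U W p)"
  by (rule linear_on_fieldsI) (simp add: comb_def)

lemma linear_ext_d_right: "one_form \<A> \<alpha> \<Longrightarrow> W \<in> V \<Longrightarrow> linear_on_fields (\<lambda>U. ext_d \<alpha> W U p)"
  by (rule linear_on_fieldsI) (simp add: comb_def)

lemma multilinear_form1:
  assumes "one_form \<A> \<alpha>" "\<And>U. U \<in> K \<Longrightarrow> form_app \<alpha> U p = 0"
  shows "multilinear K 1 (\<lambda>X. form1 \<alpha> X p)"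
  using assms linear_form_app[of \<alpha> p]
  by (simp add: multilinear_def form1_def flip: form_app_def)

lemma multilinear_d_form:
  assumes "one_form \<A> \<alpha>" "K \<subseteq> V" "\<And>U W. U \<in> K \<Longrightarrow> W \<in> V \<Longrightarrow> ext_d \<alpha> U W p = 0"
  shows "multilinear K 2 (\<lambda>X. d_form \<alpha> X p)"
  unfolding multilinear_def d_form_def
proof (intro conjI allI impI ballI)
  fix Y :: "nat \<Rightarrow> 'a vfield" and j :: nat
  assume Y: "\<forall>i. Y i \<in> V" and "j < 2"
  then have j: "j = 0 \<or> j = 1" by auto
  show "linear_on_fields (\<lambda>U. ext_d \<alpha> ((Y(j := U)) 0) ((Y(j := U)) 1) p)"
    using j Y linear_ext_d_left[OF assms(1), of "Y 1"] linear_ext_d_right[OF assms(1), of "Y 0"]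
    by auto
  show "ext_d \<alpha> ((Y(j := U)) 0) ((Y(j := U)) 1) p = 0" if "U \<in> K" for U
    using j Y that assms(2) assms(3)[OF that] ext_d_skew[OF assms(1), of "Y 0" U p] by auto
qed simp

lemma multilinear_power:
  assumes "multilinear K 2 (\<lambda>X. \<omega> X p)"
  shows "multilinear K (2 * m) (\<lambda>X. two_form_power \<omega> m X p)"
proof (induction m)
  case (Suc m)
  from multilinear_wedge[where \<omega> = \<omega> and \<eta> = "two_form_power \<omega> m" and p = p, OF assms Suc]
  show ?case by simp
qed (simp add: multilinear_def)

text \<open>Take m at most h for which the m-th power is nonzero at p, on fields Y say, while the
  next power vanishes there. If X pairs to zero with these Y, the power m + 1 on X, W, Y is a
  nonzero multiple of \<open>ext_d \<alpha> X W p\<close>. The exponent m may depend on p, so only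
  an upper bound for the rank is obtained.\<close>

lemma rank_bound:
  assumes \<alpha>: "one_form \<A> \<alpha>" and van: "form_vanishes \<A> (two_form_power (d_form \<alpha>) (h + 1))"
  obtains Y where "\<And>i. Y i \<in> V"
    "\<And>X W. X \<in> V \<Longrightarrow> W \<in> V \<Longrightarrow> (\<And>i. i < 2*h \<Longrightarrow> ext_d \<alpha> X (Y i) p = 0) \<Longrightarrow> ext_d \<alpha> X W p = 0"
proof -
  define P where "P = (\<lambda>m. \<forall>X. (\<forall>i. X i \<in> V) \<longrightarrow> two_form_power (d_form \<alpha>) m X p = 0)"
  have power: "two_form_power (d_form \<alpha>) m X p
      = matching_sum m (\<lambda>i j. ext_d \<alpha> (X i) (X j) p) / fact (2*m)" for m X
    by (subst two_form_power_eq_matching_sum) (simp_all add: d_form_def)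
  have "P (Suc h)" using van by (simp add: P_def form_vanishes_def)
  moreover have "\<not> P 0" unfolding P_def by (auto intro!: exI[of _ "\<lambda>_. 0"])
  ultimately obtain m where m: "m \<le> h" "\<not> P m" "P (Suc m)"
    using ex_least_nat_less[of P "Suc h"] less_Suc_eq_le by blast
  then obtain Y where Y: "\<And>i. Y i \<in> V" "two_form_power (d_form \<alpha>) m Y p \<noteq> 0"
    by (auto simp: P_def)
  have "ext_d \<alpha> X W p = 0"
    if XW: "X \<in> V" "W \<in> V" and X0: "\<And>i. i < 2*h \<Longrightarrow> ext_d \<alpha> X (Y i) p = 0" for X W
  proof -
    \<comment> \<open>In this order the row of X has at most one nonzero entry to the right of the
      diagonal, namely the one at W.\<close>
    define Q where "Q = (\<lambda>i::nat. if i = 0 then X else if i = 1 then W else Y (i - 2))"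
    define A where "A = (\<lambda>i j. ext_d \<alpha> (Q i) (Q j) p)"
    have Q: "Q i \<in> V" for i using XW Y by (simp add: Q_def)
    have "matching_sum (Suc m) A = (2 * real m + 2) * A 0 1 * matching_sum m (\<lambda>i j. A (i+2) (j+2))"
    proof (rule matching_sum_first_row)
      show "A i j = - A j i" for i j unfolding A_def by (rule ext_d_skew[OF \<alpha> Q Q])
      show "A 0 j = 0" if "2 \<le> j" "j < 2*m+2" for j
        using that X0[of "j - 2"] m(1) by (simp add: A_def Q_def)
    qed
    moreover have "matching_sum (Suc m) A = 0"
      using m(3) Q power[of "Suc m" Q] by (simp add: P_def A_def)
    moreover have "matching_sum m (\<lambda>i j. A (i+2) (j+2)) \<noteq> 0"
      using Y(2) power[of m Y] by (simp add: A_def Q_def)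
    ultimately have "A 0 1 = 0" by simp
    then show ?thesis by (simp add: A_def Q_def)
  qed
  with Y(1) show ?thesis by (rule that)
qed

text \<open>The combined components of the two exterior derivatives and the two forms give a linear
  map from the vector fields to the model space. Its kernel annihilates the volume form, so it is
  onto; a preimage with half of the components deleted splits off the part tangent to one of the
  foliations.\<close>

lemma contact_pair_decomposition:
  assumes cp: "contact_pair \<A> h k \<alpha>1 \<alpha>2" and X: "X \<in> V"
  obtains X1 X2 where "X1 \<in> V" "X2 \<in> V"
    "form_app \<alpha>2 X1 p = 0" "\<And>W. W \<in> V \<Longrightarrow> ext_d \<alpha>2 X1 W p = 0"
    "form_app \<alpha>1 X2 p = 0" "\<And>W. W \<in> V \<Longrightarrow> ext_d \<alpha>1 X2 W p = 0"
    "form_app \<alpha>1 (X - X1 - X2) p = 0" "\<And>W. W \<in> V \<Longrightarrow> ext_d \<alpha>1 (X - X1 - X2) W p = 0"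
    "form_app \<alpha>2 (X - X1 - X2) p = 0" "\<And>W. W \<in> V \<Longrightarrow> ext_d \<alpha>2 (X - X1 - X2) W p = 0"
proof -
  define n where "n = 2*h + 2*k + 2"
  have \<alpha>: "one_form \<A> \<alpha>1" "one_form \<A> \<alpha>2" using cp by (auto simp: contact_pair_def)
  have n: "n = DIM('e)" using cp by (auto simp: contact_pair_def volume_form_def n_def)
  obtain b where b: "bij_betw b {..<n} (Basis :: 'e set)"
    using ex_bij_betw_nat_finite[of "Basis :: 'e set"] n by (auto simp: lessThan_atLeast0)
  have bb: "b i \<bullet> b l = (if i = l then 1 else 0)" if "i < n" "l < n" for i l
    using that bij_betwE[OF b] inj_onD[OF bij_betw_imp_inj_on[OF b]]
    by (auto simp: inner_Basis)
  obtain Y1 where Y1: "\<And>i. Y1 i \<in> V"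
    "\<And>X W. X \<in> V \<Longrightarrow> W \<in> V \<Longrightarrow> (\<And>i. i < 2*h \<Longrightarrow> ext_d \<alpha>1 X (Y1 i) p = 0) \<Longrightarrow> ext_d \<alpha>1 X W p = 0"
    using cp rank_bound[OF \<alpha>(1), of h p] by (auto simp: contact_pair_def)
  obtain Y2 where Y2: "\<And>i. Y2 i \<in> V"
    "\<And>X W. X \<in> V \<Longrightarrow> W \<in> V \<Longrightarrow> (\<And>i. i < 2*k \<Longrightarrow> ext_d \<alpha>2 X (Y2 i) p = 0) \<Longrightarrow> ext_d \<alpha>2 X W p = 0"
    using cp rank_bound[OF \<alpha>(2), of k p] by (auto simp: contact_pair_def)
  \<comment> \<open>The n functionals of the dimension count: 2*h and 2*k equations for the two
    radicals, then the two forms.\<close>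
  define c where "c = (\<lambda>i U. if i < 2*h then ext_d \<alpha>1 U (Y1 i) p
    else if i < 2*h + 2*k then ext_d \<alpha>2 U (Y2 (i - 2*h)) p
    else if i = 2*h + 2*k then form_app \<alpha>1 U p else form_app \<alpha>2 U p)"
  have lin: "linear_on_fields (c i)" for i
    unfolding c_def using \<alpha> Y1(1) Y2(1)
    by (cases "i < 2*h"; cases "i < 2*h + 2*k"; cases "i = 2*h + 2*k")
      (simp_all add: linear_ext_d_left linear_form_app)
  have ker1: "ext_d \<alpha>1 U W p = 0" if "U \<in> V" "W \<in> V" "\<And>i. i < 2*h \<Longrightarrow> c i U = 0" for U W
    using that(3) by (intro Y1(2)[OF that(1,2)]) (simp add: c_def)
  have ker2: "ext_d \<alpha>2 U W p = 0"
    if "U \<in> V" "W \<in> V" "\<And>i. 2*h \<le> i \<Longrightarrow> i < 2*h + 2*k \<Longrightarrow> c i U = 0" for U W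
  proof (rule Y2(2)[OF that(1,2)])
    fix i assume "i < 2*k"
    then show "ext_d \<alpha>2 U (Y2 i) p = 0" using that(3)[of "2*h + i"] by (simp add: c_def)
  qed
  have app1: "c (2*h + 2*k) U = form_app \<alpha>1 U p"
    and app2: "c (2*h + 2*k + 1) U = form_app \<alpha>2 U p" for U
    by (simp_all add: c_def)
  define K where "K = {U \<in> V. \<forall>i<n. c i U = 0}"
  have ml1: "multilinear K 1 (\<lambda>X. form1 \<alpha>1 X p)"
    by (rule multilinear_form1[OF \<alpha>(1)]) (simp add: app1[symmetric] K_def n_def)
  have ml1': "multilinear K 1 (\<lambda>X. form1 \<alpha>2 X p)"
    by (rule multilinear_form1[OF \<alpha>(2)]) (simp add: app2[symmetric] K_def n_def)
  have ml2: "multilinear K 2 (\<lambda>X. d_form \<alpha>1 X p)" "multilinear K 2 (\<lambda>X. d_form \<alpha>2 X p)"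
    by (auto intro!: multilinear_d_form \<alpha> ker1 ker2 simp: K_def n_def)
  define \<omega> where "\<omega> = wedge (2*h + 1) 1
             (wedge 1 (2*h) (form1 \<alpha>1) (two_form_power (d_form \<alpha>1) h)) (form1 \<alpha>2)"
  define \<eta> where "\<eta> = two_form_power (d_form \<alpha>2) k"
  have "multilinear K (1 + 2*h) (\<lambda>X. wedge 1 (2*h) (form1 \<alpha>1) (two_form_power (d_form \<alpha>1) h) X p)"
    by (intro multilinear_wedge multilinear_power ml1 ml2(1))
  then have "multilinear K ((2*h + 1) + 1) (\<lambda>X. \<omega> X p)"
    unfolding \<omega>_def by (intro multilinear_wedge ml1') (simp add: add.commute)
  then have ml\<omega>: "multilinear K (2*h + 2) (\<lambda>X. \<omega> X p)" by simp
  have ml\<eta>: "multilinear K (2*k) (\<lambda>X. \<eta> X p)"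
    unfolding \<eta>_def by (intro multilinear_power ml2(2))
  obtain E where E: "\<And>i. E i \<in> V" "wedge (2*h + 2) (2*k) \<omega> \<eta> E p \<noteq> 0"
    using cp by (auto simp: contact_pair_def volume_form_def \<omega>_def \<eta>_def)
  define L where "L = (\<lambda>U. \<Sum>l<n. c l U *\<^sub>R b l)"
  have L: "L U \<bullet> b l = c l U" if "l < n" for U l
  proof -
    have "L U \<bullet> b l = (\<Sum>i<n. if i = l then c i U else 0)"
      unfolding L_def inner_sum_left using that by (intro sum.cong) (auto simp: bb)
    then show ?thesis using that by simp
  qed
  \<comment> \<open>The coordinates of x are coefficients for the fields E on which the volume form
    is nonzero; M returns the functionals of the combination. As an endomorphism of the model space,
    it is onto once it is injective, and a kernel element would be a relation among the E modulo
    K.\<close>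
  define M where "M = (\<lambda>x::'e. \<Sum>i<n. (x \<bullet> b i) *\<^sub>R L (E i))"
  have Mc: "M x \<bullet> b l = c l (lincomb n (\<lambda>i. x \<bullet> b i) E)" if "l < n" for x l
    unfolding linear_on_fields_lincomb[OF lin E(1)] M_def inner_sum_left using L[OF that] by simp
  have "linear M"
    unfolding M_def
    by (rule linearI) (simp_all add: inner_add_left scaleR_add_left sum.distrib scaleR_sum_right)
  have "x = 0" if "M x = 0" for x
  proof (rule ccontr)
    assume "x \<noteq> 0"
    then obtain u where u: "u \<in> Basis" "x \<bullet> u \<noteq> 0" using euclidean_all_zero_iff by blast
    then obtain j where j: "j < n" "b j = u"
      using b by (metis bij_betw_imp_surj_on imageE lessThan_iff)
    have "lincomb n (\<lambda>i. x \<bullet> b i) E \<in> K"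
      using Mc[of _ x] that E(1) by (auto simp: K_def)
    moreover have nn: "2*h + 2 + 2*k = n" by (simp add: n_def)
    ultimately have "wedge (2*h + 2) (2*k) \<omega> \<eta> E p = 0"
      using j u by (intro wedge_dependent[where \<omega> = \<omega> and \<eta> = \<eta> and p = p
            and c = "\<lambda>i. x \<bullet> b i" and j = j, OF ml\<omega> ml\<eta> E(1)]) (simp_all add: nn)
    with E(2) show False by simp
  qed
  then have "inj M" unfolding linear_injective_0[OF \<open>linear M\<close>] by blast
  then have "surj M" by (intro linear_injective_imp_surjective \<open>linear M\<close>) simp_all
  have onto: "\<exists>U\<in>V. \<forall>l<n. c l U = t l" for t
  proof -
    define y where "y = (\<Sum>l<n. t l *\<^sub>R b l)"
    have y: "y \<bullet> b l = t l" if "l < n" for l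
    proof -
      have "y \<bullet> b l = (\<Sum>i<n. if i = l then t i else 0)"
        unfolding y_def inner_sum_left using that by (intro sum.cong) (auto simp: bb)
      then show ?thesis using that by simp
    qed
    obtain x where "M x = y" using \<open>surj M\<close> by (metis surj_def)
    then show ?thesis using Mc[of _ x] y E(1)
      by (intro bexI[of _ "lincomb n (\<lambda>i. x \<bullet> b i) E"]) auto
  qed
  \<comment> \<open>The indices kept are those belonging to \<open>\<alpha>1\<close>, so X1 lies in
    the characteristic space of \<open>\<alpha>2\<close>; X2 takes the remaining indices.\<close>
  obtain X1 where X1: "X1 \<in> V" "\<And>l. l < n \<Longrightarrow> c l X1 = (if l < 2*h \<or> l = 2*h + 2*k then c l X else 0)"
    using onto[of "\<lambda>l. if l < 2*h \<or> l = 2*h + 2*k then c l X else 0"] by auto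
  obtain X2 where X2: "X2 \<in> V" "\<And>l. l < n \<Longrightarrow> c l X2 = (if l < 2*h \<or> l = 2*h + 2*k then 0 else c l X)"
    using onto[of "\<lambda>l. if l < 2*h \<or> l = 2*h + 2*k then 0 else c l X"] by auto
  have "X - X1 - X2 = comb 1 (comb 1 X (-1) X1) (-1) X2"
    by (simp add: comb_def vscale_def fun_eq_iff)
  \<comment> \<open>So far the remainder is only in the common kernel; its vanishing at p is derived
    later from the metric.\<close>
  then have res: "c l (X - X1 - X2) = 0" if "l < n" for l
    using that X X1(1) X2(1) by (simp add: linear_on_fieldsD[OF lin] X1(2) X2(2))
  have R: "X - X1 - X2 \<in> V" using X X1(1) X2(1) by simp
  show ?thesis
  proof (rule that[OF X1(1) X2(1)])
    show "form_app \<alpha>2 X1 p = 0" using X1(2)[of "2*h + 2*k + 1"] by (simp only: app2) (simp add: n_def)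
    show "form_app \<alpha>1 X2 p = 0" using X2(2)[of "2*h + 2*k"] by (simp only: app1) (simp add: n_def)
    show "form_app \<alpha>1 (X - X1 - X2) p = 0"
      using res[of "2*h + 2*k"] by (simp only: app1) (simp add: n_def)
    show "form_app \<alpha>2 (X - X1 - X2) p = 0"
      using res[of "2*h + 2*k + 1"] by (simp only: app2) (simp add: n_def)
    show "ext_d \<alpha>2 X1 W p = 0" if "W \<in> V" for W
      by (rule ker2[OF X1(1) that]) (simp add: X1(2) n_def)
    show "ext_d \<alpha>1 X2 W p = 0" if "W \<in> V" for W
      by (rule ker1[OF X2(1) that]) (simp add: X2(2) n_def)
    show "ext_d \<alpha>1 (X - X1 - X2) W p = 0" if "W \<in> V" for W
      by (rule ker1[OF R that]) (simp add: res n_def)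
    show "ext_d \<alpha>2 (X - X1 - X2) W p = 0" if "W \<in> V" for W
      by (rule ker2[OF R that]) (simp add: res n_def)
  qed
qed

end

section \<open>Metric contact pairs with decomposable endomorphism\<close>

definition inner_app :: "'a bilin \<Rightarrow> 'a vfield \<Rightarrow> 'a vfield \<Rightarrow> 'a \<Rightarrow> real" where
  "inner_app g X Y p = g p (X p) (Y p)"

lemma vadd_eq: "vadd X Y = X + Y"
  by (simp add: vadd_def fun_eq_iff)

lemma vsub_eq: "vsub X Y = X - Y"
  by (simp add: vsub_def fun_eq_iff)

context smooth_manifold
begin

lemma der_fun_divide [simp]: "X \<in> V \<Longrightarrow> f \<in> C \<Longrightarrow> der X (\<lambda>q. f q / c) p = der X f p / c"
  using der_fun_mult[of X f "\<lambda>q. 1 / c" p] by simp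

lemma ext_d_smooth [simp, intro]:
  assumes "one_form \<A> \<alpha>" "X \<in> V" "Y \<in> V" shows "ext_d \<alpha> X Y \<in> C"
proof -
  have "ext_d \<alpha> X Y = (\<lambda>p. 1/2 * (der X (form_app \<alpha> Y) p - der Y (form_app \<alpha> X) p
      - form_app \<alpha> (lie_bracket X Y) p))"
    by (simp add: ext_d_eq fun_eq_iff)
  also have "\<dots> \<in> C" using assms by (intro Cinf_mult Cinf_diff) auto
  finally show ?thesis .
qed

text \<open>This is \<open>d d\<alpha> = 0\<close>: the second derivatives cancel in pairs, and the
  values of \<alpha> on double brackets cancel by the Jacobi identity.\<close>

lemma ext_d_closed:
  assumes \<alpha>: "one_form \<A> \<alpha>" and X: "X \<in> V" and Y: "Y \<in> V" and W: "W \<in> V"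
  shows "der X (ext_d \<alpha> Y W) p + der Y (ext_d \<alpha> W X) p + der W (ext_d \<alpha> X Y) p
    - ext_d \<alpha> (lie_bracket X Y) W p - ext_d \<alpha> (lie_bracket Y W) X p
    - ext_d \<alpha> (lie_bracket W X) Y p = 0"
proof -
  have d: "der X (ext_d \<alpha> Y W) p = (der X (der Y (form_app \<alpha> W)) p
      - der X (der W (form_app \<alpha> Y)) p - der X (form_app \<alpha> (lie_bracket Y W)) p) / 2"
    if "X \<in> V" "Y \<in> V" "W \<in> V" for X Y W
  proof -
    have "ext_d \<alpha> Y W = (\<lambda>p. (der Y (form_app \<alpha> W) p - der W (form_app \<alpha> Y) p
        - form_app \<alpha> (lie_bracket Y W) p) / 2)"
      by (simp add: ext_d_eq fun_eq_iff)
    then show ?thesis using that \<alpha> by simp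
  qed
  have "form_app \<alpha> (lie_bracket (lie_bracket X Y) W + lie_bracket (lie_bracket Y W) X
    + lie_bracket (lie_bracket W X) Y) p = 0"
    using form_app_vscale[OF \<alpha> X, of "\<lambda>_. 0"] unfolding jacobi[OF X Y W]
    by (simp add: vscale_def zero_fun_def)
  then have "form_app \<alpha> (lie_bracket (lie_bracket X Y) W) p
      + form_app \<alpha> (lie_bracket (lie_bracket Y W) X) p
      + form_app \<alpha> (lie_bracket (lie_bracket W X) Y) p = 0"
    using \<alpha> X Y W by simp
  then show ?thesis
    using \<alpha> X Y W by (simp add: d ext_d_eq) (simp add: field_simps)
qed

end

locale metric_contact_pair_manifold = smooth_manifold \<A>
  for \<A> :: "('a::{t2_space,second_countable_topology}, 'e::euclidean_space) chart set" +
  fixes h k :: nat and \<alpha>1 \<alpha>2 :: "'a oneform" and Z1 Z2 :: "'a vfield"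
    and \<phi> :: "'a endofield" and g :: "'a bilin" and nabla :: "'a connection"
  assumes mcp: "metric_contact_pair \<A> h k \<alpha>1 \<alpha>2 Z1 Z2 \<phi> g"
    and dec: "decomposable \<A> \<alpha>1 \<alpha>2 \<phi>"
    and lc: "levi_civita \<A> g nabla"
begin

abbreviation "ip \<equiv> inner_app g"
abbreviation "F \<equiv> endo_app \<phi>"
abbreviation "a1 \<equiv> form_app \<alpha>1"
abbreviation "a2 \<equiv> form_app \<alpha>2"
abbreviation "br \<equiv> lie_bracket"

text \<open>Treats both Reeb fields at once; two such assumptions cover the mixed cases as
  well.\<close>

definition reeb :: "'a oneform \<Rightarrow> 'a vfield \<Rightarrow> bool" where
  "reeb \<alpha> Z \<longleftrightarrow> \<alpha> = \<alpha>1 \<and> Z = Z1 \<or> \<alpha> = \<alpha>2 \<and> Z = Z2"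

lemma reeb12 [simp]: "reeb \<alpha>1 Z1" "reeb \<alpha>2 Z2"
  by (simp_all add: reeb_def)

lemma cp: "contact_pair \<A> h k \<alpha>1 \<alpha>2"
  and rf: "reeb_fields \<A> \<alpha>1 \<alpha>2 Z1 Z2"
  and ef: "endo_field \<A> \<phi>"
  and rm: "riemannian_metric \<A> g"
  using mcp by (simp_all add: metric_contact_pair_def)

lemma forms [simp]: "one_form \<A> \<alpha>1" "one_form \<A> \<alpha>2"
  using cp by (simp_all add: contact_pair_def)

lemma reeb_one_form [simp]: "reeb \<alpha> Z \<Longrightarrow> one_form \<A> \<alpha>"
  by (auto simp: reeb_def)

lemma Z_closed [simp]: "Z1 \<in> V" "Z2 \<in> V"
  using rf by (simp_all add: reeb_fields_def)

lemma reeb_closed [simp]: "reeb \<alpha> Z \<Longrightarrow> Z \<in> V"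
  by (auto simp: reeb_def)

lemma a_Z [simp]:
  "a1 Z1 = (\<lambda>p. 1)" "a1 Z2 = (\<lambda>p. 0)" "a2 Z1 = (\<lambda>p. 0)" "a2 Z2 = (\<lambda>p. 1)"
  using rf by (simp_all add: reeb_fields_def form_app_def fun_eq_iff)

lemma ext_d_Z_left [simp]:
  assumes "X \<in> V"
  shows "ext_d \<alpha>1 Z1 X p = 0" "ext_d \<alpha>2 Z1 X p = 0" "ext_d \<alpha>1 Z2 X p = 0" "ext_d \<alpha>2 Z2 X p = 0"
  using rf assms unfolding reeb_fields_def by blast+

lemma ext_d_Z_right [simp]:
  assumes "X \<in> V"
  shows "ext_d \<alpha>1 X Z1 p = 0" "ext_d \<alpha>2 X Z1 p = 0" "ext_d \<alpha>1 X Z2 p = 0" "ext_d \<alpha>2 X Z2 p = 0"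
  using assms ext_d_skew[of \<alpha>1 X] ext_d_skew[of \<alpha>2 X] by simp_all

lemma reeb_ext_d:
  assumes "reeb \<alpha> Z" "reeb \<beta> Z'" "X \<in> V"
  shows "ext_d \<alpha> Z' X p = 0" "ext_d \<alpha> X Z' p = 0"
  using assms(1,2) ext_d_Z_left[OF assms(3)] ext_d_Z_right[OF assms(3)]
  unfolding reeb_def by (elim disjE conjE; simp)+

section \<open>Metric, endomorphism and connection on global fields\<close>

lemma ip_lin:
  assumes "X \<in> V" "Y \<in> V" "W \<in> V"
  shows "g p (\<lambda>f. a * X p f + b * Y p f) (W p) = a * ip X W p + b * ip Y W p"
  using rm vf_tangent[OF assms(1)] vf_tangent[OF assms(2)] vf_tangent[OF assms(3)]
  unfolding riemannian_metric_def inner_app_def by blast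

lemma ip_sym: "X \<in> V \<Longrightarrow> Y \<in> V \<Longrightarrow> ip X Y p = ip Y X p"
  using rm vf_tangent unfolding riemannian_metric_def inner_app_def by blast

lemma ip_sym_fun: "X \<in> V \<Longrightarrow> Y \<in> V \<Longrightarrow> ip X Y = ip Y X"
  using ip_sym by blast

lemma ip_smooth [simp, intro]: "X \<in> V \<Longrightarrow> Y \<in> V \<Longrightarrow> ip X Y \<in> C"
  using rm unfolding riemannian_metric_def inner_app_def[abs_def] by blast

lemma ip_left [simp]:
  assumes "X \<in> V" "W \<in> V"
  shows "Y \<in> V \<Longrightarrow> ip (X + Y) W = (\<lambda>p. ip X W p + ip Y W p)"
    and "Y \<in> V \<Longrightarrow> ip (X - Y) W = (\<lambda>p. ip X W p - ip Y W p)"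
    and "ip (- X) W = (\<lambda>p. - ip X W p)"
    and "ip (vscale f X) W = (\<lambda>p. f p * ip X W p)"
proof -
  show "ip (X + Y) W = (\<lambda>p. ip X W p + ip Y W p)" if "Y \<in> V"
    using ip_lin[OF assms(1) that assms(2), of _ 1 1]
    by (simp add: inner_app_def fun_eq_iff plus_fun_def)
  show "ip (X - Y) W = (\<lambda>p. ip X W p - ip Y W p)" if "Y \<in> V"
    using ip_lin[OF assms(1) that assms(2), of _ 1 "-1"]
    by (simp add: inner_app_def fun_eq_iff fun_diff_def)
  show "ip (- X) W = (\<lambda>p. - ip X W p)"
    using ip_lin[OF assms(1,1,2), of _ "-1" 0]
    by (simp add: inner_app_def fun_eq_iff fun_Compl_def)
  show "ip (vscale f X) W = (\<lambda>p. f p * ip X W p)"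
    using ip_lin[OF assms(1,1,2), of _ "f _" 0]
    by (simp add: inner_app_def fun_eq_iff vscale_def)
qed

lemma ip_right [simp]:
  assumes "X \<in> V" "W \<in> V"
  shows "Y \<in> V \<Longrightarrow> ip W (X + Y) = (\<lambda>p. ip W X p + ip W Y p)"
    and "Y \<in> V \<Longrightarrow> ip W (X - Y) = (\<lambda>p. ip W X p - ip W Y p)"
    and "ip W (- X) = (\<lambda>p. - ip W X p)"
    and "f \<in> C \<Longrightarrow> ip W (vscale f X) = (\<lambda>p. f p * ip W X p)"
proof -
  have sym: "ip W U = ip U W" if "U \<in> V" for U using ip_sym_fun[OF assms(2) that] .
  show "ip W (X + Y) = (\<lambda>p. ip W X p + ip W Y p)" "ip W (X - Y) = (\<lambda>p. ip W X p - ip W Y p)"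
    if "Y \<in> V"
    using assms that by (simp_all add: sym)
  show "ip W (- X) = (\<lambda>p. - ip W X p)"
    using assms by (simp add: sym)
  show "ip W (vscale f X) = (\<lambda>p. f p * ip W X p)" if "f \<in> C"
    using assms that by (simp add: sym)
qed

lemma ip_zero [simp]: "X \<in> V \<Longrightarrow> ip 0 X = (\<lambda>p. 0)" "X \<in> V \<Longrightarrow> ip X 0 = (\<lambda>p. 0)"
  using ip_left(2)[of X X X] ip_right(2)[of X X X] by auto

lemma ip_nondegenerate:
  assumes "X \<in> V" "ip X X p = 0" shows "X p = (\<lambda>f. 0)"
  using rm vf_tangent[OF assms(1)] assms(2) unfolding riemannian_metric_def inner_app_def
  by (metis less_irrefl)

text \<open>The difference of X and Y is itself a global test field, so definiteness at p suffices
  and no tangent vector has to be extended.\<close>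

lemma ip_eqI:
  assumes "X \<in> V" "Y \<in> V" "\<And>W. W \<in> V \<Longrightarrow> ip X W p = ip Y W p"
  shows "X p = Y p"
proof -
  have "(X - Y) p = (\<lambda>f. 0)"
    by (rule ip_nondegenerate[of "X - Y" p]) (use assms in simp_all)
  then show ?thesis by (simp add: fun_eq_iff)
qed

lemma ip_zeroI:
  assumes "X \<in> V" "\<And>W p. W \<in> V \<Longrightarrow> ip X W p = 0"
  shows "X = 0"
  by (rule ext) (rule ip_eqI[of X 0], use assms in simp_all)

lemma ip_Z [simp]: "X \<in> V \<Longrightarrow> ip X Z1 = a1 X" "X \<in> V \<Longrightarrow> ip X Z2 = a2 X"
  "X \<in> V \<Longrightarrow> ip Z1 X = a1 X" "X \<in> V \<Longrightarrow> ip Z2 X = a2 X"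
proof -
  have "\<forall>p. \<forall>v\<in>tangent_space \<A> p. g p v (Z1 p) = \<alpha>1 p v \<and> g p v (Z2 p) = \<alpha>2 p v"
    using mcp by (simp add: metric_contact_pair_def)
  then show *: "ip X Z1 = a1 X" "ip X Z2 = a2 X" if "X \<in> V" for X
    using vf_tangent[OF that] by (auto simp: inner_app_def form_app_def)
  show "ip Z1 X = a1 X" "ip Z2 X = a2 X" if "X \<in> V" for X
    using *[OF that] ip_sym_fun[OF that] by auto
qed

lemma form_app_reeb: "reeb \<alpha> Z \<Longrightarrow> X \<in> V \<Longrightarrow> form_app \<alpha> X = ip X Z"
  by (auto simp: reeb_def)

lemma F_closed [simp, intro]: "X \<in> V \<Longrightarrow> F X \<in> V"
  using ef unfolding endo_field_def endo_app_def[abs_def] by blast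

lemma F_lin:
  assumes "X \<in> V" "Y \<in> V"
  shows "\<phi> p (\<lambda>f. a * X p f + b * Y p f) = (\<lambda>f. a * F X p f + b * F Y p f)"
  using ef vf_tangent[OF assms(1)] vf_tangent[OF assms(2)]
  unfolding endo_field_def endo_app_def by blast

lemma F_simps [simp]:
  assumes "X \<in> V"
  shows "Y \<in> V \<Longrightarrow> F (X + Y) = F X + F Y"
    and "Y \<in> V \<Longrightarrow> F (X - Y) = F X - F Y"
    and "F (- X) = - F X"
    and "F (vscale f X) = vscale f (F X)"
proof -
  show "F (X + Y) = F X + F Y" if "Y \<in> V"
    using F_lin[OF assms that, of _ 1 1]
    by (simp add: endo_app_def fun_eq_iff plus_fun_def)
  show "F (X - Y) = F X - F Y" if "Y \<in> V"
    using F_lin[OF assms that, of _ 1 "-1"]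
    by (simp add: endo_app_def fun_eq_iff fun_diff_def)
  show "F (- X) = - F X"
    using F_lin[OF assms assms, of _ "-1" 0]
    by (simp add: endo_app_def fun_eq_iff fun_Compl_def)
  show "F (vscale f X) = vscale f (F X)"
    using F_lin[OF assms assms, of _ "f _" 0]
    by (simp add: endo_app_def fun_eq_iff vscale_def)
qed

lemma F_Z [simp]: "F Z1 = 0" "F Z2 = 0"
  using mcp by (auto simp: metric_contact_pair_def endo_app_def fun_eq_iff)

lemma F_zero [simp]: "F 0 = 0"
  using F_simps(2)[of Z1 Z1] by simp

lemma FF [simp]: "X \<in> V \<Longrightarrow> F (F X) = - X + vscale (a1 X) Z1 + vscale (a2 X) Z2"
  using mcp vf_tangent[of X]
  by (simp add: metric_contact_pair_def endo_app_def form_app_def vscale_def fun_eq_iff)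

lemma ip_F: "X \<in> V \<Longrightarrow> Y \<in> V \<Longrightarrow> ip X (F Y) p = ext_d \<alpha>1 X Y p + ext_d \<alpha>2 X Y p"
  using mcp by (simp add: metric_contact_pair_def endo_app_def inner_app_def)

lemma ip_F_skew: "X \<in> V \<Longrightarrow> Y \<in> V \<Longrightarrow> ip (F X) Y p = - ip X (F Y) p"
  using ip_F[of X Y p] ip_F[of Y X p] ext_d_skew[of \<alpha>1 X Y p] ext_d_skew[of \<alpha>2 X Y p]
    ip_sym[of "F X" Y p] by simp

lemma a_F [simp]: "X \<in> V \<Longrightarrow> a1 (F X) = (\<lambda>p. 0)" "X \<in> V \<Longrightarrow> a2 (F X) = (\<lambda>p. 0)"
  using ip_F_skew[of X Z1] ip_F_skew[of X Z2] by (auto simp: fun_eq_iff)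

lemma nabla_closed [simp, intro]: "X \<in> V \<Longrightarrow> Y \<in> V \<Longrightarrow> nabla X Y \<in> V"
  using lc by (simp add: levi_civita_def affine_connection_def)

lemma nabla_simps [simp]:
  assumes "X \<in> V" "Y \<in> V"
  shows "W \<in> V \<Longrightarrow> nabla (X + Y) W = nabla X W + nabla Y W"
    and "W \<in> V \<Longrightarrow> nabla X (Y + W) = nabla X Y + nabla X W"
    and "f \<in> C \<Longrightarrow> nabla (vscale f X) Y = vscale f (nabla X Y)"
    and "f \<in> C \<Longrightarrow> nabla X (vscale f Y) = vscale (der X f) Y + vscale f (nabla X Y)"
proof -
  show "nabla (X + Y) W = nabla X W + nabla Y W" "nabla X (Y + W) = nabla X Y + nabla X W"
    if "W \<in> V"
    using lc assms that unfolding levi_civita_def affine_connection_def vadd_eq by blast+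
  show "nabla (vscale f X) Y = vscale f (nabla X Y)"
    "nabla X (vscale f Y) = vscale (der X f) Y + vscale f (nabla X Y)" if "f \<in> C"
    using lc assms that unfolding levi_civita_def affine_connection_def vadd_eq der_def[abs_def]
    by blast+
qed

lemma nabla_zero [simp]: "X \<in> V \<Longrightarrow> nabla 0 X = 0" "X \<in> V \<Longrightarrow> nabla X 0 = 0"
  using nabla_simps(1)[of 0 0 X] nabla_simps(2)[of X 0 0] by auto

lemma nabla_uminus [simp]:
  assumes "X \<in> V" "Y \<in> V"
  shows "nabla (- X) Y = - nabla X Y" "nabla X (- Y) = - nabla X Y"
  using nabla_simps(1)[of X "- X" Y] nabla_simps(2)[of X Y "- Y"] assms
  by (auto simp: add_eq_0_iff)

lemma nabla_minus [simp]:
  assumes "X \<in> V" "Y \<in> V" "W \<in> V"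
  shows "nabla (X - Y) W = nabla X W - nabla Y W" "nabla W (X - Y) = nabla W X - nabla W Y"
  using nabla_simps(1)[of X "- Y" W] nabla_simps(2)[of W X "- Y"] assms by simp_all

section \<open>Covariant derivatives of the Reeb fields and of the endomorphism\<close>

lemma torsion: "X \<in> V \<Longrightarrow> Y \<in> V \<Longrightarrow> br X Y = nabla X Y - nabla Y X"
  using lc unfolding levi_civita_def vsub_eq by simp

lemma compat:
  assumes "X \<in> V" "Y \<in> V" "W \<in> V"
  shows "der X (ip Y W) p = ip (nabla X Y) W p + ip Y (nabla X W) p"
  using lc assms unfolding levi_civita_def inner_app_def[abs_def] der_def by blast

text \<open>The form is the metric dual of its Reeb field and the connection is metric and
  torsion-free. The 2 compensates the factor 1/2 in the exterior derivative.\<close>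

lemma ext_d_nabla:
  assumes "reeb \<alpha> Z" "X \<in> V" "Y \<in> V"
  shows "2 * ext_d \<alpha> X Y p = ip (nabla X Z) Y p - ip (nabla Y Z) X p"
proof -
  have Z: "Z \<in> V" using assms by simp
  have "form_app \<alpha> (br X Y) p = ip (nabla X Y) Z p - ip (nabla Y X) Z p"
    using assms Z by (simp add: torsion form_app_reeb)
  moreover have "der X (form_app \<alpha> Y) p = ip (nabla X Y) Z p + ip Y (nabla X Z) p"
    "der Y (form_app \<alpha> X) p = ip (nabla Y X) Z p + ip X (nabla Y Z) p"
    using assms Z by (simp_all add: form_app_reeb compat)
  ultimately show ?thesis
    using ip_sym[of X "nabla Y Z" p] ip_sym[of Y "nabla X Z" p] assms Z by (simp add: ext_d_eq)
qed

lemma nabla_Z_skew: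
  assumes "reeb \<alpha> Z" "reeb \<beta> Z'" "X \<in> V"
  shows "ip (nabla X Z) Z' p + ip (nabla X Z') Z p = 0"
proof -
  have Z: "Z \<in> V" "Z' \<in> V" using assms by simp_all
  obtain c where "ip Z Z' = (\<lambda>p. c)"
    using assms(1,2) unfolding reeb_def by (elim disjE conjE) simp_all
  then have "der X (ip Z Z') p = 0" using assms(3) by simp
  then show ?thesis
    using compat[OF assms(3) Z, of p] ip_sym[of Z "nabla X Z'" p] assms Z by simp
qed

text \<open>The forms vanish on the bracket because they are constant on the Reeb fields; closedness
  puts the bracket into both radicals. So it is orthogonal to the image of F and to the Reeb fields,
  which together span.\<close>

lemma br_Z1_Z2: "br Z1 Z2 = 0"
proof -
  define U where "U = br Z1 Z2"
  have U: "U \<in> V" by (simp add: U_def)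
  have aU: "a1 U p = 0" "a2 U p = 0" for p
    using ext_d_Z_left(1)[of Z2 p] ext_d_Z_left(2)[of Z2 p] by (simp_all add: ext_d_eq U_def)
  have ext: "ext_d \<alpha> U W p = 0" if "reeb \<alpha> Z" "W \<in> V" for \<alpha> Z W p
  proof -
    note r = reeb_ext_d[OF that(1)]
    have z1: "ext_d \<alpha> Z2 W = (\<lambda>p. 0)" by (rule ext) (rule r(1)[OF reeb12(2) that(2)])
    have z2: "ext_d \<alpha> W Z1 = (\<lambda>p. 0)" by (rule ext) (rule r(2)[OF reeb12(1) that(2)])
    have z3: "ext_d \<alpha> Z1 Z2 = (\<lambda>p. 0)" by (rule ext) (rule r(1)[OF reeb12(1)], simp)
    have z4: "ext_d \<alpha> (br Z2 W) Z1 p = 0" by (rule r(2)[OF reeb12(1)]) (simp add: that)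
    have z5: "ext_d \<alpha> (br W Z1) Z2 p = 0" by (rule r(2)[OF reeb12(2)]) (simp add: that)
    show ?thesis
      using ext_d_closed[of \<alpha> Z1 Z2 W p] that by (simp add: z1 z2 z3 z4 z5 U_def)
  qed
  have F: "ip U (F W) p = 0" if "W \<in> V" for W p
    using ip_F[OF U that] ext[OF reeb12(1) that] ext[OF reeb12(2) that] by simp
  have "ip U W p = 0" if "W \<in> V" for W p
    using F[of "F W" p] that U aU by simp
  then show ?thesis using ip_zeroI[OF U] by (simp add: U_def)
qed

text \<open>As Z lies in the radical, the product of \<open>nabla Z Z'\<close> with W equals that of
  \<open>nabla W Z'\<close> with Z. It is skew in the two Reeb fields, as their products are
  constant, and symmetric, as they commute.\<close>

lemma nabla_Z_Z:
  assumes "reeb \<alpha> Z" "reeb \<beta> Z'"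
  shows "nabla Z Z' = 0"
proof (rule ip_zeroI)
  have Z: "Z \<in> V" "Z' \<in> V" using assms by simp_all
  then show "nabla Z Z' \<in> V" by simp
  fix W p assume W: "W \<in> V"
  have 1: "ip (nabla Y Y') W p = ip (nabla W Y') Y p" if "reeb a Y" "reeb b Y'" for a b Y Y'
  proof -
    have "ext_d b Y W p = 0" by (rule reeb_ext_d(1)[OF that(2,1) W])
    then show ?thesis using ext_d_nabla[OF that(2), of Y W p] that(1) W by simp
  qed
  have comm: "nabla Z Z' = nabla Z' Z"
  proof -
    have "nabla Z1 Z2 = nabla Z2 Z1" using torsion[of Z1 Z2] br_Z1_Z2 by simp
    then show ?thesis using assms unfolding reeb_def by (elim disjE conjE) simp_all
  qed
  show "ip (nabla Z Z') W p = 0"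
    using 1[OF assms] 1[OF assms(2,1)] nabla_Z_skew[OF assms W, of p] comm by simp
qed

lemma nabla_Z_orth:
  assumes "reeb \<alpha> Z" "reeb \<beta> Z'" "X \<in> V"
  shows "ip (nabla X Z) Z' p = 0"
proof -
  have "ext_d \<alpha> X Z' p = 0" by (rule reeb_ext_d(2)[OF assms])
  then show ?thesis
    using ext_d_nabla[OF assms(1,3), of Z' p] assms nabla_Z_Z[OF assms(2,1)] by simp
qed

lemma a_nabla_Z [simp]:
  assumes "X \<in> V"
  shows "a1 (nabla X Z1) p = 0" "a2 (nabla X Z1) p = 0"
    "a1 (nabla X Z2) p = 0" "a2 (nabla X Z2) p = 0"
  using nabla_Z_orth[OF _ _ assms, of \<alpha>1 Z1 \<alpha>1 Z1 p] nabla_Z_orth[OF _ _ assms, of \<alpha>1 Z1 \<alpha>2 Z2 p]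
    nabla_Z_orth[OF _ _ assms, of \<alpha>2 Z2 \<alpha>1 Z1 p] nabla_Z_orth[OF _ _ assms, of \<alpha>2 Z2 \<alpha>2 Z2 p] assms
  by simp_all

text \<open>The covariant derivative of \<open>\<phi>\<close> along X, applied to Y.\<close>

definition DF :: "'a vfield \<Rightarrow> 'a vfield \<Rightarrow> 'a vfield" where
  "DF X Y = nabla X (F Y) - F (nabla X Y)"

lemma DF_closed [simp, intro]: "X \<in> V \<Longrightarrow> Y \<in> V \<Longrightarrow> DF X Y \<in> V"
  by (simp add: DF_def)

lemma DF_skew:
  assumes "X \<in> V" "Y \<in> V" "W \<in> V"
  shows "ip (DF X Y) W p = - ip (DF X W) Y p"
proof -
  have "ip (F Y) W = (\<lambda>p. - ip Y (F W) p)"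
    by (rule ext) (rule ip_F_skew[OF assms(2,3)])
  then have "der X (ip (F Y) W) p = - der X (ip Y (F W)) p" using assms by simp
  then show ?thesis
    using assms ip_F_skew[of "nabla X Y" W p] ip_F_skew[of Y "nabla X W" p]
      ip_sym[of Y "nabla X (F W)" p] ip_sym[of Y "F (nabla X W)" p]
    by (simp add: compat DF_def)
qed

text \<open>This is the closedness of the fundamental form.\<close>

lemma DF_cyclic:
  assumes X: "X \<in> V" and Y: "Y \<in> V" and W: "W \<in> V"
  shows "ip (DF X Y) W p + ip (DF Y W) X p + ip (DF W X) Y p = 0"
proof -
  have ip_F_fun: "ip U (F U') = (\<lambda>p. ext_d \<alpha>1 U U' p + ext_d \<alpha>2 U U' p)" if "U \<in> V" "U' \<in> V" for U U'
    by (rule ext) (rule ip_F[OF that])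
  have cyc: "der X (ip Y (F W)) p + der Y (ip W (F X)) p + der W (ip X (F Y)) p
      - ip (br X Y) (F W) p - ip (br Y W) (F X) p - ip (br W X) (F Y) p = 0"
    using ext_d_closed[of \<alpha>1 X Y W p] ext_d_closed[of \<alpha>2 X Y W p] X Y W by (simp add: ip_F_fun)
  have e: "der X (ip Y (F W)) p - ip (br X Y) (F W) p
      = ip Y (nabla X (F W)) p - ip W (F (nabla Y X)) p"
    if "X \<in> V" "Y \<in> V" "W \<in> V" for X Y W
    using that ip_F_skew[of "nabla Y X" W p] ip_sym[of "F (nabla Y X)" W p]
    by (simp add: compat torsion)
  have "ip Y (DF X W) p + ip W (DF Y X) p + ip X (DF W Y) p = 0"
    using cyc e[OF X Y W] e[OF Y W X] e[OF W X Y] X Y W by (simp add: DF_def)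
  then show ?thesis
    using DF_skew[OF X Y W, of p] DF_skew[OF Y W X, of p] DF_skew[OF W X Y, of p]
      ip_sym[OF Y DF_closed[OF X W], of p] ip_sym[OF W DF_closed[OF Y X], of p]
      ip_sym[OF X DF_closed[OF W Y], of p] by linarith
qed

text \<open>Computes the inner product of the components of X and Y in the leaves through which the
  Reeb field of the form passes.\<close>

definition gam :: "'a oneform \<Rightarrow> 'a vfield \<Rightarrow> 'a vfield \<Rightarrow> 'a \<Rightarrow> real" where
  "gam \<alpha> X Y p = form_app \<alpha> X p * form_app \<alpha> Y p - ext_d \<alpha> X (F Y) p"

section \<open>Orthogonality of the foliations and the orthogonal projections\<close>

lemma ext_d_zero [simp]: "one_form \<A> \<alpha> \<Longrightarrow> X \<in> V \<Longrightarrow> ext_d \<alpha> X 0 p = 0"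
  using ext_d_right(2)[of \<alpha> X X X p] by simp

lemma ext_d_FF: "reeb \<alpha> Z \<Longrightarrow> X \<in> V \<Longrightarrow> Y \<in> V \<Longrightarrow> ext_d \<alpha> X (F (F Y)) p = - ext_d \<alpha> X Y p"
  unfolding reeb_def by (elim disjE conjE) simp_all

lemma char_spaceE:
  assumes "u \<in> char_space \<A> \<alpha> p"
  obtains U where "U \<in> V" "u = U p" "form_app \<alpha> U p = 0" "\<And>Y. Y \<in> V \<Longrightarrow> ext_d \<alpha> U Y p = 0"
  using assms unfolding char_space_def form_app_def by blast

lemma char_spaceI:
  assumes "U \<in> V" "form_app \<alpha> U p = 0" "\<And>Y. Y \<in> V \<Longrightarrow> ext_d \<alpha> U Y p = 0"
  shows "U p \<in> char_space \<A> \<alpha> p"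
  using assms unfolding char_space_def form_app_def by blast

lemma inner_app_cong: "X p = X' p \<Longrightarrow> Y p = Y' p \<Longrightarrow> ip X Y p = ip X' Y' p"
  by (simp add: inner_app_def)

text \<open>This is where decomposability enters: \<open>\<phi> v\<close> stays in the second space,
  so both exterior derivatives vanish on u and \<open>\<phi> v\<close>, and u is orthogonal to
  \<open>\<phi> (\<phi> v)\<close>. This is \<open>- v\<close> up to Reeb terms, which drop out
  because each is annihilated by u or by v.\<close>

lemma char_spaces_orthogonal:
  assumes "u \<in> char_space \<A> \<alpha>1 p" "v \<in> char_space \<A> \<alpha>2 p"
  shows "g p u v = 0"
proof -
  obtain U where U: "U \<in> V" "u = U p" "a1 U p = 0" "\<And>Y. Y \<in> V \<Longrightarrow> ext_d \<alpha>1 U Y p = 0"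
    using assms(1) by (rule char_spaceE) blast
  obtain W where W: "W \<in> V" "v = W p" "a2 W p = 0" "\<And>Y. Y \<in> V \<Longrightarrow> ext_d \<alpha>2 W Y p = 0"
    using assms(2) by (rule char_spaceE) blast
  have "\<phi> p v \<in> char_space \<A> \<alpha>2 p" using dec assms(2) unfolding decomposable_def by blast
  then obtain Q where Q: "Q \<in> V" "\<phi> p v = Q p" "\<And>Y. Y \<in> V \<Longrightarrow> ext_d \<alpha>2 Q Y p = 0"
    by (rule char_spaceE) blast
  have "F (F W) p = F Q p" using Q(2) W(2) by (simp add: endo_app_def)
  then have "ip U (F (F W)) p = ip U (F Q) p" by (intro inner_app_cong refl)
  also have "\<dots> = 0"
    using ip_F[OF U(1) Q(1), of p] U(4)[OF Q(1)] Q(3)[OF U(1)] ext_d_skew[OF forms(2) U(1) Q(1), of p]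
    by simp
  finally have "ip U W p = 0" using U W(1,3) by simp
  then show ?thesis using U(2) W(2) by (simp add: inner_app_def)
qed

text \<open>The remainder of the algebraic splitting is orthogonal to the image of F and to the Reeb
  fields, hence zero at p. For the products with W, \<open>ext_d \<alpha>1 X\<close> equals the
  product of X1 with F of the second argument; insert \<open>F W\<close>.\<close>

lemma foliation_splitting:
  assumes X: "X \<in> V"
  obtains X1 X2 where "X1 \<in> V" "X2 \<in> V" "X p = (X1 + X2) p"
    "X1 p \<in> char_space \<A> \<alpha>2 p" "X2 p \<in> char_space \<A> \<alpha>1 p"
    "a1 X1 p = a1 X p" "a2 X2 p = a2 X p"
    "\<And>W. W \<in> V \<Longrightarrow> ip X1 W p = gam \<alpha>1 X W p" "\<And>W. W \<in> V \<Longrightarrow> ip X2 W p = gam \<alpha>2 X W p"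
proof -
  obtain X1 X2 where c: "X1 \<in> V" "X2 \<in> V"
    "a2 X1 p = 0" "\<And>W. W \<in> V \<Longrightarrow> ext_d \<alpha>2 X1 W p = 0"
    "a1 X2 p = 0" "\<And>W. W \<in> V \<Longrightarrow> ext_d \<alpha>1 X2 W p = 0"
    "a1 (X - X1 - X2) p = 0" "\<And>W. W \<in> V \<Longrightarrow> ext_d \<alpha>1 (X - X1 - X2) W p = 0"
    "a2 (X - X1 - X2) p = 0" "\<And>W. W \<in> V \<Longrightarrow> ext_d \<alpha>2 (X - X1 - X2) W p = 0"
    by (rule contact_pair_decomposition[OF cp X, of p], rule that)
  define R where "R = X - X1 - X2"
  have R: "R \<in> V" using X c(1,2) by (simp add: R_def)
  have "ip R (F W) p = 0" if "W \<in> V" for W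
    using ip_F[OF R that] c(8,10)[OF that] by (simp add: R_def)
  from this[OF F_closed[OF R]] have "ip R R p = 0"
    using R c(7,9) by (simp add: R_def[symmetric])
  then have "R p = (\<lambda>f. 0)" by (rule ip_nondegenerate[OF R])
  from fun_cong[OF this] have split: "X p = (X1 + X2) p"
    by (intro ext) (simp add: R_def algebra_simps)
  have a: "a1 X1 p = a1 X p" "a2 X2 p = a2 X p" using c(3,5,7,9) X c(1,2) by simp_all
  have e1: "ext_d \<alpha>1 X W p = ip X1 (F W) p" if "W \<in> V" for W
    using ip_F[OF c(1) that] c(4)[OF that] c(6)[OF that] c(8)[OF that] X c(1,2) that by simp
  have e2: "ext_d \<alpha>2 X W p = ip X2 (F W) p" if "W \<in> V" for W
    using ip_F[OF c(2) that] c(4)[OF that] c(6)[OF that] c(10)[OF that] X c(1,2) that by simp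
  show ?thesis
  proof (rule that[OF c(1,2) split _ _ a])
    show "X1 p \<in> char_space \<A> \<alpha>2 p" by (rule char_spaceI[OF c(1,3,4)])
    show "X2 p \<in> char_space \<A> \<alpha>1 p" by (rule char_spaceI[OF c(2,5,6)])
    show "ip X1 W p = gam \<alpha>1 X W p" if "W \<in> V" for W
      using e1[of "F W"] a c(1,3) that by (simp add: gam_def)
    show "ip X2 W p = gam \<alpha>2 X W p" if "W \<in> V" for W
      using e2[of "F W"] a c(2,5) that by (simp add: gam_def)
  qed
qed

text \<open>By orthogonality of the foliations both sides are the inner product of the parts of X
  and Y in the same foliation.\<close>

lemma gam_sym:
  assumes r: "reeb \<alpha> Z" and X: "X \<in> V" and Y: "Y \<in> V"
  shows "gam \<alpha> X Y p = gam \<alpha> Y X p"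
proof -
  obtain X1 X2 where x: "X1 \<in> V" "X2 \<in> V" "X p = (X1 + X2) p"
    "X1 p \<in> char_space \<A> \<alpha>2 p" "X2 p \<in> char_space \<A> \<alpha>1 p"
    "a1 X1 p = a1 X p" "a2 X2 p = a2 X p"
    "\<And>W. W \<in> V \<Longrightarrow> ip X1 W p = gam \<alpha>1 X W p" "\<And>W. W \<in> V \<Longrightarrow> ip X2 W p = gam \<alpha>2 X W p"
    by (rule foliation_splitting[OF X, of p], rule that)
  obtain Y1 Y2 where y: "Y1 \<in> V" "Y2 \<in> V" "Y p = (Y1 + Y2) p"
    "Y1 p \<in> char_space \<A> \<alpha>2 p" "Y2 p \<in> char_space \<A> \<alpha>1 p"
    "a1 Y1 p = a1 Y p" "a2 Y2 p = a2 Y p"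
    "\<And>W. W \<in> V \<Longrightarrow> ip Y1 W p = gam \<alpha>1 Y W p" "\<And>W. W \<in> V \<Longrightarrow> ip Y2 W p = gam \<alpha>2 Y W p"
    by (rule foliation_splitting[OF Y, of p], rule that)
  have o: "ip X2 Y1 p = 0" "ip Y2 X1 p = 0"
    using char_spaces_orthogonal x(4,5) y(4,5) by (simp_all add: inner_app_def)
  have "ip X1 Y p = ip X1 (Y1 + Y2) p" "ip Y1 X p = ip Y1 (X1 + X2) p"
    "ip X2 Y p = ip X2 (Y1 + Y2) p" "ip Y2 X p = ip Y2 (X1 + X2) p"
    by (intro inner_app_cong refl x(3) y(3))+
  then have "gam \<alpha>1 X Y p = gam \<alpha>1 Y X p" "gam \<alpha>2 X Y p = gam \<alpha>2 Y X p"
    using o x(1,2) y(1,2) X Y x(8,9)[OF Y] y(8,9)[OF X]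
      ip_sym[of X1 Y1 p] ip_sym[of X2 Y2 p] ip_sym[of X1 Y2 p] ip_sym[of X2 Y1 p] by simp_all
  with r show ?thesis unfolding reeb_def by (elim disjE conjE) simp_all
qed

lemma orth_proj_eq:
  assumes X: "X \<in> V" and \<alpha>: "one_form \<A> \<alpha>" and X1: "X1 \<in> V" "X1 p \<in> char_space \<A> \<alpha> p"
    and orth: "\<And>w. w \<in> char_space \<A> \<alpha> p \<Longrightarrow> g p ((X - X1) p) w = 0"
  shows "orth_proj g p (char_space \<A> \<alpha> p) (X p) = X1 p"
  unfolding orth_proj_def
proof (rule the_equality)
  have d: "(\<lambda>f. X p f - W p f) = (X - W) p" for W by (simp add: fun_eq_iff)
  show "X1 p \<in> char_space \<A> \<alpha> p \<and> (\<forall>w\<in>char_space \<A> \<alpha> p. g p (\<lambda>f. X p f - X1 p f) w = 0)"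
    using X1 orth by (simp only: d) blast
  fix u assume u: "u \<in> char_space \<A> \<alpha> p \<and> (\<forall>w\<in>char_space \<A> \<alpha> p. g p (\<lambda>f. X p f - u f) w = 0)"
  obtain U where U: "U \<in> V" "u = U p" "form_app \<alpha> U p = 0" "\<And>Y. Y \<in> V \<Longrightarrow> ext_d \<alpha> U Y p = 0"
    by (rule char_spaceE[OF conjunct1[OF u]], rule that)
  \<comment> \<open>Membership of \<open>X1 p\<close> is witnessed by a field that agrees with X1 at
    p only.\<close>
  obtain W where W: "W \<in> V" "X1 p = W p" "form_app \<alpha> W p = 0" "\<And>Y. Y \<in> V \<Longrightarrow> ext_d \<alpha> W Y p = 0"
    by (rule char_spaceE[OF X1(2)], rule that)
  have WU: "(W - U) p \<in> char_space \<A> \<alpha> p" by (rule char_spaceI[of "W - U"]) (use \<alpha> U W in simp_all)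
  have "ip (X - X1) (W - U) p = 0" using orth[OF WU] by (simp only: inner_app_def)
  moreover have "ip (X - U) (W - U) p = 0"
    using bspec[OF conjunct2[OF u] WU] by (simp only: inner_app_def U(2) d)
  ultimately have "ip (W - U) (W - U) p = 0"
    using inner_app_cong[of X1 p W "W - U" "W - U", OF W(2) refl] X X1(1) U(1) W(1) by simp
  then have "(W - U) p = (\<lambda>f. 0)" by (rule ip_nondegenerate[of "W - U", rotated]) (use U W in simp)
  from fun_cong[OF this] show "u = X1 p" unfolding U(2) W(2) by (intro ext) simp
qed

lemma gam_add: "X \<in> V \<Longrightarrow> Y \<in> V \<Longrightarrow> gam \<alpha>1 X Y p + gam \<alpha>2 X Y p = ip X Y p"
  using ip_F[of X "F Y" p] by (simp add: gam_def algebra_simps)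

lemma gam_Z:
  assumes "reeb \<alpha> Z" "reeb \<beta> Z'" "X \<in> V"
  shows "gam \<alpha> X Z' p = form_app \<alpha> X p * form_app \<alpha> Z' p"
    "gam \<alpha> Z' X p = form_app \<alpha> X p * form_app \<alpha> Z' p"
proof -
  have "F Z' = 0" using assms(2) unfolding reeb_def by (elim disjE conjE) simp_all
  then show *: "gam \<alpha> X Z' p = form_app \<alpha> X p * form_app \<alpha> Z' p"
    using assms by (simp add: gam_def)
  show "gam \<alpha> Z' X p = form_app \<alpha> X p * form_app \<alpha> Z' p"
    using gam_sym[OF assms(1) _ assms(3), of Z' p] * assms by simp
qed

text \<open>Removes F from exterior derivatives, so that the later tensor computations become
  polynomial identities.\<close>

lemma ext_d_F:
  assumes "reeb \<alpha> Z" "X \<in> V" "Y \<in> V"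
  shows "ext_d \<alpha> X (F Y) p = form_app \<alpha> X p * form_app \<alpha> Y p - gam \<alpha> X Y p"
    "ext_d \<alpha> (F X) Y p = gam \<alpha> X Y p - form_app \<alpha> X p * form_app \<alpha> Y p"
  using gam_sym[OF assms, of p] ext_d_skew[of \<alpha> "F X" Y p] assms by (simp_all add: gam_def)

section \<open>The conditions to be compared\<close>

lemma vscale_zero [simp]: "vscale f 0 = 0"
  by (simp add: vscale_apply fun_eq_iff)

lemma ip_field_eqI:
  assumes "X \<in> V" "Y \<in> V" "\<And>W p. W \<in> V \<Longrightarrow> ip X W p = ip Y W p"
  shows "X = Y"
  using ip_zeroI[of "X - Y"] assms by simp

definition curvature_condition :: bool where
  "curvature_condition \<longleftrightarrow> (\<forall>X\<in>V. \<forall>Y\<in>V. \<forall>W\<in>V. \<forall>p.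
     ip (curvature nabla X Y (Z1 + Z2)) W p =
       (a1 Y p * gam \<alpha>1 X W p - a1 X p * gam \<alpha>1 Y W p) +
       (a2 Y p * gam \<alpha>2 X W p - a2 X p * gam \<alpha>2 Y W p))"

definition DF_condition :: bool where
  "DF_condition \<longleftrightarrow> (\<forall>X\<in>V. \<forall>Y\<in>V. \<forall>W\<in>V. \<forall>p.
     ip (DF X Y) W p =
       (a1 W p * gam \<alpha>1 X Y p - a1 Y p * gam \<alpha>1 X W p) +
       (a2 W p * gam \<alpha>2 X Y p - a2 Y p * gam \<alpha>2 X W p))"

text \<open>By \<open>ext_d_nabla\<close> the right-hand side is the skew part of the left-hand
  side, so equality says that the symmetric part vanishes, which is the Killing equation for each
  Reeb field.\<close>

definition killing_condition :: bool where
  "killing_condition \<longleftrightarrow> (\<forall>\<alpha> Z. reeb \<alpha> Z \<longrightarrow> (\<forall>X\<in>V. \<forall>W\<in>V. \<forall>p.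
     ip (nabla X Z) W p = ext_d \<alpha> X W p))"

lemma curvature_eq:
  "curvature nabla X Y W = nabla X (nabla Y W) - nabla Y (nabla X W) - nabla (br X Y) W"
  by (simp add: curvature_def vsub_eq)

lemma curvature_closed [simp, intro]:
  "X \<in> V \<Longrightarrow> Y \<in> V \<Longrightarrow> W \<in> V \<Longrightarrow> curvature nabla X Y W \<in> V"
  by (simp add: curvature_eq)

lemma DF_Z: "X \<in> V \<Longrightarrow> DF X Z1 = - F (nabla X Z1)" "X \<in> V \<Longrightarrow> DF X Z2 = - F (nabla X Z2)"
  by (simp_all add: DF_def)

lemma curvature_Z:
  assumes Z: "\<And>U. U \<in> V \<Longrightarrow> nabla U (Z1 + Z2) = - F U" and X: "X \<in> V" and Y: "Y \<in> V" and W: "W \<in> V"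
  shows "ip (curvature nabla X Y (Z1 + Z2)) W p = ip (DF W X) Y p"
proof -
  \<comment> \<open>The sum rule for \<open>nabla\<close> is switched off so that the derivative of
    the sum stays in the shape rewritten by the assumption \<open>Z\<close>.\<close>
  have "curvature nabla X Y (Z1 + Z2) = DF Y X - DF X Y"
    using X Y by (simp add: curvature_eq Z torsion DF_def del: nabla_simps(2))
  then have "ip (curvature nabla X Y (Z1 + Z2)) W p = ip (DF Y X) W p - ip (DF X Y) W p"
    using X Y W by simp
  then show ?thesis
    using DF_cyclic[OF X Y W, of p] DF_skew[OF Y X W, of p] DF_skew[OF W Y X, of p] by linarith
qed

lemma killing_nabla_Z:
  assumes killing_condition "X \<in> V"
  shows "nabla X (Z1 + Z2) = - F X"
proof (rule ip_field_eqI)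
  fix W p assume W: "W \<in> V"
  have "ip (nabla X Z1) W p = ext_d \<alpha>1 X W p" "ip (nabla X Z2) W p = ext_d \<alpha>2 X W p"
    using assms W reeb12 unfolding killing_condition_def by blast+
  then show "ip (nabla X (Z1 + Z2)) W p = ip (- F X) W p"
    using ip_F[OF assms(2) W, of p] ip_F_skew[OF assms(2) W, of p] assms(2) W by simp
qed (use assms in simp_all)

lemma DF_condition_imp_curvature_condition:
  assumes DF_condition killing_condition shows curvature_condition
  unfolding curvature_condition_def
proof (intro ballI allI)
  fix X Y W p assume v: "X \<in> V" "Y \<in> V" "W \<in> V"
  have "ip (curvature nabla X Y (Z1 + Z2)) W p = ip (DF W X) Y p"
    by (rule curvature_Z[OF killing_nabla_Z[OF assms(2)] v])
  also have "\<dots> = (a1 Y p * gam \<alpha>1 W X p - a1 X p * gam \<alpha>1 W Y p) +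
       (a2 Y p * gam \<alpha>2 W X p - a2 X p * gam \<alpha>2 W Y p)"
    using assms(1) v unfolding DF_condition_def by blast
  finally show "ip (curvature nabla X Y (Z1 + Z2)) W p =
       (a1 Y p * gam \<alpha>1 X W p - a1 X p * gam \<alpha>1 Y W p) +
       (a2 Y p * gam \<alpha>2 X W p - a2 X p * gam \<alpha>2 Y W p)"
    using gam_sym[OF reeb12(1) v(3,1), of p] gam_sym[OF reeb12(1) v(3,2), of p]
      gam_sym[OF reeb12(2) v(3,1), of p] gam_sym[OF reeb12(2) v(3,2), of p] by simp
qed

text \<open>At a Reeb field the derivative of \<open>\<phi>\<close> is minus F of the derivative of
  that field. This determines the latter against the image of F; in the Reeb directions it vanishes
  in any case.\<close>

lemma DF_condition_imp_killing:
  assumes DF_condition shows killing_condition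
  unfolding killing_condition_def
proof (intro allI impI ballI)
  fix \<alpha> Z X W p assume r: "reeb \<alpha> Z" and X: "X \<in> V" and W: "W \<in> V"
  have Z: "Z \<in> V" using r by simp
  have F: "ip (nabla X Z) (F W) p = ext_d \<alpha> X (F W) p" if W: "W \<in> V" for W
  proof -
    have "ip (DF X Z) W p = (a1 W p * gam \<alpha>1 X Z p - a1 Z p * gam \<alpha>1 X W p) +
       (a2 W p * gam \<alpha>2 X Z p - a2 Z p * gam \<alpha>2 X W p)"
      using assms X Z W unfolding DF_condition_def by blast
    also have "\<dots> = - ext_d \<alpha> X (F W) p * (-1)"
      using r X W gam_Z(1)[OF reeb12(1) r X] gam_Z(1)[OF reeb12(2) r X]
        ext_d_F(1)[OF r X W] unfolding reeb_def by (elim disjE conjE) (simp_all add: algebra_simps)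
    finally have "ip (DF X Z) W p = ext_d \<alpha> X (F W) p" by simp
    moreover have "DF X Z = - F (nabla X Z)" using r DF_Z[OF X] unfolding reeb_def by blast
    ultimately show ?thesis using ip_F_skew[of "nabla X Z" W p] X Z W by simp
  qed
  have "a1 (nabla X Z) p = 0" "a2 (nabla X Z) p = 0"
    using r a_nabla_Z[OF X] unfolding reeb_def by auto
  then show "ip (nabla X Z) W p = ext_d \<alpha> X W p"
    using F[OF F_closed[OF W]] ext_d_FF[OF r X W, of p] X Z W by simp
qed

text \<open>The cyclic identity with the Reeb field as third argument; two of its terms become
  derivatives of that field.\<close>

lemma nabla_reeb_F:
  assumes r: "reeb \<alpha> Z" and X: "X \<in> V" and Y: "Y \<in> V"
  shows "ip (nabla X Z) (F Y) p + ip (DF Z Y) X p + ip (F (nabla Y Z)) X p = 0"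
proof -
  have Z: "Z \<in> V" using r by simp
  have "DF U Z = - F (nabla U Z)" if "U \<in> V" for U
    using r DF_Z[OF that] unfolding reeb_def by blast
  then show ?thesis
    using DF_cyclic[OF X Y Z, of p] DF_skew[OF X Y Z, of p] DF_skew[OF Z X Y, of p]
      ip_F_skew[of "nabla X Z" Y p] X Y Z by simp
qed

subsection \<open>The curvature condition implies the formula for the derivative of the endomorphism\<close>

text \<open>This symmetric operator vanishes precisely if the Reeb field Z is Killing.\<close>

definition S :: "'a vfield \<Rightarrow> 'a vfield" where
  "S X = nabla X (Z1 + Z2) + F X"

lemma S_closed [simp, intro]: "X \<in> V \<Longrightarrow> S X \<in> V"
  by (simp add: S_def)

lemma S_lin [simp]:
  assumes "X \<in> V"
  shows "Y \<in> V \<Longrightarrow> S (X + Y) = S X + S Y" "Y \<in> V \<Longrightarrow> S (X - Y) = S X - S Y" "S (- X) = - S X"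
    "f \<in> C \<Longrightarrow> S (vscale f X) = vscale f (S X)"
  using assms by (simp_all add: S_def vscale_apply fun_eq_iff algebra_simps del: nabla_simps(2))

lemma S_Z [simp]: "S Z1 = 0" "S Z2 = 0"
  by (simp_all add: S_def nabla_Z_Z[OF reeb12(1) reeb12(1)] nabla_Z_Z[OF reeb12(1) reeb12(2)]
      nabla_Z_Z[OF reeb12(2) reeb12(1)] nabla_Z_Z[OF reeb12(2) reeb12(2)])

lemma a_S [simp]: "X \<in> V \<Longrightarrow> a1 (S X) = (\<lambda>p. 0)" "X \<in> V \<Longrightarrow> a2 (S X) = (\<lambda>p. 0)"
  by (rule ext, simp add: S_def)+

text \<open>The skew part of the derivative of Z is exactly \<open>- F\<close>, because the two
  exterior derivatives add up to the fundamental form.\<close>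

lemma S_sym:
  assumes "X \<in> V" "Y \<in> V" shows "ip (S X) Y p = ip X (S Y) p"
proof -
  have "2 * ext_d \<alpha>1 X Y p = ip (nabla X Z1) Y p - ip (nabla Y Z1) X p"
    "2 * ext_d \<alpha>2 X Y p = ip (nabla X Z2) Y p - ip (nabla Y Z2) X p"
    by (rule ext_d_nabla[OF reeb12(1) assms] ext_d_nabla[OF reeb12(2) assms])+
  moreover have "ip (S X) Y p = ip (nabla X Z1) Y p + ip (nabla X Z2) Y p - ip X (F Y) p"
    using assms ip_F_skew[OF assms, of p] by (simp add: S_def)
  moreover have "ip (S Y) X p = ip (nabla Y Z1) X p + ip (nabla Y Z2) X p + ip X (F Y) p"
    using assms ip_sym[of "F Y" X p] by (simp add: S_def)
  ultimately show ?thesis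
    using ip_F[OF assms, of p] ip_sym[of "S Y" X p] assms by simp
qed

abbreviation "Z \<equiv> Z1 + Z2"

lemma DF_Z_eq:
  assumes Y: "Y \<in> V" shows "DF Z Y = - (S (F Y) + F (S Y))"
proof (rule ip_field_eqI)
  fix X p assume X: "X \<in> V"
  have Zs: "nabla U Z = S U - F U" for U by (simp add: S_def)
  have "ip (nabla X Z) (F Y) p + ip (DF Z Y) X p + ip (F (nabla Y Z)) X p = 0"
    using nabla_reeb_F[OF reeb12(1) X Y, of p] nabla_reeb_F[OF reeb12(2) X Y, of p] X Y
    by (simp add: DF_def)
  then have "ip (S X) (F Y) p - ip (F X) (F Y) p + ip (DF Z Y) X p
      + ip (F (S Y)) X p - ip (F (F Y)) X p = 0"
    unfolding Zs using X Y by simp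
  moreover have "ip (F X) (F Y) p = - ip (F (F Y)) X p"
    using ip_F_skew[of X "F Y" p] ip_sym[of X "F (F Y)" p] X Y by (simp del: FF)
  moreover have "ip (S X) (F Y) p = ip (S (F Y)) X p"
    using S_sym[of X "F Y" p] ip_sym[of X "S (F Y)" p] X Y by simp
  ultimately show "ip (DF Z Y) X p = ip (- (S (F Y) + F (S Y))) X p"
    using X Y by simp
qed (use Y in simp_all)

text \<open>The square of F is minus the identity plus Reeb terms that are parallel along Z, so its
  derivative along Z vanishes. Inserting \<open>DF_Z_eq\<close> leaves twice the difference of
  \<open>F (S (F Y))\<close> and \<open>S Y\<close>.\<close>

lemma F_S_F:
  assumes Y: "Y \<in> V" shows "F (S (F Y)) = S Y"
proof -
  \<comment> \<open>The name keeps the simplifier from distributing over the sum of the Reeb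
    fields.\<close>
  define z where "z = Z"
  have z: "z \<in> V" by (simp add: z_def)
  have nz: "nabla z Z1 = 0" "nabla z Z2 = 0"
    by (simp_all add: z_def nabla_Z_Z[OF reeb12(1) reeb12(1)] nabla_Z_Z[OF reeb12(1) reeb12(2)]
      nabla_Z_Z[OF reeb12(2) reeb12(1)] nabla_Z_Z[OF reeb12(2) reeb12(2)])
  have d: "der z (a1 Y) = a1 (nabla z Y)" "der z (a2 Y) = a2 (nabla z Y)"
    using compat[OF z Y, of Z1] compat[OF z Y, of Z2] z Y by (simp_all add: nz fun_eq_iff)
  have "DF z (F Y) + F (DF z Y) = nabla z (F (F Y)) - F (F (nabla z Y))"
    using z Y by (simp add: DF_def del: FF)
  also have "\<dots> = 0"
    using z Y by (simp add: nz d)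
  finally have "S (F (F Y)) + F (S (F Y)) + F (S (F Y)) + F (F (S Y)) = 0"
    using Y by (simp add: z_def DF_Z_eq del: FF) (simp add: algebra_simps neg_eq_iff_add_eq_0 del: FF)
  then have "S Y p f + S Y p f = F (S (F Y)) p f + F (S (F Y)) p f" for p f
    using Y by (simp add: vscale_apply fun_eq_iff algebra_simps)
  then show ?thesis by (simp add: fun_eq_iff)
qed

lemma F_S: "Y \<in> V \<Longrightarrow> F (S Y) = - S (F Y)"
  using F_S_F[of "F Y"] by (simp add: minus_equation_iff[of "F (S Y)"])

lemma DF_Z_zero: "Y \<in> V \<Longrightarrow> DF Z Y = 0"
  by (simp only: DF_Z_eq F_S) simp

text \<open>The curvature condition for the pair X, Z is a Riccati equation for S along Z. Conjugating
  it with the endomorphism, which anticommutes with S and is parallel along Z, reverses the sign of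
  the quadratic term, so S vanishes.\<close>

lemma S_zero:
  assumes cc: curvature_condition and X: "X \<in> V"
  shows "S X = 0"
proof -
  define z where "z = Z"
  have z: "z \<in> V" by (simp add: z_def)
  have nz: "nabla z z = 0"
    by (simp add: z_def nabla_Z_Z[OF reeb12(1) reeb12(1)] nabla_Z_Z[OF reeb12(1) reeb12(2)]
      nabla_Z_Z[OF reeb12(2) reeb12(1)] nabla_Z_Z[OF reeb12(2) reeb12(2)])
  have az: "a1 z p = 1" "a2 z p = 1" for p by (simp_all add: z_def)
  have Nz: "nabla U z = S U - F U" for U by (simp add: S_def z_def)
  have FN: "nabla z (F U) = F (nabla z U)" if "U \<in> V" for U
    using DF_Z_zero[OF that] by (simp add: DF_def z_def)
  have gz: "gam \<alpha>1 z W p = a1 W p" "gam \<alpha>2 z W p = a2 W p" if "W \<in> V" for W p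
    using that gam_sym[OF reeb12(1) z that, of p] gam_sym[OF reeb12(2) z that, of p]
      gam_Z(1)[OF reeb12(1) reeb12(1) that, of p] by (simp_all add: z_def gam_def)
  have ric: "nabla z (S U) = S (nabla z U) - S (S U)" if U: "U \<in> V" for U
  proof -
    have "curvature nabla U z z = - F (F U)"
    proof (rule ip_field_eqI)
      fix W p assume W: "W \<in> V"
      have "ip (curvature nabla U z z) W p =
         (a1 z p * gam \<alpha>1 U W p - a1 U p * gam \<alpha>1 z W p) +
         (a2 z p * gam \<alpha>2 U W p - a2 U p * gam \<alpha>2 z W p)"
        using cc U z W unfolding curvature_condition_def z_def by blast
      also have "\<dots> = ip U W p - a1 U p * a1 W p - a2 U p * a2 W p"
        using gam_add[OF U W, of p] gz[OF W] by (simp add: az)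
      finally show "ip (curvature nabla U z z) W p = ip (- F (F U)) W p"
        using U W by simp
    qed (use U z in simp_all)
    \<comment> \<open>The mixed terms cancel since F anticommutes with S, and the derivatives of F U
      along z cancel since F is parallel along z. The last term is the prescribed curvature, so
      exactly the Riccati equation remains.\<close>
    moreover have "curvature nabla U z z = - nabla z (S U) + S (nabla z U) - S (S U) - F (F U)"
    proof -
      have br: "br U z = S U - F U - nabla z U" using U z by (simp only: torsion Nz)
      have "curvature nabla U z z = nabla U 0 - nabla z (S U - F U)
          - (S (S U - F U - nabla z U) - F (S U - F U - nabla z U))"
        by (simp only: curvature_eq Nz[of z, unfolded nz, symmetric] Nz br)
      then show ?thesis
        using U z FN[OF U] F_S[OF U] by (simp add: fun_eq_iff del: FF)
    qed
    ultimately have r: "(- nabla z (S U) + S (nabla z U) - S (S U) - F (F U)) p f = (- F (F U)) p f" for p f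
      by (simp only:)
    have eq: "- nabla z (S U) p f + S (nabla z U) p f - S (S U) p f = 0" for p f
      using r[of p f] by (simp only: minus_apply plus_fun_apply uminus_apply)
    show ?thesis
    proof (intro ext)
      fix p f
      show "nabla z (S U) p f = (S (nabla z U) - S (S U)) p f"
        using eq[of p f] by (simp only: minus_apply)
    qed
  qed
  have "F (nabla z (S (F X))) = F (S (nabla z (F X))) - F (S (S (F X)))"
    using ric[of "F X"] X z by simp
  moreover have "F (nabla z (S (F X))) = nabla z (S X)"
    using FN[of "S (F X)"] F_S_F[OF X] X by simp
  moreover have "F (S (nabla z (F X))) = S (nabla z X)"
    using FN[OF X] F_S_F[of "nabla z X"] X z by simp
  moreover have "F (S (S (F X))) = - S (S X)"
    using F_S[of "S (F X)"] F_S_F[OF X] X by simp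
  ultimately have r: "(S (nabla z X) - - S (S X)) p f = (S (nabla z X) - S (S X)) p f" for p f
    using ric[OF X] by (simp only:)
  have "S (S X) p f = 0" for p f
    using r[of p f] by simp
  then have SS: "S (S X) = 0" by (intro ext) simp
  have "S X p = 0 p" for p
  proof -
    \<comment> \<open>A symmetric operator with square zero vanishes.\<close>
    have "ip (S X) (S X) p = 0" using S_sym[of "S X" X p] SS X by simp
    then show ?thesis using ip_nondegenerate[of "S X" p] X by (simp add: fun_eq_iff)
  qed
  then show ?thesis by (rule ext)
qed

lemma curvature_condition_imp_DF_condition:
  assumes cc: curvature_condition shows DF_condition
  unfolding DF_condition_def
proof (intro ballI allI)
  fix X Y W p assume v: "X \<in> V" "Y \<in> V" "W \<in> V"
  have "nabla U Z = - F U" if "U \<in> V" for U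
    using S_zero[OF cc that] unfolding S_def by (simp only: eq_neg_iff_add_eq_0)
  from curvature_Z[OF this v(2,3,1), of p]
  have "ip (DF X Y) W p = ip (curvature nabla Y W Z) X p" by simp
  also have "\<dots> = (a1 W p * gam \<alpha>1 Y X p - a1 Y p * gam \<alpha>1 W X p) +
       (a2 W p * gam \<alpha>2 Y X p - a2 Y p * gam \<alpha>2 W X p)"
    using cc v unfolding curvature_condition_def by blast
  finally show "ip (DF X Y) W p =
       (a1 W p * gam \<alpha>1 X Y p - a1 Y p * gam \<alpha>1 X W p) +
       (a2 W p * gam \<alpha>2 X Y p - a2 Y p * gam \<alpha>2 X W p)"
    using gam_sym[OF reeb12(1) v(1,2), of p] gam_sym[OF reeb12(1) v(1,3), of p]
      gam_sym[OF reeb12(2) v(1,2), of p] gam_sym[OF reeb12(2) v(1,3), of p] by simp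
qed

subsection \<open>Normality in terms of the covariant derivative of the endomorphism\<close>

lemma nijenhuis_eq:
  "nijenhuis J X Y = endo_app J (endo_app J (br X Y)) - endo_app J (br (endo_app J X) Y)
    - endo_app J (br X (endo_app J Y)) + br (endo_app J X) (endo_app J Y)"
  by (simp add: nijenhuis_def vadd_eq vsub_eq)

text \<open>For a torsion-free connection the terms in which the endomorphism is not differentiated
  cancel. No condition on the square of J is imposed, so this serves \<open>\<phi>\<close> as well
  as the almost complex structures.\<close>

lemma nijenhuis_nabla:
  assumes cl: "\<And>U. U \<in> V \<Longrightarrow> endo_app J U \<in> V"
    and lin: "\<And>U W. U \<in> V \<Longrightarrow> W \<in> V \<Longrightarrow> endo_app J (U - W) = endo_app J U - endo_app J W"
    and X: "X \<in> V" and Y: "Y \<in> V"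
    and D: "\<And>U W. D U W = nabla U (endo_app J W) - endo_app J (nabla U W)"
  shows "nijenhuis J X Y = D (endo_app J X) Y - D (endo_app J Y) X
    - endo_app J (D X Y) + endo_app J (D Y X)"
  using X Y by (simp add: nijenhuis_eq torsion lin cl D algebra_simps)

text \<open>The rotation of the Reeb plane by which the two almost complex structures differ from F:
  they are F + P and F - P.\<close>

definition P :: "'a vfield \<Rightarrow> 'a vfield" where
  "P X = vscale (a1 X) Z2 - vscale (a2 X) Z1"

lemma P_closed [simp, intro]: "X \<in> V \<Longrightarrow> P X \<in> V"
  by (simp add: P_def)

lemma P_minus [simp]: "X \<in> V \<Longrightarrow> Y \<in> V \<Longrightarrow> P (X - Y) = P X - P Y"
  by (simp add: P_def vscale_apply fun_eq_iff algebra_simps)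

lemma a_P [simp]: "X \<in> V \<Longrightarrow> a1 (P X) p = - a2 X p" "X \<in> V \<Longrightarrow> a2 (P X) p = a1 X p"
  by (simp_all add: P_def)

lemma F_P [simp]: "X \<in> V \<Longrightarrow> F (P X) = 0"
  by (simp add: P_def)

lemma endo_app_J: "endo_app (J_structure \<alpha>1 \<alpha>2 Z1 Z2 \<phi>) X = F X + P X"
  by (simp add: J_structure_def endo_app_def P_def form_app_def vscale_apply fun_eq_iff)

lemma endo_app_T: "endo_app (T_structure \<alpha>1 \<alpha>2 Z1 Z2 \<phi>) X = F X - P X"
  by (simp add: T_structure_def endo_app_def P_def form_app_def vscale_apply fun_eq_iff)

lemma nabla_P:
  assumes K: killing_condition and X: "X \<in> V" and Y: "Y \<in> V" and W: "W \<in> V"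
  shows "ip (nabla X (P Y) - P (nabla X Y)) W p = ext_d \<alpha>1 X Y p * a2 W p + a1 Y p * ext_d \<alpha>2 X W p
    - ext_d \<alpha>2 X Y p * a1 W p - a2 Y p * ext_d \<alpha>1 X W p"
proof -
  have k: "ip (nabla X Z1) U p = ext_d \<alpha>1 X U p" "ip (nabla X Z2) U p = ext_d \<alpha>2 X U p"
    if "U \<in> V" for U
    using K X that reeb12 unfolding killing_condition_def by blast+
  have "der X (a1 Y) p = a1 (nabla X Y) p + ext_d \<alpha>1 X Y p"
    "der X (a2 Y) p = a2 (nabla X Y) p + ext_d \<alpha>2 X Y p"
    using compat[OF X Y, of Z1 p] compat[OF X Y, of Z2 p] k[OF Y]
      ip_sym[OF Y, of "nabla X Z1" p] ip_sym[OF Y, of "nabla X Z2" p] X Y by simp_all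
  then show ?thesis using X Y W k[OF W] by (simp add: P_def algebra_simps)
qed

text \<open>The sign e covers both almost complex structures. The derivative of \<open>J\<close> is
  known from the two conditions, and skewness moves an outer \<open>J\<close> onto the test field
  W.\<close>

lemma nijenhuis_zero:
  assumes DFc: DF_condition and K: killing_condition
    and E: "\<And>U. endo_app J U = F U + vscale (\<lambda>_. e) (P U)" and e: "e * e = 1"
    and X: "X \<in> V" and Y: "Y \<in> V"
  shows "nijenhuis J X Y = 0"
proof (rule ip_field_eqI)
  define D where "D U W = nabla U (endo_app J W) - endo_app J (nabla U W)" for U W
  have cl [simp]: "endo_app J U \<in> V" if "U \<in> V" for U using that by (simp add: E)
  have lin: "endo_app J (U - W) = endo_app J U - endo_app J W" if "U \<in> V" "W \<in> V" for U W
    using that by (simp add: E vscale_apply fun_eq_iff algebra_simps)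
  have Dcl [simp]: "D U W \<in> V" if "U \<in> V" "W \<in> V" for U W using that by (simp add: D_def)
  have nij: "nijenhuis J X Y = D (endo_app J X) Y - D (endo_app J Y) X
    - endo_app J (D X Y) + endo_app J (D Y X)"
    by (rule nijenhuis_nabla[OF cl lin X Y]) (simp_all only: D_def)
  then show "nijenhuis J X Y \<in> V" using X Y by simp
  fix W p assume W: "W \<in> V"
  have skew: "ip (endo_app J U) W p = - ip U (endo_app J W) p" if "U \<in> V" for U
    using that W ip_F_skew[OF that W, of p] by (simp add: E P_def algebra_simps)
  have D_ip: "ip (D U U') W p =
      (a1 W p * gam \<alpha>1 U U' p - a1 U' p * gam \<alpha>1 U W p) +
      (a2 W p * gam \<alpha>2 U U' p - a2 U' p * gam \<alpha>2 U W p) +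
      e * (ext_d \<alpha>1 U U' p * a2 W p + a1 U' p * ext_d \<alpha>2 U W p
        - ext_d \<alpha>2 U U' p * a1 W p - a2 U' p * ext_d \<alpha>1 U W p)"
    if v: "U \<in> V" "U' \<in> V" "W \<in> V" for U U' W
  proof -
    have "D U U' = DF U U' + vscale (\<lambda>_. e) (nabla U (P U') - P (nabla U U'))"
      using v by (simp add: D_def E DF_def) (simp add: vscale_apply fun_eq_iff algebra_simps der_def vf_const)
    moreover have "ip (DF U U') W p =
      (a1 W p * gam \<alpha>1 U U' p - a1 U' p * gam \<alpha>1 U W p) +
      (a2 W p * gam \<alpha>2 U U' p - a2 U' p * gam \<alpha>2 U W p)"
      using DFc v unfolding DF_condition_def by blast
    ultimately show ?thesis using v nabla_P[OF K v, of p] by simp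
  qed
  have ext_E: "ext_d \<alpha> U (endo_app J U') p = ext_d \<alpha> U (F U') p"
    "ext_d \<alpha> (endo_app J U) U' p = ext_d \<alpha> (F U) U' p"
    if "reeb \<alpha> \<zeta>" "U \<in> V" "U' \<in> V" for \<alpha> \<zeta> U U'
    using that unfolding reeb_def by (elim disjE conjE; simp add: E P_def)+
  have a_E: "a1 (endo_app J U) p = - e * a2 U p" "a2 (endo_app J U) p = e * a1 U p"
    if "U \<in> V" for U using that by (simp_all add: E)
  have gam_E: "gam \<alpha>1 U (endo_app J U') p = ext_d \<alpha>1 U U' p - e * a2 U' p * a1 U p"
    "gam \<alpha>2 U (endo_app J U') p = ext_d \<alpha>2 U U' p + e * a1 U' p * a2 U p"
    if "U \<in> V" "U' \<in> V" for U U'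
  proof -
    have "F (endo_app J U') = F (F U')" using that by (simp add: E del: FF)
    then have "gam \<alpha> U (endo_app J U') p
        = form_app \<alpha> U p * form_app \<alpha> (endo_app J U') p + ext_d \<alpha> U U' p"
      if "reeb \<alpha> \<zeta>" for \<alpha> \<zeta>
      using ext_d_FF[OF that \<open>U \<in> V\<close> \<open>U' \<in> V\<close>, of p] by (simp add: gam_def del: FF)
    from this[OF reeb12(1)] this[OF reeb12(2)]
    show "gam \<alpha>1 U (endo_app J U') p = ext_d \<alpha>1 U U' p - e * a2 U' p * a1 U p"
      "gam \<alpha>2 U (endo_app J U') p = ext_d \<alpha>2 U U' p + e * a1 U' p * a2 U p"
      using a_E[OF \<open>U' \<in> V\<close>] by simp_all
  qed
  have gam_E': "gam \<alpha>1 (endo_app J U') U p = ext_d \<alpha>1 U U' p - e * a2 U' p * a1 U p"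
    "gam \<alpha>2 (endo_app J U') U p = ext_d \<alpha>2 U U' p + e * a1 U' p * a2 U p"
    if "U \<in> V" "U' \<in> V" for U U'
    using gam_E[OF that] gam_sym[OF reeb12(1) cl[OF that(2)] that(1), of p]
      gam_sym[OF reeb12(2) cl[OF that(2)] that(1), of p] by simp_all
  have "ip (nijenhuis J X Y) W p = ip (D (endo_app J X) Y) W p - ip (D (endo_app J Y) X) W p
      + ip (D X Y) (endo_app J W) p - ip (D Y X) (endo_app J W) p"
    unfolding nij using X Y W by (simp add: skew)
  also have "\<dots> = 0"
  proof -
    \<comment> \<open>The rules express everything by \<open>gam\<close> and \<open>ext_d\<close> of
      pairs in a fixed order and these six values; what remains is a polynomial identity modulo
      \<open>e * e = 1\<close>.\<close>
    define x1 x2 y1 y2 w1 w2 where "x1 = a1 X p" and "x2 = a2 X p" and "y1 = a1 Y p"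
      and "y2 = a2 Y p" and "w1 = a1 W p" and "w2 = a2 W p"
    note sym = gam_sym[OF reeb12(1) Y X, of p] gam_sym[OF reeb12(2) Y X, of p]
      gam_sym[OF reeb12(1) W X, of p] gam_sym[OF reeb12(2) W X, of p]
      gam_sym[OF reeb12(1) W Y, of p] gam_sym[OF reeb12(2) W Y, of p]
      ext_d_skew[OF forms(1) Y X, of p] ext_d_skew[OF forms(2) Y X, of p]
      ext_d_skew[OF forms(1) W X, of p] ext_d_skew[OF forms(2) W X, of p]
      ext_d_skew[OF forms(1) W Y, of p] ext_d_skew[OF forms(2) W Y, of p]
    note rules = D_ip a_E gam_E gam_E' ext_E[OF reeb12(1)] ext_E[OF reeb12(2)]
        ext_d_F[OF reeb12(1)] ext_d_F[OF reeb12(2)] cl X Y W sym x1_def[symmetric]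
        x2_def[symmetric] y1_def[symmetric] y2_def[symmetric] w1_def[symmetric] w2_def[symmetric]
    show ?thesis
      using e by (simp only: rules) algebra
  qed
  finally show "ip (nijenhuis J X Y) W p = ip 0 W p" using W by simp
qed simp

lemma DF_condition_imp_normal:
  assumes DF_condition shows "normal_pair \<A> \<alpha>1 \<alpha>2 Z1 Z2 \<phi>"
proof -
  note n = nijenhuis_zero[OF assms DF_condition_imp_killing[OF assms]]
  have z: "(\<lambda>p f. 0) = (0 :: 'a vfield)" by (simp add: fun_eq_iff)
  have J: "endo_app (J_structure \<alpha>1 \<alpha>2 Z1 Z2 \<phi>) U = F U + vscale (\<lambda>_. 1) (P U)" for U
    by (simp add: endo_app_J vscale_def)
  have T: "endo_app (T_structure \<alpha>1 \<alpha>2 Z1 Z2 \<phi>) U = F U + vscale (\<lambda>_. -1) (P U)" for U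
    by (simp add: endo_app_T vscale_minus_one)
  show ?thesis
    unfolding normal_pair_def integrable_acs_def z by (auto intro: n[OF J] n[OF T])
qed

section \<open>Normality implies the formula for the derivative of the endomorphism\<close>

lemma lie_bracket_right [simp]:
  assumes "X \<in> V" "Y \<in> V" "W \<in> V"
  shows "br W (X + Y) = br W X + br W Y" "br W (X - Y) = br W X - br W Y"
  using assms by (simp_all add: torsion algebra_simps)

lemma lie_bracket_minus_left [simp]:
  assumes "X \<in> V" "Y \<in> V" "W \<in> V"
  shows "br (X - Y) W = br X W - br Y W"
  using assms by (simp add: torsion algebra_simps)

lemma ip_P_F [simp]: "X \<in> V \<Longrightarrow> W \<in> V \<Longrightarrow> ip (P X) (F W) p = 0"
  by (simp add: P_def)

text \<open>Reeb fields have vanishing derivatives along each other, so the bracket of two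
  combinations of them is again one, and these are orthogonal to the image of F.\<close>

lemma ip_br_P_F:
  assumes "X \<in> V" "Y \<in> V" "W \<in> V"
  shows "ip (br (P X) (P Y)) (F W) p = 0"
  using assms by (simp add: torsion P_def nabla_Z_Z[OF reeb12(1) reeb12(1)]
      nabla_Z_Z[OF reeb12(1) reeb12(2)] nabla_Z_Z[OF reeb12(2) reeb12(1)]
      nabla_Z_Z[OF reeb12(2) reeb12(2)])

text \<open>In the sum of the two torsions the terms of odd degree in P cancel. Those of degree two
  have values in the Reeb plane and disappear against the image of F, which leaves twice the torsion
  of \<open>\<phi>\<close>.\<close>

lemma normal_imp_nijenhuis:
  assumes n: "normal_pair \<A> \<alpha>1 \<alpha>2 Z1 Z2 \<phi>" and X: "X \<in> V" and Y: "Y \<in> V" and W: "W \<in> V"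
  shows "ip (nijenhuis \<phi> X Y) (F W) p = 0"
proof -
  have z: "(\<lambda>p f. 0) = (0 :: 'a vfield)" by (simp add: fun_eq_iff)
  have "nijenhuis (J_structure \<alpha>1 \<alpha>2 Z1 Z2 \<phi>) X Y = 0" "nijenhuis (T_structure \<alpha>1 \<alpha>2 Z1 Z2 \<phi>) X Y = 0"
    using n X Y unfolding normal_pair_def integrable_acs_def z by blast+
  then have "ip (nijenhuis (J_structure \<alpha>1 \<alpha>2 Z1 Z2 \<phi>) X Y) (F W) p
      + ip (nijenhuis (T_structure \<alpha>1 \<alpha>2 Z1 Z2 \<phi>) X Y) (F W) p = 0"
    using W by simp
  then show ?thesis
    unfolding nijenhuis_eq endo_app_J endo_app_T
    using X Y W ip_br_P_F[OF X Y W, of p] by (simp del: FF)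
qed

lemma nijenhuis_phi:
  "X \<in> V \<Longrightarrow> Y \<in> V \<Longrightarrow> nijenhuis \<phi> X Y = DF (F X) Y - DF (F Y) X - F (DF X Y) + F (DF Y X)"
  by (rule nijenhuis_nabla[where D = DF]) (simp_all add: DF_def)

text \<open>Evaluated at a Reeb field, the torsion shows that the Lie derivative of
  \<open>\<phi>\<close> along this field vanishes. Then \<open>nabla_reeb_F\<close> becomes the
  Killing equation against the image of F; the Reeb directions are known.\<close>

lemma normal_imp_killing:
  assumes n: "normal_pair \<A> \<alpha>1 \<alpha>2 Z1 Z2 \<phi>" shows killing_condition
  unfolding killing_condition_def
proof (intro allI impI ballI)
  fix \<alpha> \<zeta> X Y p assume r: "reeb \<alpha> \<zeta>" and X: "X \<in> V" and Y: "Y \<in> V"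
  have \<zeta>: "\<zeta> \<in> V" "F \<zeta> = 0" using r unfolding reeb_def by auto
  have DF\<zeta>: "DF \<zeta> U = nabla (F U) \<zeta> - F (nabla U \<zeta>)" if U: "U \<in> V" for U
  proof -
    \<comment> \<open>This is the Lie derivative of \<open>\<phi>\<close> along
      \<open>\<zeta>\<close>, applied to U; the torsion of U and \<open>\<zeta>\<close> is
      \<open>F Q\<close>.\<close>
    define Q where "Q = F (br U \<zeta>) - br (F U) \<zeta>"
    have Q: "Q \<in> V" using U \<zeta> by (simp add: Q_def)
    have FQ: "ip (F Q) (F W) p = 0" if W: "W \<in> V" for W p
      using normal_imp_nijenhuis[OF n U \<zeta>(1) W, of p] U \<zeta> W
      by (simp add: nijenhuis_eq Q_def torsion del: FF)
    have "F Q = 0"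
      by (rule ext) (use ip_nondegenerate[OF F_closed[OF Q]] FQ[OF Q] in \<open>simp add: fun_eq_iff\<close>)
    have a: "form_app \<beta> (br (F U) \<zeta>) p = 0" if "reeb \<beta> Z'" for \<beta> Z' p
    proof -
      have "form_app \<beta> \<zeta> = (\<lambda>p. 1) \<or> form_app \<beta> \<zeta> = (\<lambda>p. 0)" "form_app \<beta> (F U) = (\<lambda>p. 0)"
        using that r U unfolding reeb_def by auto
      then show ?thesis
        using reeb_ext_d(2)[OF that r F_closed[OF U], of p] U \<zeta> by (auto simp: ext_d_eq)
    qed
    have "F (F Q) = - Q"
      using Q U \<zeta> a[OF reeb12(1)] a[OF reeb12(2)] by (simp add: Q_def vscale_apply fun_eq_iff)
    then have "Q = 0" using \<open>F Q = 0\<close> by simp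
    then have "nabla (F U) \<zeta> p f - F (nabla U \<zeta>) p f = nabla \<zeta> (F U) p f - F (nabla \<zeta> U) p f" for p f
      using U \<zeta> by (simp add: Q_def torsion fun_eq_iff algebra_simps)
    then show ?thesis by (simp add: DF_def fun_eq_iff)
  qed
  have K: "ip (nabla X \<zeta>) (F U) p + ip (nabla (F U) \<zeta>) X p = 0" if U: "U \<in> V" for U
    using nabla_reeb_F[OF r X U, of p] X U \<zeta> by (simp add: DF\<zeta>)
  have "nabla Z1 \<zeta> = 0" "nabla Z2 \<zeta> = 0"
    by (rule nabla_Z_Z[OF reeb12(1) r] nabla_Z_Z[OF reeb12(2) r])+
  moreover have "a1 (nabla X \<zeta>) p = 0" "a2 (nabla X \<zeta>) p = 0"
    using r a_nabla_Z[OF X] unfolding reeb_def by auto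
  ultimately have "ip (nabla X \<zeta>) Y p + ip (nabla Y \<zeta>) X p = 0"
    using K[OF F_closed[OF Y]] X Y \<zeta>(1) by simp
  then show "ip (nabla X \<zeta>) Y p = ext_d \<alpha> X Y p"
    using ext_d_nabla[OF r X Y, of p] by linarith
qed

text \<open>The Reeb components follow from skewness and the Killing equation. The last identity
  differentiates the formula for the square of F; its right-hand side comes from the Reeb terms of
  that formula.\<close>

lemma killing_DF:
  assumes K: killing_condition and X: "X \<in> V" and Y: "Y \<in> V"
  shows "a1 (DF X Y) p = - ext_d \<alpha>1 X (F Y) p" "a2 (DF X Y) p = - ext_d \<alpha>2 X (F Y) p"
    and "W \<in> V \<Longrightarrow> ip (DF X (F Y)) W p - ip (DF X Y) (F W) p =
      ext_d \<alpha>1 X Y p * a1 W p + a1 Y p * ext_d \<alpha>1 X W p +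
      ext_d \<alpha>2 X Y p * a2 W p + a2 Y p * ext_d \<alpha>2 X W p"
proof -
  have k: "ip (nabla X Z1) U p = ext_d \<alpha>1 X U p" "ip (nabla X Z2) U p = ext_d \<alpha>2 X U p"
    if "U \<in> V" for U
    using K X that reeb12 unfolding killing_condition_def by blast+
  show "a1 (DF X Y) p = - ext_d \<alpha>1 X (F Y) p" "a2 (DF X Y) p = - ext_d \<alpha>2 X (F Y) p"
    using DF_skew[OF X Y, of Z1 p] DF_skew[OF X Y, of Z2 p] DF_Z[OF X] k[OF F_closed[OF Y]]
      ip_F_skew[of "nabla X Z1" Y p] ip_F_skew[of "nabla X Z2" Y p] X Y by simp_all
  assume W: "W \<in> V"
  have d: "der X (a1 Y) p = a1 (nabla X Y) p + ext_d \<alpha>1 X Y p"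
    "der X (a2 Y) p = a2 (nabla X Y) p + ext_d \<alpha>2 X Y p"
    using compat[OF X Y, of Z1 p] compat[OF X Y, of Z2 p] k[OF Y]
      ip_sym[OF Y, of "nabla X Z1" p] ip_sym[OF Y, of "nabla X Z2" p] X Y by simp_all
  have "DF X (F Y) + F (DF X Y) = nabla X (F (F Y)) - F (F (nabla X Y))"
    using X Y by (simp add: DF_def del: FF)
  then have "ip (DF X (F Y) + F (DF X Y)) W p = ip (nabla X (F (F Y)) - F (F (nabla X Y))) W p"
    by simp
  moreover have "ip (nabla X (F (F Y)) - F (F (nabla X Y))) W p =
      ext_d \<alpha>1 X Y p * a1 W p + a1 Y p * ext_d \<alpha>1 X W p +
      ext_d \<alpha>2 X Y p * a2 W p + a2 Y p * ext_d \<alpha>2 X W p"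
    using X Y W k[OF W] by (simp add: d algebra_simps)
  moreover have "ip (DF X (F Y) + F (DF X Y)) W p = ip (DF X (F Y)) W p - ip (DF X Y) (F W) p"
    using X Y W ip_F_skew[of "DF X Y" W p] by simp
  ultimately show "ip (DF X (F Y)) W p - ip (DF X Y) (F W) p =
      ext_d \<alpha>1 X Y p * a1 W p + a1 Y p * ext_d \<alpha>1 X W p +
      ext_d \<alpha>2 X Y p * a2 W p + a2 Y p * ext_d \<alpha>2 X W p" by linarith
qed

text \<open>As for Kaehler manifolds: the Nijenhuis tensor evaluated on Y, W and paired with the image of X
  is twice the covariant derivative of the fundamental form, up to terms in the Reeb directions.\<close>

lemma normal_imp_DF_condition:
  assumes n: "normal_pair \<A> \<alpha>1 \<alpha>2 Z1 Z2 \<phi>" shows DF_condition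
  unfolding DF_condition_def
proof (intro ballI allI)
  fix X Y W p assume X: "X \<in> V" and Y: "Y \<in> V" and W: "W \<in> V"
  note K = normal_imp_killing[OF n]
  note FX = F_closed[OF X] and FY = F_closed[OF Y] and FW = F_closed[OF W]
  note eF = ext_d_F[OF reeb12(1)] ext_d_F[OF reeb12(2)]
  note sym = gam_sym[OF reeb12(1) Y X, of p] gam_sym[OF reeb12(2) Y X, of p]
      gam_sym[OF reeb12(1) W X, of p] gam_sym[OF reeb12(2) W X, of p]
      gam_sym[OF reeb12(1) W Y, of p] gam_sym[OF reeb12(2) W Y, of p]
  have FFi: "ip (DF U U') (F (F X)) p = - ip (DF U U') X p
      - a1 X p * ext_d \<alpha>1 U (F U') p - a2 X p * ext_d \<alpha>2 U (F U') p" if "U \<in> V" "U' \<in> V" for U U'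
    using that X killing_DF(1,2)[OF K that, of p] by simp
  have N: "ip (DF (F Y) W) (F X) p - ip (DF (F W) Y) (F X) p
      + ip (DF Y W) (F (F X)) p - ip (DF W Y) (F (F X)) p = 0"
    using normal_imp_nijenhuis[OF n Y W X, of p] X Y W FX FY FW
      ip_F_skew[of "DF Y W" "F X" p] ip_F_skew[of "DF W Y" "F X" p]
    by (simp add: nijenhuis_phi del: FF)
  have 1: "ip (DF (F Y) (F W)) X p - ip (DF (F Y) W) (F X) p =
      ext_d \<alpha>1 (F Y) W p * a1 X p + a1 W p * ext_d \<alpha>1 (F Y) X p +
      ext_d \<alpha>2 (F Y) W p * a2 X p + a2 W p * ext_d \<alpha>2 (F Y) X p"
    by (rule killing_DF(3)[OF K FY W X])
  have 2: "ip (DF (F W) (F Y)) X p - ip (DF (F W) Y) (F X) p =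
      ext_d \<alpha>1 (F W) Y p * a1 X p + a1 Y p * ext_d \<alpha>1 (F W) X p +
      ext_d \<alpha>2 (F W) Y p * a2 X p + a2 Y p * ext_d \<alpha>2 (F W) X p"
    by (rule killing_DF(3)[OF K FW Y X])
  have 3: "ip (DF X (F Y)) (F W) p - ip (DF X Y) (F (F W)) p =
      a1 Y p * ext_d \<alpha>1 X (F W) p + a2 Y p * ext_d \<alpha>2 X (F W) p"
    using killing_DF(3)[OF K X Y FW, of p] W by (simp del: FF)
  have 4: "ip (DF X Y) (F (F W)) p = - ip (DF X Y) W p
      - a1 W p * ext_d \<alpha>1 X (F Y) p - a2 W p * ext_d \<alpha>2 X (F Y) p"
    using X Y W killing_DF(1,2)[OF K X Y, of p] by simp
  \<comment> \<open>Up to Reeb terms, N and 1 to 4 turn c1 into: \<open>DF Y W\<close> against X,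
    minus \<open>DF W Y\<close> against X, minus \<open>DF X Y\<close> against W, is zero. By c2 the
    first two together equal minus the product of \<open>DF X Y\<close> and W, whence the factor 2
    below.\<close>
  note c1 = DF_cyclic[OF FY FW X, of p] DF_skew[OF FW X FY, of p]
  note c2 = DF_cyclic[OF X Y W, of p] DF_skew[OF W X Y, of p]
  have "2 * ip (DF X Y) W p = 2 * (
       (a1 W p * gam \<alpha>1 X Y p - a1 Y p * gam \<alpha>1 X W p) +
       (a2 W p * gam \<alpha>2 X Y p - a2 Y p * gam \<alpha>2 X W p))"
    using N[unfolded FFi[OF Y W] FFi[OF W Y]] 1 2 3 4 c1 c2
    by (simp only: eF X Y W sym) (simp add: algebra_simps)
  then show "ip (DF X Y) W p =
       (a1 W p * gam \<alpha>1 X Y p - a1 Y p * gam \<alpha>1 X W p) +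
       (a2 W p * gam \<alpha>2 X Y p - a2 Y p * gam \<alpha>2 X W p)" by simp
qed

section \<open>The equivalence and its translation into orthogonal projections\<close>

lemma normal_iff_curvature_condition:
  "normal_pair \<A> \<alpha>1 \<alpha>2 Z1 Z2 \<phi> \<longleftrightarrow> curvature_condition"
  using normal_imp_DF_condition DF_condition_imp_killing DF_condition_imp_curvature_condition
    curvature_condition_imp_DF_condition DF_condition_imp_normal by blast

lemma curvature_at_iff:
  assumes X: "X \<in> V" and Y: "Y \<in> V"
  shows "(let X1 = orth_proj g p (char_space \<A> \<alpha>2 p) (X p);
           Y1 = orth_proj g p (char_space \<A> \<alpha>2 p) (Y p);
           X2 = orth_proj g p (char_space \<A> \<alpha>1 p) (X p);
           Y2 = orth_proj g p (char_space \<A> \<alpha>1 p) (Y p)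
       in curvature nabla X Y (vadd Z1 Z2) p =
            (\<lambda>f. (\<alpha>1 p Y1 * X1 f - \<alpha>1 p X1 * Y1 f) + (\<alpha>2 p Y2 * X2 f - \<alpha>2 p X2 * Y2 f)))
    \<longleftrightarrow> (\<forall>W\<in>V. ip (curvature nabla X Y (Z1 + Z2)) W p =
       (a1 Y p * gam \<alpha>1 X W p - a1 X p * gam \<alpha>1 Y W p) +
       (a2 Y p * gam \<alpha>2 X W p - a2 X p * gam \<alpha>2 Y W p))"
proof -
  have proj: "\<exists>X1 X2. X1 \<in> V \<and> X2 \<in> V \<and> a1 X1 p = a1 X p \<and> a2 X2 p = a2 X p \<and>
      (\<forall>W\<in>V. ip X1 W p = gam \<alpha>1 X W p \<and> ip X2 W p = gam \<alpha>2 X W p) \<and>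
      orth_proj g p (char_space \<A> \<alpha>2 p) (X p) = X1 p \<and>
      orth_proj g p (char_space \<A> \<alpha>1 p) (X p) = X2 p" if X: "X \<in> V" for X
  proof -
    obtain X1 X2 where x: "X1 \<in> V" "X2 \<in> V" "X p = (X1 + X2) p"
      "X1 p \<in> char_space \<A> \<alpha>2 p" "X2 p \<in> char_space \<A> \<alpha>1 p"
      "a1 X1 p = a1 X p" "a2 X2 p = a2 X p"
      "\<And>W. W \<in> V \<Longrightarrow> ip X1 W p = gam \<alpha>1 X W p" "\<And>W. W \<in> V \<Longrightarrow> ip X2 W p = gam \<alpha>2 X W p"
      by (rule foliation_splitting[OF X, of p], rule that)
    have d: "(X - X1) p = X2 p" "(X - X2) p = X1 p" using x(3) by (simp_all add: fun_eq_iff)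
    have "orth_proj g p (char_space \<A> \<alpha>2 p) (X p) = X1 p"
      by (rule orth_proj_eq[OF X forms(2) x(1,4)]) (simp only: d char_spaces_orthogonal[OF x(5)])
    moreover have "orth_proj g p (char_space \<A> \<alpha>1 p) (X p) = X2 p"
    proof (rule orth_proj_eq[OF X forms(1) x(2,5)])
      fix w assume w: "w \<in> char_space \<A> \<alpha>1 p"
      obtain W where W: "W \<in> V" "w = W p" by (rule char_spaceE[OF w], rule that)
      show "g p ((X - X2) p) w = 0"
        using char_spaces_orthogonal[OF w x(4)] ip_sym[OF x(1) W(1), of p]
        unfolding d W(2) by (simp only: inner_app_def)
    qed
    ultimately show ?thesis using x(1,2,6-9) by blast
  qed
  obtain X1 X2 where x: "X1 \<in> V" "X2 \<in> V" "a1 X1 p = a1 X p" "a2 X2 p = a2 X p"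
      "\<forall>W\<in>V. ip X1 W p = gam \<alpha>1 X W p \<and> ip X2 W p = gam \<alpha>2 X W p"
      "orth_proj g p (char_space \<A> \<alpha>2 p) (X p) = X1 p"
      "orth_proj g p (char_space \<A> \<alpha>1 p) (X p) = X2 p"
    using proj[OF X] by (elim exE conjE) (rule that)
  obtain Y1 Y2 where y: "Y1 \<in> V" "Y2 \<in> V" "a1 Y1 p = a1 Y p" "a2 Y2 p = a2 Y p"
      "\<forall>W\<in>V. ip Y1 W p = gam \<alpha>1 Y W p \<and> ip Y2 W p = gam \<alpha>2 Y W p"
      "orth_proj g p (char_space \<A> \<alpha>2 p) (Y p) = Y1 p"
      "orth_proj g p (char_space \<A> \<alpha>1 p) (Y p) = Y2 p"
    using proj[OF Y] by (elim exE conjE) (rule that)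
  define c where "c = curvature nabla X Y (Z1 + Z2)"
  \<comment> \<open>The coefficients are frozen at p: R is a global field that represents the
    right-hand side at this point only, which is enough for testing there.\<close>
  define R where "R = vscale (\<lambda>_. a1 Y p) X1 - vscale (\<lambda>_. a1 X p) Y1
    + (vscale (\<lambda>_. a2 Y p) X2 - vscale (\<lambda>_. a2 X p) Y2)"
  have R: "R \<in> V" and c: "c \<in> V" using x y X Y by (simp_all add: R_def c_def)
  have ipR: "ip R W p = (a1 Y p * gam \<alpha>1 X W p - a1 X p * gam \<alpha>1 Y W p) +
       (a2 Y p * gam \<alpha>2 X W p - a2 X p * gam \<alpha>2 Y W p)" if "W \<in> V" for W
    using x y that by (simp add: R_def)
  have "\<alpha>1 p (X1 p) = a1 X p" "\<alpha>2 p (X2 p) = a2 X p" "\<alpha>1 p (Y1 p) = a1 Y p" "\<alpha>2 p (Y2 p) = a2 Y p"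
    using x(3,4) y(3,4) by (simp_all add: form_app_def)
  then have "(\<lambda>f. (\<alpha>1 p (Y1 p) * X1 p f - \<alpha>1 p (X1 p) * Y1 p f)
      + (\<alpha>2 p (Y2 p) * X2 p f - \<alpha>2 p (X2 p) * Y2 p f)) = R p"
    by (simp add: R_def vscale_apply fun_eq_iff)
  moreover have "c p = R p \<longleftrightarrow> (\<forall>W\<in>V. ip c W p = ip R W p)"
    using ip_eqI[OF c R] inner_app_cong[of c p R] by blast
  ultimately show ?thesis
    unfolding x(6,7) y(6,7) Let_def vadd_eq c_def[symmetric] by (simp add: ipR)
qed

end

theorem theorem6:
  fixes \<A> :: "('a::{t2_space,second_countable_topology}, 'e::euclidean_space) chart set"
    and h k :: nat
    and \<alpha>1 \<alpha>2 :: "'a oneform"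
    and Z1 Z2 :: "'a vfield"
    and \<phi> :: "'a endofield"
    and g :: "'a bilin"
    and nabla :: "'a connection"
  assumes "smooth_atlas \<A>"
    and "metric_contact_pair \<A> h k \<alpha>1 \<alpha>2 Z1 Z2 \<phi> g"
    and "decomposable \<A> \<alpha>1 \<alpha>2 \<phi>"
    and "levi_civita \<A> g nabla"
  shows "normal_pair \<A> \<alpha>1 \<alpha>2 Z1 Z2 \<phi> \<longleftrightarrow>
    (\<forall>X\<in>vfields \<A>. \<forall>Y\<in>vfields \<A>. \<forall>p.
       let X1 = orth_proj g p (char_space \<A> \<alpha>2 p) (X p);
           Y1 = orth_proj g p (char_space \<A> \<alpha>2 p) (Y p);
           X2 = orth_proj g p (char_space \<A> \<alpha>1 p) (X p);
           Y2 = orth_proj g p (char_space \<A> \<alpha>1 p) (Y p)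
       in curvature nabla X Y (vadd Z1 Z2) p =
            (\<lambda>f. (\<alpha>1 p Y1 * X1 f - \<alpha>1 p X1 * Y1 f) + (\<alpha>2 p Y2 * X2 f - \<alpha>2 p X2 * Y2 f)))"
proof -
  interpret metric_contact_pair_manifold \<A> h k \<alpha>1 \<alpha>2 Z1 Z2 \<phi> g nabla
    using assms by unfold_locales
  show ?thesis
    unfolding normal_iff_curvature_condition curvature_condition_def
    using curvature_at_iff by (simp cong: ball_cong) blast
qed

end
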